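(* There is an algorithm running in time $O(|A|+|B|+|E|)$ that, given a marriage instance $G=(A\cup B,E)$ with strict preferences, decides whether $G$ admits a fully popular matching, and if it does, returns a fully popular matching of maximum size (i.e., a fully popular matching $M$ with $|M|\ge |N|$ for every fully popular matching $N$ of $G$).
   Context: A marriage instance is a bipartite graph $G=(A\cup B,E)$ (vertices of $A$ are called agents, those of $B$ jobs) in which every vertex has a strict ranking of its neighbors. For matchings $M,N$ of $G$, a vertex prefers $M$ to $N$ if it gets a better assignment in $M$ than in $N$, where being unmatched is worse than being matched to any neighbor; $\phi(M,N)$ is the number of vertices of $A\cup B$ preferring $M$ to $N$, and $\phi_A(M,N)$ is the number of vertices of $A$ preferring $M$ to $N$. A matching $M$ is popular if $\phi(M,N)\ge\phi(N,M)$ for all matchings $N$ of $G$; it is $A$-popular if $\phi_A(M,N)\ge\phi_A(N,M)$ for all matchings $N$; it is fully popular if it is both popular and $A$-popular. The size of a matching is its number of edges. *)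

theory Defs
  imports "HOL-Library.Landau_Symbols"
begin

section \<open>Marriage instances and popularity\<close>

text \<open>A strict ranking of a finite set is a duplicate-free list of its elements, most preferred
  element first. Agents and jobs live on different sides, so the two vertex sets are disjoint by
  construction even when \<open>'a = 'b\<close>.\<close>

record ('a, 'b) marriage =
  agents :: "'a set"
  jobs :: "'b set"
  edges :: "('a \<times> 'b) set"
  agent_ranking :: "'a \<Rightarrow> 'b list"
  job_ranking :: "'b \<Rightarrow> 'a list"

definition marriage_instance :: "('a, 'b) marriage \<Rightarrow> bool" where
  "marriage_instance G \<longleftrightarrow>
     finite (agents G) \<and> finite (jobs G) \<and> edges G \<subseteq> agents G \<times> jobs G \<and>
     (\<forall>a \<in> agents G. distinct (agent_ranking G a) \<and>
        set (agent_ranking G a) = {b. (a, b) \<in> edges G}) \<and>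
     (\<forall>b \<in> jobs G. distinct (job_ranking G b) \<and>
        set (job_ranking G b) = {a. (a, b) \<in> edges G})"

definition matching :: "('a, 'b) marriage \<Rightarrow> ('a \<times> 'b) set \<Rightarrow> bool" where
  "matching G M \<longleftrightarrow> M \<subseteq> edges G \<and>
     (\<forall>a b b'. (a, b) \<in> M \<longrightarrow> (a, b') \<in> M \<longrightarrow> b = b') \<and>
     (\<forall>a a' b. (a, b) \<in> M \<longrightarrow> (a', b) \<in> M \<longrightarrow> a = a')"

definition ranked_before :: "'c list \<Rightarrow> 'c \<Rightarrow> 'c \<Rightarrow> bool" where
  "ranked_before xs x y \<longleftrightarrow> (\<exists>i j. i < j \<and> j < length xs \<and> xs ! i = x \<and> xs ! j = y)"

text \<open>The universal quantifier below covers both ways of being better off: it is vacuous if the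
  vertex is unmatched in \<open>N\<close>, and otherwise compares the two partners.\<close>

definition agent_prefers ::
  "('a, 'b) marriage \<Rightarrow> 'a \<Rightarrow> ('a \<times> 'b) set \<Rightarrow> ('a \<times> 'b) set \<Rightarrow> bool" where
  "agent_prefers G a M N \<longleftrightarrow>
     (\<exists>b. (a, b) \<in> M \<and> (\<forall>b'. (a, b') \<in> N \<longrightarrow> ranked_before (agent_ranking G a) b b'))"

definition job_prefers ::
  "('a, 'b) marriage \<Rightarrow> 'b \<Rightarrow> ('a \<times> 'b) set \<Rightarrow> ('a \<times> 'b) set \<Rightarrow> bool" where
  "job_prefers G b M N \<longleftrightarrow>
     (\<exists>a. (a, b) \<in> M \<and> (\<forall>a'. (a', b) \<in> N \<longrightarrow> ranked_before (job_ranking G b) a a'))"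

definition phi_A :: "('a, 'b) marriage \<Rightarrow> ('a \<times> 'b) set \<Rightarrow> ('a \<times> 'b) set \<Rightarrow> nat" where
  "phi_A G M N = card {a \<in> agents G. agent_prefers G a M N}"

definition phi :: "('a, 'b) marriage \<Rightarrow> ('a \<times> 'b) set \<Rightarrow> ('a \<times> 'b) set \<Rightarrow> nat" where
  "phi G M N = card {a \<in> agents G. agent_prefers G a M N} + card {b \<in> jobs G. job_prefers G b M N}"

definition popular :: "('a, 'b) marriage \<Rightarrow> ('a \<times> 'b) set \<Rightarrow> bool" where
  "popular G M \<longleftrightarrow> matching G M \<and> (\<forall>N. matching G N \<longrightarrow> phi G M N \<ge> phi G N M)"

definition A_popular :: "('a, 'b) marriage \<Rightarrow> ('a \<times> 'b) set \<Rightarrow> bool" where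
  "A_popular G M \<longleftrightarrow> matching G M \<and> (\<forall>N. matching G N \<longrightarrow> phi_A G M N \<ge> phi_A G N M)"

definition fully_popular :: "('a, 'b) marriage \<Rightarrow> ('a \<times> 'b) set \<Rightarrow> bool" where
  "fully_popular G M \<longleftrightarrow> popular G M \<and> A_popular G M"

definition max_fully_popular :: "('a, 'b) marriage \<Rightarrow> ('a \<times> 'b) set \<Rightarrow> bool" where
  "max_fully_popular G M \<longleftrightarrow> fully_popular G M \<and> (\<forall>N. fully_popular G N \<longrightarrow> card M \<ge> card N)"

definition input_size :: "('a, 'b) marriage \<Rightarrow> nat" where
  "input_size G = card (agents G) + card (jobs G) + card (edges G)"


section \<open>A unit-cost word RAM\<close>

text \<open>Algorithms are programs of a structured random access machine with registers and a fixed
  finite number of arrays (an array is named by a constant of the program, so it cannot be computed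
  at run time; cells inside an array are addressed indirectly). Every elementary instruction and
  every test costs one time unit. The only arithmetic is addition and truncated subtraction, and a
  run is stuck as soon as it would produce a value or write to an address exceeding the word
  bound \<open>W\<close>.\<close>

datatype operand = Num nat | Reg nat

datatype expr = Opd operand | Add operand operand | Sub operand operand | Load nat operand

datatype test = Less operand operand | Equal operand operand

datatype prog =
    Skip
  | Assign nat expr
  | Store nat operand operand \<comment> \<open>array, index, value\<close>
  | Seq prog prog
  | Cond test prog prog
  | While test prog

record state =
  reg :: "nat \<Rightarrow> nat"
  mem :: "nat \<Rightarrow> nat \<Rightarrow> nat" \<comment> \<open>array, index\<close>

fun operand_val :: "operand \<Rightarrow> state \<Rightarrow> nat" where
  "operand_val (Num n) s = n"
| "operand_val (Reg x) s = reg s x"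

fun expr_val :: "expr \<Rightarrow> state \<Rightarrow> nat" where
  "expr_val (Opd u) s = operand_val u s"
| "expr_val (Add u v) s = operand_val u s + operand_val v s"
| "expr_val (Sub u v) s = operand_val u s - operand_val v s"
| "expr_val (Load d u) s = mem s d (operand_val u s)"

fun test_val :: "test \<Rightarrow> state \<Rightarrow> bool" where
  "test_val (Less u v) s \<longleftrightarrow> operand_val u s < operand_val v s"
| "test_val (Equal u v) s \<longleftrightarrow> operand_val u s = operand_val v s"

definition set_reg :: "nat \<Rightarrow> nat \<Rightarrow> state \<Rightarrow> state" where
  "set_reg x n s = s\<lparr>reg := (reg s)(x := n)\<rparr>"

definition set_mem :: "nat \<Rightarrow> nat \<Rightarrow> nat \<Rightarrow> state \<Rightarrow> state" where
  "set_mem d i n s = s\<lparr>mem := (mem s)(d := (mem s d)(i := n))\<rparr>"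

text \<open>\<open>exec W p s t s'\<close>: with word bound \<open>W\<close>, program \<open>p\<close> started in \<open>s\<close> halts in \<open>s'\<close> after
  \<open>t\<close> time units.\<close>

inductive exec :: "nat \<Rightarrow> prog \<Rightarrow> state \<Rightarrow> nat \<Rightarrow> state \<Rightarrow> bool" for W :: nat where
  exec_Skip: "exec W Skip s 1 s"
| exec_Assign: "expr_val e s \<le> W \<Longrightarrow> exec W (Assign x e) s 1 (set_reg x (expr_val e s) s)"
| exec_Store: "operand_val u s \<le> W \<Longrightarrow> operand_val v s \<le> W \<Longrightarrow>
    exec W (Store d u v) s 1 (set_mem d (operand_val u s) (operand_val v s) s)"
| exec_Seq: "exec W p s t s' \<Longrightarrow> exec W q s' t' s'' \<Longrightarrow> exec W (Seq p q) s (t + t') s''"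
| exec_CondT: "test_val b s \<Longrightarrow> exec W p s t s' \<Longrightarrow> exec W (Cond b p q) s (Suc t) s'"
| exec_CondF: "\<not> test_val b s \<Longrightarrow> exec W q s t s' \<Longrightarrow> exec W (Cond b p q) s (Suc t) s'"
| exec_WhileF: "\<not> test_val b s \<Longrightarrow> exec W (While b p) s 1 s"
| exec_WhileT: "test_val b s \<Longrightarrow> exec W p s t s' \<Longrightarrow> exec W (While b p) s' t' s'' \<Longrightarrow>
    exec W (While b p) s (Suc (t + t')) s''"

inductive_cases exec_SkipE: "exec W Skip s t s'"
inductive_cases exec_AssignE: "exec W (Assign x e) s t s'"
inductive_cases exec_StoreE: "exec W (Store d u v) s t s'"
inductive_cases exec_SeqE: "exec W (Seq p q) s t s'"
inductive_cases exec_CondE: "exec W (Cond b p q) s t s'"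
inductive_cases exec_WhileE: "exec W (While b p) s t s'"

lemma exec_deterministic:
  "exec W p s t s' \<Longrightarrow> exec W p s u s'' \<Longrightarrow> t = u \<and> s' = s''"
proof (induction arbitrary: u s'' rule: exec.induct)
  case exec_Skip
  then show ?case by (rule exec_SkipE) simp
next
  case exec_Assign
  from exec_Assign.prems show ?case by (rule exec_AssignE) simp
next
  case exec_Store
  from exec_Store.prems show ?case by (rule exec_StoreE) simp
next
  case exec_Seq
  from exec_Seq.prems show ?case by (rule exec_SeqE) (use exec_Seq.IH in blast)
next
  case exec_CondT
  from exec_CondT.prems show ?case
    by (rule exec_CondE) (use exec_CondT.IH exec_CondT.hyps in blast)+
next
  case exec_CondF
  from exec_CondF.prems show ?case
    by (rule exec_CondE) (use exec_CondF.IH exec_CondF.hyps in blast)+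
next
  case exec_WhileF
  from exec_WhileF.prems show ?case
    by (rule exec_WhileE) (use exec_WhileF.hyps in simp_all)
next
  case exec_WhileT
  from exec_WhileT.prems show ?case
    by (rule exec_WhileE) (use exec_WhileT.IH exec_WhileT.hyps in blast)+
qed


section \<open>Input and output\<close>

text \<open>Inputs have their agents numbered \<open>0, \<dots>, |A| - 1\<close> and their jobs \<open>0, \<dots>, |B| - 1\<close>.\<close>

definition numbered :: "(nat, nat) marriage \<Rightarrow> bool" where
  "numbered G \<longleftrightarrow> agents G = {..<card (agents G)} \<and> jobs G = {..<card (jobs G)}"

definition array :: "nat list \<Rightarrow> nat \<Rightarrow> nat" where
  "array xs i = (if i < length xs then xs ! i else 0)"

text \<open>The rankings \<open>f 0, \<dots>, f (n - 1)\<close> are stored back to back in one array; ranking \<open>f i\<close>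
  occupies the cells from \<open>offset f i\<close> up to but excluding \<open>offset f (Suc i)\<close>.\<close>

definition offset :: "(nat \<Rightarrow> nat list) \<Rightarrow> nat \<Rightarrow> nat" where
  "offset f i = (\<Sum>j<i. length (f j))"

definition offset_array :: "(nat \<Rightarrow> nat list) \<Rightarrow> nat \<Rightarrow> nat \<Rightarrow> nat" where
  "offset_array f n = array (map (offset f) [0..<Suc n])"

definition ranking_array :: "(nat \<Rightarrow> nat list) \<Rightarrow> nat \<Rightarrow> nat \<Rightarrow> nat" where
  "ranking_array f n = array (concat (map f [0..<n]))"

text \<open>The input is given by adjacency lists in preference order only; in particular, no constant
  time access to the rank of a given neighbour is provided.\<close>

definition input_state :: "(nat, nat) marriage \<Rightarrow> state" where
  "input_state G = \<lparr>
     reg = (\<lambda>_. 0)(0 := card (agents G), 1 := card (jobs G)),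
     mem = (\<lambda>_ _. 0)(
       0 := offset_array (agent_ranking G) (card (agents G)),
       1 := ranking_array (agent_ranking G) (card (agents G)),
       2 := offset_array (job_ranking G) (card (jobs G)),
       3 := ranking_array (job_ranking G) (card (jobs G)))\<rparr>"

text \<open>On halting, register \<open>0\<close> holds the decision (\<open>1\<close> for yes, \<open>0\<close> for no), and cell \<open>a\<close> of
  array \<open>0\<close> holds \<open>0\<close> if agent \<open>a\<close> is unmatched and \<open>Suc b\<close> if \<open>a\<close> is matched to job \<open>b\<close>.\<close>

definition output_matching :: "(nat, nat) marriage \<Rightarrow> state \<Rightarrow> (nat \<times> nat) set" where
  "output_matching G s = {(a, b). a \<in> agents G \<and> mem s 0 a = Suc b}"

definition correct_output :: "(nat, nat) marriage \<Rightarrow> state \<Rightarrow> bool" where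
  "correct_output G s \<longleftrightarrow>
     (if \<exists>M. fully_popular G M
      then reg s 0 = 1 \<and> max_fully_popular G (output_matching G s)
      else reg s 0 = 0)"

end

theory Submission imports Defs begin

text \<open>A popular matching is certified by dual values in \<open>{-1, 0, 1}\<close>. In a fully popular
  matching each agent gets its first choice or its best job that is nobody's first choice, and
  the vertices of dual value \<open>0\<close> are matched as in the agent-optimal stable matching \<open>S\<close>. A
  vertex with its partner and its dual value thus has few possible states. Put into a suitable
  order, with dual value \<open>0\<close> best for agents and worst for jobs, the certified fully popular
  matchings are closed under giving every agent the worse and every job the better of its two
  states, so if there is one, then there is an extreme one. It is found in the manner of Gale
  and Shapley by letting jobs propose, starting from their best states, while recording lower
  bounds for the states of the agents that hold in every solution. An agent that receives no
  proposal has dual value \<open>0\<close> in every solution, which forces its partner in \<open>S\<close> to dual value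
  \<open>0\<close>, too. A vertex of nonzero dual value is always matched, so the extreme solution, which has
  the fewest zeros, matches every vertex that some fully popular matching matches.\<close>

section \<open>Ranks and certificates\<close>

text \<open>Dual values enter because comparing \<open>M\<close> with all rivals is a maximum weight
  matching problem in which an edge weighs the votes of its two ends. That the dual values can be
  chosen integral is obtained without linear programming: popularity forbids cycles of positive
  weight in an alternating digraph, and the weights of best walks are then a certificate.

  The chains put the dual value before the partner because of the edge inequalities: only in that
  order does a job that has moved beyond an agent bound the state of this agent from below in every
  solution at once.

  The obstacle to plain deferred acceptance is dual value 0. No proposal announces it, it ties a
  vertex to its partner in \<open>S\<close>, and it may turn out to be forced long after the vertex
  found a seat. This is why jobs carry flags, why seats can be revoked, and why the list of an agent
  is scanned when its bound becomes 4. An agent without a proposal is recognized as zero by a global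
  counting argument, which is valid only when all jobs have come to rest.\<close>

definition pos :: "'c list \<Rightarrow> 'c \<Rightarrow> nat" where
  "pos xs x = length (takeWhile (\<lambda>y. y \<noteq> x) xs)"

lemma pos_less: "x \<in> set xs \<Longrightarrow> pos xs x < length xs"
  unfolding pos_def by (induction xs) auto

lemma nth_pos: "x \<in> set xs \<Longrightarrow> xs ! pos xs x = x"
  unfolding pos_def by (induction xs) auto

lemma pos_nth: "distinct xs \<Longrightarrow> i < length xs \<Longrightarrow> pos xs (xs ! i) = i"
  by (metis nth_eq_iff_index_eq nth_mem nth_pos pos_less)

lemma ranked_before_iff:
  "distinct xs \<Longrightarrow> ranked_before xs x y \<longleftrightarrow> x \<in> set xs \<and> y \<in> set xs \<and> pos xs x < pos xs y"
  unfolding ranked_before_def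
proof (intro iffI; elim exE conjE)
  fix i j assume "distinct xs" "i < j" "j < length xs" "xs ! i = x" "xs ! j = y"
  then show "x \<in> set xs \<and> y \<in> set xs \<and> pos xs x < pos xs y"
    using pos_nth[of xs i] pos_nth[of xs j] by auto
next
  assume "x \<in> set xs" "y \<in> set xs" "pos xs x < pos xs y"
  then show "\<exists>i j. i < j \<and> j < length xs \<and> xs ! i = x \<and> xs ! j = y"
    using nth_pos[of x xs] nth_pos[of y xs] pos_less[of y xs] by blast
qed

lemma sgn_int_simps:
  "0 < d \<Longrightarrow> sgn (d::int) = 1" "d < 0 \<Longrightarrow> sgn (d::int) = - 1"
  by auto

locale marriage =
  fixes G :: "('a, 'b) marriage"
  assumes inst: "marriage_instance G"
begin

definition da :: "'a \<Rightarrow> nat" where "da a = length (agent_ranking G a)"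
definition db :: "'b \<Rightarrow> nat" where "db b = length (job_ranking G b)"
definition ra :: "'a \<Rightarrow> 'b \<Rightarrow> nat" where "ra a b = pos (agent_ranking G a) b"
definition rb :: "'b \<Rightarrow> 'a \<Rightarrow> nat" where "rb b a = pos (job_ranking G b) a"

text \<open>An unmatched vertex gets the length of its list, one more than its worst rank.\<close>

definition ka :: "('a \<times> 'b) set \<Rightarrow> 'a \<Rightarrow> nat" where
  "ka M a = (if \<exists>b. (a, b) \<in> M then ra a (THE b. (a, b) \<in> M) else da a)"
definition kb :: "('a \<times> 'b) set \<Rightarrow> 'b \<Rightarrow> nat" where
  "kb M b = (if \<exists>a. (a, b) \<in> M then rb b (THE a. (a, b) \<in> M) else db b)"

lemma finite_agents [simp]: "finite (agents G)" and finite_jobs [simp]: "finite (jobs G)"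
  using inst by (auto simp: marriage_instance_def)

lemma edge_vertices: "(a, b) \<in> edges G \<Longrightarrow> a \<in> agents G \<and> b \<in> jobs G"
  using inst by (auto simp: marriage_instance_def)

lemma agent_list: "a \<in> agents G \<Longrightarrow> distinct (agent_ranking G a)"
  "a \<in> agents G \<Longrightarrow> b \<in> set (agent_ranking G a) \<longleftrightarrow> (a, b) \<in> edges G"
  using inst by (auto simp: marriage_instance_def)

lemma job_list: "b \<in> jobs G \<Longrightarrow> distinct (job_ranking G b)"
  "b \<in> jobs G \<Longrightarrow> a \<in> set (job_ranking G b) \<longleftrightarrow> (a, b) \<in> edges G"
  using inst by (auto simp: marriage_instance_def)

lemma ra_less: "(a, b) \<in> edges G \<Longrightarrow> ra a b < da a"
  unfolding ra_def da_def using agent_list edge_vertices by (metis pos_less)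

lemma rb_less: "(a, b) \<in> edges G \<Longrightarrow> rb b a < db b"
  unfolding rb_def db_def using job_list edge_vertices by (metis pos_less)

lemma nth_ra: "(a, b) \<in> edges G \<Longrightarrow> agent_ranking G a ! ra a b = b"
  unfolding ra_def using agent_list edge_vertices by (metis nth_pos)

lemma nth_rb: "(a, b) \<in> edges G \<Longrightarrow> job_ranking G b ! rb b a = a"
  unfolding rb_def using job_list edge_vertices by (metis nth_pos)

lemma agent_nth: "a \<in> agents G \<Longrightarrow> i < da a \<Longrightarrow>
    (a, agent_ranking G a ! i) \<in> edges G \<and> ra a (agent_ranking G a ! i) = i"
  unfolding ra_def da_def using agent_list by (metis nth_mem pos_nth)

lemma job_nth: "b \<in> jobs G \<Longrightarrow> i < db b \<Longrightarrow>
    (job_ranking G b ! i, b) \<in> edges G \<and> rb b (job_ranking G b ! i) = i"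
  unfolding rb_def db_def using job_list by (metis nth_mem pos_nth)

lemma ra_inj: "(a, b) \<in> edges G \<Longrightarrow> (a, b') \<in> edges G \<Longrightarrow> ra a b = ra a b' \<longleftrightarrow> b = b'"
  by (metis nth_ra)

lemma rb_inj: "(a, b) \<in> edges G \<Longrightarrow> (a', b) \<in> edges G \<Longrightarrow> rb b a = rb b a' \<longleftrightarrow> a = a'"
  by (metis nth_rb)

lemma matchingD:
  assumes "matching G M"
  shows "(a, b) \<in> M \<Longrightarrow> (a, b) \<in> edges G"
    "(a, b) \<in> M \<Longrightarrow> (a, b') \<in> M \<Longrightarrow> b = b'"
    "(a, b) \<in> M \<Longrightarrow> (a', b) \<in> M \<Longrightarrow> a = a'"
  using assms unfolding matching_def by blast+

lemma ka_matched: "matching G M \<Longrightarrow> (a, b) \<in> M \<Longrightarrow> ka M a = ra a b"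
  unfolding ka_def using matchingD(2) by (metis (no_types, lifting) theI)

lemma kb_matched: "matching G M \<Longrightarrow> (a, b) \<in> M \<Longrightarrow> kb M b = rb b a"
  unfolding kb_def using matchingD(3) by (metis (no_types, lifting) theI)

lemma ka_unmatched: "(\<And>b. (a, b) \<notin> M) \<Longrightarrow> ka M a = da a"
  by (simp add: ka_def)

lemma kb_unmatched: "(\<And>a. (a, b) \<notin> M) \<Longrightarrow> kb M b = db b"
  by (simp add: kb_def)

lemma ka_le: "matching G M \<Longrightarrow> ka M a \<le> da a"
  by (metis ka_matched ka_unmatched matchingD(1) less_or_eq_imp_le ra_less)

lemma kb_le: "matching G M \<Longrightarrow> kb M b \<le> db b"
  by (metis kb_matched kb_unmatched matchingD(1) less_or_eq_imp_le rb_less)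

lemma ka_less_iff: "matching G M \<Longrightarrow> ka M a < da a \<longleftrightarrow> (\<exists>b. (a, b) \<in> M)"
  by (metis ka_matched ka_unmatched less_irrefl matchingD(1) ra_less)

lemma kb_less_iff: "matching G M \<Longrightarrow> kb M b < db b \<longleftrightarrow> (\<exists>a. (a, b) \<in> M)"
  by (metis kb_matched kb_unmatched less_irrefl matchingD(1) rb_less)

lemma ka_eq_ra: "matching G M \<Longrightarrow> (a, b) \<in> edges G \<Longrightarrow> ka M a = ra a b \<longleftrightarrow> (a, b) \<in> M"
  by (metis ka_less_iff ka_matched matchingD(1) ra_inj ra_less)

lemma kb_eq_rb: "matching G M \<Longrightarrow> (a, b) \<in> edges G \<Longrightarrow> kb M b = rb b a \<longleftrightarrow> (a, b) \<in> M"
  by (metis kb_less_iff kb_matched matchingD(1) rb_inj rb_less)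

lemma agent_prefers_iff:
  assumes "matching G M" "matching G N" "a \<in> agents G"
  shows "agent_prefers G a M N \<longleftrightarrow> ka M a < ka N a"
proof (cases "\<exists>b. (a, b) \<in> M")
  case False
  then show ?thesis
    using ka_le[OF assms(2), of a] ka_unmatched[of a M] by (auto simp: agent_prefers_def)
next
  case True
  then obtain b where b: "(a, b) \<in> M" by blast
  then have *: "agent_prefers G a M N \<longleftrightarrow>
      (\<forall>b'. (a, b') \<in> N \<longrightarrow> ranked_before (agent_ranking G a) b b')"
    unfolding agent_prefers_def using matchingD(2)[OF assms(1)] by blast
  have e: "(a, b) \<in> edges G" using b assms(1) matchingD(1) by blast
  show ?thesis
  proof (cases "\<exists>b'. (a, b') \<in> N")
    case False
    then show ?thesis using * ka_unmatched[of a N] ra_less[OF e] ka_matched[OF assms(1) b] by auto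
  next
    case True
    then obtain b' where b': "(a, b') \<in> N" by blast
    have e': "(a, b') \<in> edges G" using b' assms(2) matchingD(1) by blast
    have "agent_prefers G a M N \<longleftrightarrow> ranked_before (agent_ranking G a) b b'"
      using * b' matchingD(2)[OF assms(2)] by blast
    also have "\<dots> \<longleftrightarrow> ra a b < ra a b'"
      using e e' agent_list[OF assms(3)] by (simp add: ranked_before_iff ra_def)
    finally show ?thesis using ka_matched[OF assms(1) b] ka_matched[OF assms(2) b'] by simp
  qed
qed

lemma job_prefers_iff:
  assumes "matching G M" "matching G N" "b \<in> jobs G"
  shows "job_prefers G b M N \<longleftrightarrow> kb M b < kb N b"
proof (cases "\<exists>a. (a, b) \<in> M")
  case False
  then show ?thesis
    using kb_le[OF assms(2), of b] kb_unmatched[of b M] by (auto simp: job_prefers_def)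
next
  case True
  then obtain a where a: "(a, b) \<in> M" by blast
  then have *: "job_prefers G b M N \<longleftrightarrow>
      (\<forall>a'. (a', b) \<in> N \<longrightarrow> ranked_before (job_ranking G b) a a')"
    unfolding job_prefers_def using matchingD(3)[OF assms(1)] by blast
  have e: "(a, b) \<in> edges G" using a assms(1) matchingD(1) by blast
  show ?thesis
  proof (cases "\<exists>a'. (a', b) \<in> N")
    case False
    then show ?thesis using * kb_unmatched[of b N] rb_less[OF e] kb_matched[OF assms(1) a] by auto
  next
    case True
    then obtain a' where a': "(a', b) \<in> N" by blast
    have e': "(a', b) \<in> edges G" using a' assms(2) matchingD(1) by blast
    have "job_prefers G b M N \<longleftrightarrow> ranked_before (job_ranking G b) a a'"
      using * a' matchingD(3)[OF assms(2)] by blast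
    also have "\<dots> \<longleftrightarrow> rb b a < rb b a'"
      using e e' job_list[OF assms(3)] by (simp add: ranked_before_iff rb_def)
    finally show ?thesis using kb_matched[OF assms(1) a] kb_matched[OF assms(2) a'] by simp
  qed
qed

text \<open>Votes for \<open>N\<close> minus votes for \<open>M\<close>. A smaller rank is better,
  so \<open>sgn (ka M a - ka N a)\<close> is the vote of \<open>a\<close> in favour of
  \<open>N\<close>.\<close>

definition delta :: "('a \<times> 'b) set \<Rightarrow> ('a \<times> 'b) set \<Rightarrow> int" where
  "delta N M = (\<Sum>a\<in>agents G. sgn (int (ka M a) - int (ka N a)))
     + (\<Sum>b\<in>jobs G. sgn (int (kb M b) - int (kb N b)))"

lemma sum_sgn: "finite S \<Longrightarrow>
  (\<Sum>a\<in>S. sgn (int (f a) - int (g a))) = int (card {a \<in> S. g a < f a}) - int (card {a \<in> S. f a < g a})"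
proof -
  assume fin: "finite S"
  have "(\<Sum>a\<in>S. sgn (int (f a) - int (g a)))
      = (\<Sum>a\<in>S. (if g a < f a then 1 else 0) - (if f a < g a then 1 else 0))"
    by (intro sum.cong) (auto simp: sgn_if)
  then show ?thesis
    using fin by (simp add: sum_subtractf flip: sum.inter_filter)
qed

lemma phi_le_iff: "matching G M \<Longrightarrow> matching G N \<Longrightarrow> phi G N M \<le> phi G M N \<longleftrightarrow> delta N M \<le> 0"
  unfolding delta_def phi_def sum_sgn[OF finite_agents] sum_sgn[OF finite_jobs]
  by (simp add: agent_prefers_iff job_prefers_iff cong: conj_cong) linarith

lemma popular_iff_delta:
  "popular G M \<longleftrightarrow> matching G M \<and> (\<forall>N. matching G N \<longrightarrow> delta N M \<le> 0)"
  unfolding popular_def using phi_le_iff by blast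

text \<open>How the ends of an edge vote when offered each other in place of what \<open>M\<close>
  gives them. As preferences are strict, an edge of a matching \<open>M\<close> weighs 0 and any
  other edge -2, 0 or 2.\<close>

definition wt :: "('a \<times> 'b) set \<Rightarrow> 'a \<Rightarrow> 'b \<Rightarrow> int" where
  "wt M a b = sgn (int (ka M a) - int (ra a b)) + sgn (int (kb M b) - int (rb b a))"

text \<open>A dual certificate of popularity: the dual value of agent \<open>a\<close> is \<open>x a\<close>, that of job \<open>b\<close> is
  \<open>- y b\<close>, so that \<open>x\<close> and \<open>y\<close> agree along the edges of \<open>M\<close>.\<close>

definition witness :: "('a \<times> 'b) set \<Rightarrow> ('a \<Rightarrow> int) \<Rightarrow> ('b \<Rightarrow> int) \<Rightarrow> bool" where
  "witness M x y \<longleftrightarrow> matching G M \<and>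
     (\<forall>(a, b) \<in> M. x a = y b \<and> x a \<in> {-1, 0, 1}) \<and>
     (\<forall>a. (\<forall>b. (a, b) \<notin> M) \<longrightarrow> x a = 0) \<and>
     (\<forall>b. (\<forall>a. (a, b) \<notin> M) \<longrightarrow> y b = 0) \<and>
     (\<forall>(a, b) \<in> edges G. wt M a b \<le> x a - y b)"

lemma witnessD:
  assumes "witness M x y"
  shows "matching G M" "x a \<in> {-1, 0, 1}" "(\<forall>b. (a, b) \<notin> M) \<Longrightarrow> x a = 0"
    "y b \<in> {-1, 0, 1}" "(\<forall>a. (a, b) \<notin> M) \<Longrightarrow> y b = 0"
    "(a, b) \<in> M \<Longrightarrow> x a = y b" "(a, b) \<in> edges G \<Longrightarrow> wt M a b \<le> x a - y b"
proof -
  show "matching G M" "(a, b) \<in> M \<Longrightarrow> x a = y b" "(a, b) \<in> edges G \<Longrightarrow> wt M a b \<le> x a - y b"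
    and x0: "(\<forall>b. (a, b) \<notin> M) \<Longrightarrow> x a = 0" and y0: "(\<forall>a. (a, b) \<notin> M) \<Longrightarrow> y b = 0" for a b
    using assms unfolding witness_def by blast+
  have *: "x a = y b \<and> x a \<in> {-1, 0, 1}" if "(a, b) \<in> M" for a b
    using assms that unfolding witness_def by blast
  show "x a \<in> {-1, 0, 1}" using * x0[of a] by blast
  show "y b \<in> {-1, 0, 1}" using * y0[of b] by (metis insertCI)
qed

lemma sum_agents_split:
  assumes "matching G N"
  shows "(\<Sum>a\<in>agents G. f a) = (\<Sum>e\<in>N. f (fst e)) + (\<Sum>a\<in>agents G - fst ` N. f a)"
proof -
  have "inj_on fst N" using assms unfolding matching_def inj_on_def by auto
  then have "(\<Sum>e\<in>N. f (fst e)) = sum f (fst ` N)" by (simp add: sum.reindex)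
  moreover have "fst ` N \<subseteq> agents G" using assms matchingD(1) edge_vertices by fastforce
  ultimately show ?thesis by (simp add: sum.subset_diff[of "fst ` N" "agents G"] add.commute)
qed

lemma sum_jobs_split:
  assumes "matching G N"
  shows "(\<Sum>b\<in>jobs G. f b) = (\<Sum>e\<in>N. f (snd e)) + (\<Sum>b\<in>jobs G - snd ` N. f b)"
proof -
  have "inj_on snd N" using assms unfolding matching_def inj_on_def by auto
  then have "(\<Sum>e\<in>N. f (snd e)) = sum f (snd ` N)" by (simp add: sum.reindex)
  moreover have "snd ` N \<subseteq> jobs G" using assms matchingD(1) edge_vertices by fastforce
  ultimately show ?thesis by (simp add: sum.subset_diff[of "snd ` N" "jobs G"] add.commute)
qed

text \<open>Weak duality. A rival \<open>N\<close> collects votes along its edges, bounded by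
  \<open>x a - y b\<close>, and from the vertices it leaves out, bounded by \<open>x a\<close> and
  \<open>- y b\<close>. The bounds add up to the sum of \<open>x\<close> minus the sum of
  \<open>y\<close>, which is 0 because \<open>x\<close> and \<open>y\<close> agree along
  \<open>M\<close> and vanish at unmatched vertices.\<close>

lemma witness_popular:
  assumes w: "witness M x y"
  shows "popular G M"
proof -
  have M: "matching G M" using w by (simp add: witness_def)
  have xr: "x a \<in> {-1, 0, 1}" and x0: "(\<forall>b. (a, b) \<notin> M) \<Longrightarrow> x a = 0"
    and yr: "y b \<in> {-1, 0, 1}" and y0: "(\<forall>a. (a, b) \<notin> M) \<Longrightarrow> y b = 0" for a b
    using witnessD(2-5)[OF w] by blast+
  have tot: "(\<Sum>a\<in>agents G. x a) = (\<Sum>b\<in>jobs G. y b)"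
  proof -
    have "(\<Sum>a\<in>agents G - fst ` M. x a) = 0"
      by (intro sum.neutral ballI x0) force
    moreover have "(\<Sum>b\<in>jobs G - snd ` M. y b) = 0"
      by (intro sum.neutral ballI y0) force
    moreover have "(\<Sum>e\<in>M. x (fst e)) = (\<Sum>e\<in>M. y (snd e))"
      using w unfolding witness_def by (intro sum.cong) auto
    ultimately show ?thesis using sum_agents_split[OF M, of x] sum_jobs_split[OF M, of y] by simp
  qed
  have "delta N M \<le> 0" if N: "matching G N" for N
  proof -
    let ?f = "\<lambda>a. sgn (int (ka M a) - int (ka N a))" and ?g = "\<lambda>b. sgn (int (kb M b) - int (kb N b))"
    have 1: "?f a \<le> x a" if "a \<notin> fst ` N" for a
    proof -
      have u: "ka N a = da a" using that by (intro ka_unmatched) force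
      show ?thesis
      proof (cases "\<exists>b. (a, b) \<in> M")
        case True
        then have "?f a = -1" using ka_less_iff[OF M] u by (simp add: sgn_int_simps)
        then show ?thesis using xr[of a] by auto
      next
        case False then show ?thesis using u ka_unmatched[of a M] x0[of a] by simp
      qed
    qed
    have 2: "?g b \<le> - y b" if "b \<notin> snd ` N" for b
    proof -
      have u: "kb N b = db b" using that by (intro kb_unmatched) force
      show ?thesis
      proof (cases "\<exists>a. (a, b) \<in> M")
        case True
        then have "?g b = -1" using kb_less_iff[OF M] u by (simp add: sgn_int_simps)
        then show ?thesis using yr[of b] by auto
      next
        case False then show ?thesis using u kb_unmatched[of b M] y0[of b] by simp
      qed
    qed
    have 3: "?f (fst e) + ?g (snd e) \<le> x (fst e) - y (snd e)" if "e \<in> N" for e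
    proof -
      obtain a b where e: "e = (a, b)" by force
      have "wt M a b \<le> x a - y b" using w that e matchingD(1)[OF N] unfolding witness_def by blast
      then show ?thesis using that e ka_matched[OF N] kb_matched[OF N] by (simp add: wt_def)
    qed
    have "delta N M = (\<Sum>e\<in>N. ?f (fst e) + ?g (snd e)) + (\<Sum>a\<in>agents G - fst ` N. ?f a)
        + (\<Sum>b\<in>jobs G - snd ` N. ?g b)"
      unfolding delta_def sum_agents_split[OF N] sum_jobs_split[OF N] by (simp add: sum.distrib)
    also have "\<dots> \<le> (\<Sum>e\<in>N. x (fst e) - y (snd e)) + (\<Sum>a\<in>agents G - fst ` N. x a)
        + (\<Sum>b\<in>jobs G - snd ` N. - y b)"
      by (intro add_mono sum_mono 1 2 3) auto
    also have "\<dots> = (\<Sum>a\<in>agents G. x a) - (\<Sum>b\<in>jobs G. y b)"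
      unfolding sum_agents_split[OF N] sum_jobs_split[OF N] by (simp add: sum_subtractf sum_negf)
    finally show ?thesis using tot by simp
  qed
  then show ?thesis using M by (simp add: popular_iff_delta)
qed

end

section \<open>Potentials of a weighted digraph without positive cycles\<close>

fun walk_weight :: "('n \<Rightarrow> 'n \<Rightarrow> int) \<Rightarrow> 'n list \<Rightarrow> int" where
  "walk_weight w (u # v # us) = w u v + walk_weight w (v # us)"
| "walk_weight w us = 0"

fun is_walk :: "('n \<Rightarrow> 'n \<Rightarrow> bool) \<Rightarrow> 'n list \<Rightarrow> bool" where
  "is_walk R (u # v # us) \<longleftrightarrow> R u v \<and> is_walk R (v # us)"
| "is_walk R us \<longleftrightarrow> True"

lemma walk_weight_append:
  "walk_weight w (us @ u # vs) = walk_weight w (us @ [u]) + walk_weight w (u # vs)"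
  by (induction w us rule: walk_weight.induct) (auto simp: neq_Nil_conv; cases vs; simp)+

lemma is_walk_append: "is_walk R (us @ u # vs) \<longleftrightarrow> is_walk R (us @ [u]) \<and> is_walk R (u # vs)"
  by (induction R us rule: is_walk.induct) (auto; cases vs; simp)+

text \<open>The potential of a node is the largest weight of a walk without repeated nodes starting
  there.\<close>

lemma potential_exists:
  fixes V :: "'n set" and w :: "'n \<Rightarrow> 'n \<Rightarrow> int"
  assumes fin: "finite V" and RV: "\<And>u v. R u v \<Longrightarrow> u \<in> V \<and> v \<in> V"
    and cyc: "\<And>u us. distinct (u # us) \<Longrightarrow> is_walk R (u # us @ [u]) \<Longrightarrow> set (u # us) \<subseteq> V
      \<Longrightarrow> walk_weight w (u # us @ [u]) \<le> 0"
  obtains p where "\<And>u v. R u v \<Longrightarrow> w u v + p v \<le> p u"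
proof
  define D where "D u = {us. is_walk R (u # us) \<and> distinct (u # us) \<and> set (u # us) \<subseteq> V}" for u
  define p where "p u = Max ((\<lambda>us. walk_weight w (u # us)) ` D u)" for u
  have finD: "finite (D u)" for u
    by (rule finite_subset[OF _ finite_subset_distinct[OF fin]]) (auto simp: D_def)
  fix u v assume R: "R u v"
  have uv: "u \<in> V" "v \<in> V" using RV R by auto
  then have "[] \<in> D v" by (simp add: D_def)
  then have "p v \<in> (\<lambda>us. walk_weight w (v # us)) ` D v"
    unfolding p_def by (intro Max_in) (use finD in auto)
  then obtain vs where vs: "vs \<in> D v" "p v = walk_weight w (v # vs)" by auto
  have pge: "walk_weight w (u # us) \<le> p u" if "us \<in> D u" for us
    unfolding p_def using that finD by (intro Max_ge) auto
  show "w u v + p v \<le> p u"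
  proof (cases "u \<in> set (v # vs)")
    case False
    then have "v # vs \<in> D u" using vs(1) R uv by (auto simp: D_def)
    from pge[OF this] show ?thesis using vs(2) by simp
  next
    case True
    \<comment> \<open>The best walk from \<open>v\<close> already visits \<open>u\<close>. Cutting
      it there splits off a closed walk, of weight at most 0, and leaves a simple walk from
      \<open>u\<close>, which competes for \<open>p u\<close>.\<close>
    then obtain ys zs where s: "v # vs = ys @ u # zs" by (meson split_list)
    have "is_walk R (u # ys @ [u])"
    proof (cases ys)
      case Nil
      then show ?thesis using R s by simp
    next
      case (Cons y ys')
      then have "y = v" using s by simp
      moreover have "is_walk R (ys @ [u])"
        using vs(1) s is_walk_append[of R ys u zs] by (simp add: D_def)
      ultimately show ?thesis using Cons R by simp
    qed
    moreover have "distinct (ys @ u # zs)" "set (ys @ u # zs) \<subseteq> V"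
      using vs(1) by (simp_all only: D_def mem_Collect_eq s)
    then have "distinct (u # ys)" "set (u # ys) \<subseteq> V" by auto
    ultimately have 1: "walk_weight w (u # ys @ [u]) \<le> 0" using cyc by blast
    have "walk_weight w (u # v # vs) = walk_weight w (u # ys @ [u]) + walk_weight w (u # zs)"
      using walk_weight_append[of w "u # ys" u zs] s by simp
    moreover have "zs \<in> D u"
      using vs(1) is_walk_append[of R ys u zs] by (auto simp only: D_def mem_Collect_eq s) auto
    ultimately show ?thesis using pge[of zs] vs(2) 1 by simp
  qed
qed

text \<open>Turns a walk into the map from each node to its successor. The end \<open>z\<close> is
  kept apart so that the induction can drop the head of the walk; if \<open>z\<close> is the first
  node, the map is a cyclic permutation.\<close>

lemma walk_successor:
  assumes "distinct us" "us \<noteq> []" "z \<notin> set (tl us)" "is_walk R (us @ [z])"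
  shows "\<exists>\<sigma>. inj_on \<sigma> (set us) \<and> \<sigma> ` set us = insert z (set (tl us)) \<and>
    (\<forall>u\<in>set us. R u (\<sigma> u)) \<and> (\<Sum>u\<in>set us. w u (\<sigma> u)) = walk_weight w (us @ [z])"
  using assms
proof (induction us)
  case (Cons u us)
  show ?case
  proof (cases us)
    case Nil
    then show ?thesis using Cons.prems by (intro exI[of _ "\<lambda>_. z"]) auto
  next
    case (Cons v vs)
    then obtain \<sigma> where \<sigma>: "inj_on \<sigma> (set us)" "\<sigma> ` set us = insert z (set vs)"
      "\<forall>u\<in>set us. R u (\<sigma> u)" "(\<Sum>u\<in>set us. w u (\<sigma> u)) = walk_weight w (us @ [z])"
      using Cons.IH Cons.prems by auto
    have u: "u \<notin> set us" using Cons.prems by simp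
    have v: "v \<notin> \<sigma> ` set us" using \<sigma>(2) Cons.prems Cons by auto
    have im: "\<sigma>(u := v) ` set us = \<sigma> ` set us" using u by (intro image_cong) auto
    have "inj_on (\<sigma>(u := v)) (set us)" using \<sigma>(1) u by (simp add: inj_on_def)
    then have "inj_on (\<sigma>(u := v)) (set (u # us))" using im u v by (simp add: inj_on_insert)
    moreover have "\<sigma>(u := v) ` set (u # us) = insert z (set (tl (u # us)))"
      using im \<sigma>(2) Cons by auto
    moreover have "\<forall>y\<in>set (u # us). R y ((\<sigma>(u := v)) y)" using \<sigma>(3) Cons.prems Cons by auto
    moreover have "(\<Sum>y\<in>set us. w y ((\<sigma>(u := v)) y)) = (\<Sum>y\<in>set us. w y (\<sigma> y))"
      using u by (intro sum.cong) auto
    then have "(\<Sum>y\<in>set (u # us). w y ((\<sigma>(u := v)) y)) = walk_weight w ((u # us) @ [z])"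
      using u \<sigma>(4) Cons by simp
    ultimately show ?thesis by blast
  qed
qed simp

text \<open>The nodes of the alternating digraph of a matching: an arc from \<open>Ag a\<close> says which job \<open>a\<close>
  moves to (the partner of the target agent, or an unmatched job, or none), and an arc from
  \<open>Root\<close> abandons the partner of the target agent.\<close>

datatype ('c, 'd) node = Ag 'c | Jb 'd | Root

section \<open>The alternating digraph and strong duality\<close>

context marriage
begin

fun arc :: "('a \<times> 'b) set \<Rightarrow> ('a, 'b) node \<Rightarrow> ('a, 'b) node \<Rightarrow> bool" where
  "arc M (Ag a) (Ag a') \<longleftrightarrow> a \<noteq> a' \<and> (\<exists>b. (a, b) \<in> edges G \<and> (a', b) \<in> M)"
| "arc M (Ag a) (Jb b) \<longleftrightarrow> (a, b) \<in> edges G \<and> (\<forall>a'. (a', b) \<notin> M)"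
| "arc M (Ag a) Root \<longleftrightarrow> a \<in> agents G"
| "arc M (Jb b) v \<longleftrightarrow> b \<in> jobs G \<and> (\<forall>a'. (a', b) \<notin> M) \<and> v = Root"
| "arc M Root v \<longleftrightarrow> (\<exists>a \<in> agents G. v = Ag a)"

definition mate :: "('a \<times> 'b) set \<Rightarrow> 'a \<Rightarrow> 'b" where
  "mate M a = (THE b. (a, b) \<in> M)"

lemma mate_eq: "matching G M \<Longrightarrow> (a, b) \<in> M \<Longrightarrow> mate M a = b"
  unfolding mate_def using matchingD(2) by blast

text \<open>The vote for being unmatched. It serves for \<open>a\<close> when \<open>a\<close> gives
  up its job, and equally for the partner of \<open>a\<close> when that partner is
  abandoned.\<close>

definition loss :: "('a \<times> 'b) set \<Rightarrow> 'a \<Rightarrow> int" where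
  "loss M a = (if \<exists>b. (a, b) \<in> M then - 1 else 0)"

fun arc_weight :: "('a \<times> 'b) set \<Rightarrow> ('a, 'b) node \<Rightarrow> ('a, 'b) node \<Rightarrow> int" where
  "arc_weight M (Ag a) (Ag a') = wt M a (mate M a')"
| "arc_weight M (Ag a) (Jb b) = wt M a b"
| "arc_weight M (Ag a) Root = loss M a"
| "arc_weight M Root (Ag a) = loss M a"
| "arc_weight M _ _ = 0"

text \<open>A permutation of \<open>C\<close> along arcs describes a simultaneous change of
  partners, and \<open>N\<close> is the matching it produces. An arc weighs the vote of its source
  agent plus the vote of the job for which its target stands. Since \<sigma> permutes
  \<open>C\<close>, every vote that is cast is counted exactly once, and the total is
  \<open>delta N M\<close>.\<close>

lemma cycle_gain:
  assumes pop: "popular G M" and fin: "finite C" and bij: "bij_betw \<sigma> C C"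
    and arcs: "\<And>u. u \<in> C \<Longrightarrow> arc M u (\<sigma> u)"
  shows "(\<Sum>u\<in>C. arc_weight M u (\<sigma> u)) \<le> 0"
proof -
  have M: "matching G M" using pop by (simp add: popular_def)
  have inj: "\<sigma> u = \<sigma> v \<Longrightarrow> u \<in> C \<Longrightarrow> v \<in> C \<Longrightarrow> u = v" for u v
    using bij by (meson bij_betw_imp_inj_on inj_onD)
  have onto: "\<exists>u\<in>C. v = \<sigma> u" if "v \<in> C" for v using bij that by (metis bij_betw_imp_surj_on imageE)
  have into: "\<sigma> u \<in> C" if "u \<in> C" for u using bij that by (meson bij_betwE)
  define N where "N = {(a, b). (Ag a \<notin> C \<and> (a, b) \<in> M) \<or>
    (Ag a \<in> C \<and> ((\<exists>a'. \<sigma> (Ag a) = Ag a' \<and> (a', b) \<in> M) \<or> \<sigma> (Ag a) = Jb b))}"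
  have NE: "(a, b) \<in> edges G" if "(a, b) \<in> N" for a b
    using that arcs[of "Ag a"] matchingD(1,2)[OF M] unfolding N_def by auto metis
  have N: "matching G N"
    unfolding matching_def
  proof (intro conjI allI impI)
    show "N \<subseteq> edges G" using NE by auto
    show "b = b'" if "(a, b) \<in> N" "(a, b') \<in> N" for a b b'
      using that matchingD(2)[OF M] unfolding N_def by auto
    show "a = a'" if "(a, b) \<in> N" "(a', b) \<in> N" for a a' b
    proof -
      have jb: "(a'', b) \<notin> M" if "Ag a1 \<in> C" "\<sigma> (Ag a1) = Jb b" for a1 a''
        using arcs[OF that(1)] that(2) by simp
      show ?thesis
        using that matchingD(3)[OF M] inj[of "Ag a" "Ag a'"] into[of "Ag a"] into[of "Ag a'"] jb
        unfolding N_def by auto metis+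
    qed
  qed
  let ?f = "\<lambda>a. sgn (int (ka M a) - int (ka N a))" and ?g = "\<lambda>b. sgn (int (kb M b) - int (kb N b))"
  define g where "g u = (case u of Ag a \<Rightarrow> if \<exists>b. (a, b) \<in> M then ?g (mate M a) else 0
      | Jb b \<Rightarrow> ?g b | Root \<Rightarrow> 0)" for u
  define f where "f u = (case u of Ag a \<Rightarrow> ?f a | _ \<Rightarrow> 0)" for u :: "('a, 'b) node"
  have w: "arc_weight M u (\<sigma> u) = f u + g (\<sigma> u)" if u: "u \<in> C" for u
  proof (cases u)
    case (Ag a)
    show ?thesis
    proof (cases "\<sigma> u")
      case (Ag a')
      then obtain b where b: "(a, b) \<in> edges G" "(a', b) \<in> M" using arcs[OF u] \<open>u = Ag a\<close> by auto
      then have "(a, b) \<in> N" using u Ag \<open>u = Ag a\<close> by (auto simp: N_def)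
      then show ?thesis using b Ag \<open>u = Ag a\<close> ka_matched[OF N] kb_matched[OF N] mate_eq[OF M b(2)]
        by (auto simp: f_def g_def wt_def)
    next
      case (Jb b)
      then have "(a, b) \<in> N" using u \<open>u = Ag a\<close> by (auto simp: N_def)
      then show ?thesis using Jb \<open>u = Ag a\<close> ka_matched[OF N] kb_matched[OF N]
        by (auto simp: f_def g_def wt_def)
    next
      case Root
      then have "ka N a = da a" using u \<open>u = Ag a\<close> by (intro ka_unmatched) (auto simp: N_def)
      then show ?thesis using Root \<open>u = Ag a\<close> ka_less_iff[OF M, of a] ka_unmatched[of a M]
        by (auto simp: f_def g_def loss_def sgn_int_simps)
    qed
  next
    case (Jb b)
    then show ?thesis using arcs[OF u] by (auto simp: f_def g_def)
  next
    case Root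
    then obtain a where a: "\<sigma> u = Ag a" using arcs[OF u] by auto
    have aC: "Ag a \<in> C" using into[OF u] a by simp
    show ?thesis
    proof (cases "\<exists>b. (a, b) \<in> M")
      case False then show ?thesis using a Root by (auto simp: f_def g_def loss_def)
    next
      case True
      then obtain b where b: "(a, b) \<in> M" by blast
      have "(a', b) \<notin> N" for a'
      proof
        assume "(a', b) \<in> N"
        then consider "Ag a' \<notin> C" "(a', b) \<in> M" | a2 where "Ag a' \<in> C" "\<sigma> (Ag a') = Ag a2" "(a2, b) \<in> M"
          | "Ag a' \<in> C" "\<sigma> (Ag a') = Jb b"
          by (auto simp: N_def)
        then show False
        proof cases
          case 1 then show ?thesis using matchingD(3)[OF M b] aC by blast
        next
          case 2
          then have "\<sigma> (Ag a') = \<sigma> u" using matchingD(3)[OF M b] a by auto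
          then show ?thesis using inj u 2(1) Root by fastforce
        next
          case 3 then show ?thesis using arcs[OF 3(1)] b by auto
        qed
      qed
      then have "kb N b = db b" by (rule kb_unmatched)
      then show ?thesis using True a b Root kb_less_iff[OF M, of b] mate_eq[OF M b]
        by (auto simp: f_def g_def loss_def sgn_int_simps)
    qed
  qed
  have "(\<Sum>u\<in>C. arc_weight M u (\<sigma> u)) = (\<Sum>u\<in>C. f u) + (\<Sum>u\<in>C. g (\<sigma> u))"
    using w by (simp add: sum.distrib)
  also have "(\<Sum>u\<in>C. g (\<sigma> u)) = (\<Sum>u\<in>C. g u)"
    using bij by (rule sum.reindex_bij_betw)
  also have "(\<Sum>u\<in>C. f u) = (\<Sum>a\<in>agents G. ?f a)"
  proof -
    have sub: "Ag a \<in> C \<Longrightarrow> a \<in> agents G" for a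
      using arcs[of "Ag a"] edge_vertices by (cases "\<sigma> (Ag a)") auto
    have z: "?f a = 0" if "Ag a \<notin> C" for a
    proof -
      have "(a, b) \<in> N \<longleftrightarrow> (a, b) \<in> M" for b using that by (auto simp: N_def)
      then have "ka N a = ka M a" by (simp add: ka_def)
      then show ?thesis by simp
    qed
    have "(\<Sum>u\<in>C. f u) = (\<Sum>u\<in>Ag ` {a. Ag a \<in> C}. f u)"
      by (rule sum.mono_neutral_right) (use fin in \<open>auto simp: f_def split: node.splits\<close>)
    also have "\<dots> = (\<Sum>a\<in>{a. Ag a \<in> C}. ?f a)"
      by (subst sum.reindex) (auto simp: inj_on_def f_def)
    also have "\<dots> = (\<Sum>a\<in>agents G. ?f a)"
      by (rule sum.mono_neutral_left) (use sub z in auto)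
    finally show ?thesis .
  qed
  also have "(\<Sum>u\<in>C. g u) = (\<Sum>b\<in>jobs G. ?g b)"
  proof -
    \<comment> \<open>The node that stands for a job is its partner if it has one and the job itself
      otherwise. A job whose node lies outside \<open>C\<close> keeps its partner, hence does not
      vote.\<close>
    define h where "h b = (if \<exists>a. (a, b) \<in> M then Ag (THE a. (a, b) \<in> M) else Jb b)" for b
    have h1: "h b = Ag a" if "(a, b) \<in> M" for a b
    proof -
      have "(THE a. (a, b) \<in> M) = a" using that matchingD(3)[OF M] by blast
      then show ?thesis using that by (auto simp: h_def)
    qed
    have h2: "h b = Jb b" if "\<forall>a. (a, b) \<notin> M" for b using that by (simp add: h_def)
    have gh: "g (h b) = ?g b" for b
      by (cases "\<exists>a. (a, b) \<in> M") (auto simp: h1 h2 g_def mate_eq[OF M])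
    have injh: "inj h"
    proof (rule injI)
      fix b b' assume "h b = h b'"
      then show "b = b'" using h1 h2 matchingD(2)[OF M] by (metis node.distinct(1) node.inject)
    qed
    have z: "?g b = 0" if n: "h b \<notin> C" for b
    proof -
      have "(a, b) \<in> N \<longleftrightarrow> (a, b) \<in> M" for a
      proof
        assume "(a, b) \<in> N"
        then consider "(a, b) \<in> M" | a' where "Ag a \<in> C" "\<sigma> (Ag a) = Ag a'" "(a', b) \<in> M"
          | "Ag a \<in> C" "\<sigma> (Ag a) = Jb b"
          by (auto simp: N_def)
        then show "(a, b) \<in> M"
        proof cases
          case 2 then show ?thesis using h1[of a' b] into[of "Ag a"] n by auto
        next
          case 3 then show ?thesis using arcs[of "Ag a"] h2[of b] into[of "Ag a"] n by auto
        qed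
      next
        assume "(a, b) \<in> M"
        then show "(a, b) \<in> N" using h1 n by (auto simp: N_def)
      qed
      then have "kb N b = kb M b" by (simp add: kb_def)
      then show ?thesis by simp
    qed
    have sub: "b \<in> jobs G" if "h b \<in> C" for b
    proof (cases "\<exists>a. (a, b) \<in> M")
      case True then show ?thesis using matchingD(1)[OF M] edge_vertices by blast
    next
      case False
      then show ?thesis using arcs[of "Jb b"] h2 that by auto
    qed
    have "(\<Sum>u\<in>C. g u) = (\<Sum>u\<in>h ` {b. h b \<in> C}. g u)"
    proof (rule sum.mono_neutral_right)
      show "\<forall>u\<in>C - h ` {b. h b \<in> C}. g u = 0"
      proof
        fix u assume u: "u \<in> C - h ` {b. h b \<in> C}"
        show "g u = 0"
        proof (cases u)
          case (Ag a)
          then have "(a, b) \<notin> M" for b using u h1[of a b] by (metis DiffE image_eqI mem_Collect_eq)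
          then show ?thesis using Ag by (simp add: g_def)
        next
          case (Jb b)
          then have "h b = u" using arcs[of u] u h2 by auto
          then show ?thesis using u by auto
        qed (simp add: g_def)
      qed
    qed (use fin in auto)
    also have "\<dots> = (\<Sum>b\<in>{b. h b \<in> C}. ?g b)"
      by (subst sum.reindex) (auto intro: inj_on_subset[OF injh] simp: gh)
    also have "\<dots> = (\<Sum>b\<in>jobs G. ?g b)"
      by (rule sum.mono_neutral_left) (use sub z in auto)
    finally show ?thesis .
  qed
  also have "(\<Sum>a\<in>agents G. ?f a) + (\<Sum>b\<in>jobs G. ?g b) = delta N M" by (simp add: delta_def)
  also have "\<dots> \<le> 0" using pop N by (simp add: popular_iff_delta)
  finally show ?thesis .
qed

text \<open>Strong duality: popularity excludes cycles of positive weight, and the potentials that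
  exist for this reason, measured relative to \<open>Root\<close>, are the dual values. They are
  integers because the weights are.\<close>

lemma popular_witness:
  assumes pop: "popular G M"
  obtains x y where "witness M x y"
proof -
  have M: "matching G M" using pop by (simp add: popular_def)
  define V where "V = Ag ` agents G \<union> Jb ` jobs G \<union> {Root :: ('a, 'b) node}"
  obtain p where p: "\<And>u v. arc M u v \<Longrightarrow> arc_weight M u v + p v \<le> p u"
  proof (rule potential_exists[of V "arc M" "arc_weight M"])
    show "finite V" by (simp add: V_def)
    show "u \<in> V \<and> v \<in> V" if "arc M u v" for u v
      using that edge_vertices matchingD(1)[OF M] unfolding V_def
      by (cases u; cases v) (auto, blast+)
    fix u us assume 1: "distinct (u # us)" "is_walk (arc M) (u # us @ [u])"
    then obtain \<sigma> where \<sigma>: "inj_on \<sigma> (set (u # us))" "\<sigma> ` set (u # us) = set (u # us)"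
      "\<forall>v\<in>set (u # us). arc M v (\<sigma> v)"
      "(\<Sum>v\<in>set (u # us). arc_weight M v (\<sigma> v)) = walk_weight (arc_weight M) (u # us @ [u])"
      using walk_successor[of "u # us" u "arc M" "arc_weight M"] by auto
    have "bij_betw \<sigma> (set (u # us)) (set (u # us))" using \<sigma>(1,2) by (simp add: bij_betw_def)
    from cycle_gain[OF pop _ this] \<sigma>(3,4)
    show "walk_weight (arc_weight M) (u # us @ [u]) \<le> 0" by simp
  qed blast
  define x where "x a = (if a \<in> agents G then p (Ag a) - p Root else 0)" for a
  define y where "y b = (if \<exists>a. (a, b) \<in> M then x (THE a. (a, b) \<in> M) else 0)" for b
  have y1: "y b = x a" if "(a, b) \<in> M" for a b
  proof -
    have "(THE a. (a, b) \<in> M) = a" using that matchingD(3)[OF M] by blast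
    then show ?thesis using that by (auto simp: y_def)
  qed
  \<comment> \<open>The two arcs between \<open>Ag a\<close> and \<open>Root\<close> confine the
    dual value of a matched agent to -1, 0, 1 and that of an unmatched agent to 0.\<close>
  have bnd: "loss M a \<le> x a \<and> x a \<le> - loss M a" if "a \<in> agents G" for a
    using p[of "Ag a" Root] p[of Root "Ag a"] that by (simp add: x_def)
  have "witness M x y"
    unfolding witness_def
  proof (intro conjI)
    show "\<forall>(a, b)\<in>M. x a = y b \<and> x a \<in> {- 1, 0, 1}"
    proof (clarify, intro conjI)
      fix a b assume ab: "(a, b) \<in> M"
      then have "loss M a = -1" "a \<in> agents G"
        using matchingD(1)[OF M] edge_vertices by (auto simp: loss_def)
      then show "x a \<in> {-1, 0, 1}" using bnd[of a] by auto
      show "x a = y b" using y1 ab by simp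
    qed
    show "\<forall>a. (\<forall>b. (a, b) \<notin> M) \<longrightarrow> x a = 0"
    proof (intro allI impI)
      fix a assume "\<forall>b. (a, b) \<notin> M"
      then have "loss M a = 0" by (simp add: loss_def)
      then show "x a = 0" using bnd[of a] by (cases "a \<in> agents G") (auto simp: x_def)
    qed
    show "\<forall>b. (\<forall>a. (a, b) \<notin> M) \<longrightarrow> y b = 0" by (simp add: y_def)
    show "\<forall>(a, b)\<in>edges G. wt M a b \<le> x a - y b"
    proof clarify
      fix a b assume ab: "(a, b) \<in> edges G"
      then have v: "a \<in> agents G" "b \<in> jobs G" using edge_vertices by auto
      show "wt M a b \<le> x a - y b"
      proof (cases "\<exists>a'. (a', b) \<in> M")
        case False
        then have "arc M (Ag a) (Jb b)" "arc M (Jb b) Root" "y b = 0"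
          using ab v by (auto simp: y_def)
        then show ?thesis using p[of "Ag a" "Jb b"] p[of "Jb b" Root] v by (simp add: x_def)
      next
        case True
        then obtain a' where a': "(a', b) \<in> M" by blast
        show ?thesis
        proof (cases "a' = a")
          case True
          then show ?thesis using a' y1 ka_matched[OF M] kb_matched[OF M] by (simp add: wt_def)
        next
          case False
          then have "arc M (Ag a) (Ag a')" using ab a' by auto
          moreover have "a' \<in> agents G" using a' matchingD(1)[OF M] edge_vertices by blast
          ultimately show ?thesis
            using p[of "Ag a" "Ag a'"] v y1[OF a'] mate_eq[OF M a'] by (simp add: x_def)
        qed
      qed
    qed
  qed (use M in simp)
  then show thesis using that by blast
qed

lemma popular_iff_witness: "popular G M \<longleftrightarrow> (\<exists>x y. witness M x y)"
  using witness_popular popular_witness by metis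

section \<open>Fully popular matchings\<close>

definition fjobs :: "'b set" where
  "fjobs = {b. \<exists>a. (a, b) \<in> edges G \<and> ra a b = 0}"

text \<open>The rank of the best job that is nobody's first choice. By the theorem of Abraham, Irving,
  Kavitha and Mehlhorn an \<open>A\<close>-popular matching gives every agent either its first choice or this
  job (nothing, if there is none).\<close>

definition sr :: "'a \<Rightarrow> nat" where
  "sr a = length (takeWhile (\<lambda>b. b \<in> fjobs) (agent_ranking G a))"

lemma sr_le: "sr a \<le> da a"
  unfolding sr_def da_def by (rule length_takeWhile_le)

lemma less_sr: "(a, b) \<in> edges G \<Longrightarrow> ra a b < sr a \<Longrightarrow> b \<in> fjobs"
  unfolding sr_def using nth_ra by (metis nth_mem set_takeWhileD takeWhile_nth)

lemma eq_sr: "(a, b) \<in> edges G \<Longrightarrow> ra a b = sr a \<Longrightarrow> b \<notin> fjobs"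
  using nth_length_takeWhile[of "\<lambda>b. b \<in> fjobs" "agent_ranking G a"] nth_ra[of a b] ra_less[of a b]
  by (simp add: sr_def da_def)

lemma sr_pos: "(a, b) \<in> edges G \<Longrightarrow> 0 < sr a"
proof (rule ccontr)
  assume e: "(a, b) \<in> edges G" and "\<not> 0 < sr a"
  moreover have "0 < da a" using ra_less[OF e] by simp
  then have "(a, agent_ranking G a ! 0) \<in> edges G" "ra a (agent_ranking G a ! 0) = 0"
    using agent_nth[of a 0] edge_vertices[OF e] by auto
  ultimately show False using eq_sr[of a "agent_ranking G a ! 0"] unfolding fjobs_def by auto
qed

lemma phi_A_le_iff: "matching G M \<Longrightarrow> matching G N \<Longrightarrow> phi_A G N M \<le> phi_A G M N \<longleftrightarrow>
    card {a \<in> agents G. ka N a < ka M a} \<le> card {a \<in> agents G. ka M a < ka N a}"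
  by (simp add: phi_A_def agent_prefers_iff cong: conj_cong)

text \<open>Promoting \<open>a\<close> to \<open>b\<close> and the former partner of \<open>b\<close> to its first choice pleases two agents
  and hurts at most one.\<close>

lemma A_popular_wanted:
  assumes AM: "A_popular G M" and e: "(a, b) \<in> edges G" and r: "ra a b < ka M a"
  shows "\<exists>a1. (a1, b) \<in> M \<and> ra a1 b = 0"
proof (rule ccontr)
  assume neg: "\<not> ?thesis"
  have M: "matching G M" using AM by (simp add: A_popular_def)
  have ab: "(a, b) \<notin> M" using r ka_matched[OF M] by auto
  have le: "card {a \<in> agents G. ka N a < ka M a} \<le> card {a \<in> agents G. ka M a < ka N a}"
    if "matching G N" for N
    using AM that phi_A_le_iff[OF M that] by (simp add: A_popular_def)
  have same: "ka N x = ka M x" if "\<And>y. (x, y) \<in> N \<longleftrightarrow> (x, y) \<in> M" for N x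
    using that by (simp add: ka_def)
  show False
  proof (cases "\<exists>a1. (a1, b) \<in> M")
    \<comment> \<open>If \<open>b\<close> is free, moving \<open>a\<close> to it hurts no other
      agent; the exchange with a second promoted agent is for a job that is taken.\<close>
    case False
    define N where "N = {(x, y). (x = a \<and> y = b) \<or> ((x, y) \<in> M \<and> x \<noteq> a)}"
    have N: "matching G N"
      unfolding matching_def
    proof (intro conjI allI impI)
      show "N \<subseteq> edges G" using e matchingD(1)[OF M] by (auto simp: N_def)
      show "y = y'" if "(x, y) \<in> N" "(x, y') \<in> N" for x y y'
        using that matchingD(2)[OF M] by (auto simp: N_def)
      show "x = x'" if "(x, y) \<in> N" "(x', y) \<in> N" for x x' y
        using that matchingD(3)[OF M] False by (auto simp: N_def)
    qed
    have ka: "ka N a = ra a b" using N by (intro ka_matched) (auto simp: N_def)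
    have "ka N x = ka M x" if "x \<noteq> a" for x using that by (intro same) (auto simp: N_def)
    then have "\<not> ka M x < ka N x" for x using ka r by (cases "x = a") auto
    then have "card {x \<in> agents G. ka M x < ka N x} = 0" by simp
    then have "card {x \<in> agents G. ka N x < ka M x} = 0" using le[OF N] by (simp only: le_zero_eq)
    moreover have "a \<in> {x \<in> agents G. ka N x < ka M x}" using ka r edge_vertices[OF e] by simp
    ultimately show False using card_gt_0_iff[of "{x \<in> agents G. ka N x < ka M x}"] by auto
  next
    case True
    then obtain a1 where a1: "(a1, b) \<in> M" by blast
    have a1': "ra a1 b \<noteq> 0" "a1 \<noteq> a" using neg a1 ab by auto
    have e1: "(a1, b) \<in> edges G" using a1 matchingD(1)[OF M] by blast
    define b1 where "b1 = agent_ranking G a1 ! 0"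
    have b1: "(a1, b1) \<in> edges G" "ra a1 b1 = 0"
      using agent_nth[of a1 0] edge_vertices[OF e1] ra_less[OF e1] by (auto simp: b1_def)
    then have "b1 \<noteq> b" using a1' by auto
    define N where "N = {(x, y). (x = a \<and> y = b) \<or> (x = a1 \<and> y = b1) \<or>
        ((x, y) \<in> M \<and> x \<noteq> a \<and> x \<noteq> a1 \<and> y \<noteq> b1)}"
    have N: "matching G N"
      unfolding matching_def
    proof (intro conjI allI impI)
      show "N \<subseteq> edges G" using e b1 matchingD(1)[OF M] by (auto simp: N_def)
      show "y = y'" if "(x, y) \<in> N" "(x, y') \<in> N" for x y y'
        using that matchingD(2)[OF M] a1' by (auto simp: N_def)
      show "x = x'" if "(x, y) \<in> N" "(x', y) \<in> N" for x x' y
        using that matchingD(3)[OF M] a1 \<open>b1 \<noteq> b\<close> by (auto simp: N_def)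
    qed
    have ka: "ka N a = ra a b" using N by (intro ka_matched) (auto simp: N_def)
    have ka1: "ka N a1 = 0" using ka_matched[OF N, of a1 b1] b1 by (auto simp: N_def)
    have "ka N x = ka M x" if "x \<noteq> a" "x \<noteq> a1" "(x, b1) \<notin> M" for x
      using that by (intro same) (auto simp: N_def)
    then have sub: "{x \<in> agents G. ka M x < ka N x} \<subseteq> {x. (x, b1) \<in> M}"
      using ka ka1 r by force
    have "finite {x. (x, b1) \<in> M} \<and> card {x. (x, b1) \<in> M} \<le> 1"
    proof (cases "\<exists>x. (x, b1) \<in> M")
      case True
      then obtain x where "{x. (x, b1) \<in> M} = {x}" using matchingD(3)[OF M] by blast
      then show ?thesis by simp
    qed simp
    then have "card {x \<in> agents G. ka M x < ka N x} \<le> 1"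
      using card_mono[OF _ sub] by linarith
    moreover have "{a, a1} \<subseteq> {x \<in> agents G. ka N x < ka M x}"
      using ka ka1 r a1' ka_matched[OF M a1] edge_vertices[OF e] edge_vertices[OF e1] by auto
    then have "card {a, a1} \<le> card {x \<in> agents G. ka N x < ka M x}"
      by (rule card_mono[rotated]) simp
    ultimately show False using le[OF N] a1' by simp
  qed
qed

text \<open>For the converse, an agent that improves in \<open>N\<close> gets a job before its
  second choice, thus a job that is somebody's first choice. The agent who has this job in
  \<open>M\<close> ranks it first and now loses it. As both matchings are injective, different
  winners have different losers.\<close>

lemma A_popular_iff:
  "A_popular G M \<longleftrightarrow> matching G M \<and> (\<forall>a\<in>agents G. ka M a = 0 \<or> ka M a = sr a) \<and>
    (\<forall>b\<in>fjobs. \<exists>a. (a, b) \<in> M)"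
proof
  assume AM: "A_popular G M"
  have M: "matching G M" using AM by (simp add: A_popular_def)
  have F: "\<exists>a. (a, b) \<in> M \<and> ra a b = 0" if b: "b \<in> fjobs" for b
  proof -
    obtain a where a: "(a, b) \<in> edges G" "ra a b = 0" using b by (auto simp: fjobs_def)
    show ?thesis
    proof (cases "ka M a = 0")
      case True then show ?thesis using ka_eq_ra[OF M a(1)] a by auto
    next
      case False then show ?thesis using A_popular_wanted[OF AM a(1)] a(2) by simp
    qed
  qed
  moreover have "ka M a = 0 \<or> ka M a = sr a" if a: "a \<in> agents G" for a
  proof (rule ccontr)
    assume n: "\<not> ?thesis"
    show False
    proof (cases "ka M a < sr a")
      case True
      then have l: "ka M a < da a" using sr_le[of a] by simp
      then obtain b where b: "(a, b) \<in> M" using ka_less_iff[OF M] by blast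
      then have e: "(a, b) \<in> edges G" using matchingD(1)[OF M] by blast
      have "b \<in> fjobs" using less_sr[OF e] True ka_matched[OF M b] by simp
      then obtain a' where "(a', b) \<in> M" "ra a' b = 0" using F by blast
      then have "ra a b = 0" using matchingD(3)[OF M b] by blast
      then show False using n ka_matched[OF M b] by simp
    next
      case False
      then have l: "sr a < ka M a" using n by simp
      then have "sr a < da a" using ka_le[OF M, of a] by simp
      then obtain b where b: "(a, b) \<in> edges G" "ra a b = sr a" using agent_nth[OF a] by blast
      then obtain a1 where "(a1, b) \<in> M" "ra a1 b = 0" using A_popular_wanted[OF AM b(1)] l by auto
      then have "b \<in> fjobs" using matchingD(1)[OF M] by (auto simp: fjobs_def)
      then show False using eq_sr b by blast
    qed
  qed
  ultimately show "matching G M \<and> (\<forall>a\<in>agents G. ka M a = 0 \<or> ka M a = sr a) \<and>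
      (\<forall>b\<in>fjobs. \<exists>a. (a, b) \<in> M)" using M by blast
next
  assume *: "matching G M \<and> (\<forall>a\<in>agents G. ka M a = 0 \<or> ka M a = sr a) \<and>
    (\<forall>b\<in>fjobs. \<exists>a. (a, b) \<in> M)"
  then have M: "matching G M" by blast
  have "card {a \<in> agents G. ka N a < ka M a} \<le> card {a \<in> agents G. ka M a < ka N a}"
    if N: "matching G N" for N
  proof -
    have ex: "\<exists>b c. (a, b) \<in> N \<and> (c, b) \<in> M \<and> c \<in> agents G \<and> ka M c < ka N c"
      if a: "a \<in> agents G" "ka N a < ka M a" for a
    proof -
      have s: "ka M a = sr a" using * a by auto
      have "ka N a < da a" using a(2) ka_le[OF M, of a] by simp
      then obtain b where b: "(a, b) \<in> N" using ka_less_iff[OF N] by blast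
      have e: "(a, b) \<in> edges G" using b matchingD(1)[OF N] by blast
      have r: "ra a b < sr a" using ka_matched[OF N b] a(2) s by simp
      then have bF: "b \<in> fjobs" using less_sr e by blast
      then obtain c where c: "(c, b) \<in> M" using * by blast
      have ce: "(c, b) \<in> edges G" using c matchingD(1)[OF M] by blast
      then have cA: "c \<in> agents G" using edge_vertices by blast
      have "ka M c = 0" using * cA ka_matched[OF M c] eq_sr[OF ce] bF by force
      moreover have "c \<noteq> a" using c s r ka_matched[OF M] by auto
      then have "(c, b) \<notin> N" using b matchingD(3)[OF N] by blast
      then have "ka N c \<noteq> ra c b" using ka_eq_ra[OF N ce] by simp
      ultimately have "ka M c < ka N c" using ka_matched[OF M c] by simp
      then show ?thesis using b c cA by blast
    qed
    then obtain \<beta> \<gamma> where bg: "\<And>a. a \<in> agents G \<Longrightarrow> ka N a < ka M a \<Longrightarrow> (a, \<beta> a) \<in> N \<and>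
        (\<gamma> a, \<beta> a) \<in> M \<and> \<gamma> a \<in> agents G \<and> ka M (\<gamma> a) < ka N (\<gamma> a)" by metis
    show ?thesis
    proof (rule card_inj_on_le[of \<gamma>])
      show "inj_on \<gamma> {a \<in> agents G. ka N a < ka M a}"
        by (rule inj_onI) (use bg matchingD(2)[OF M] matchingD(3)[OF N] in \<open>metis (mono_tags, lifting) mem_Collect_eq\<close>)
    qed (use bg in auto)
  qed
  then show "A_popular G M" using M phi_A_le_iff by (simp add: A_popular_def)
qed

definition fp_witness :: "('a \<times> 'b) set \<Rightarrow> ('a \<Rightarrow> int) \<Rightarrow> ('b \<Rightarrow> int) \<Rightarrow> bool" where
  "fp_witness M x y \<longleftrightarrow> witness M x y \<and> (\<forall>a\<in>agents G. ka M a = 0 \<or> ka M a = sr a) \<and>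
    (\<forall>b\<in>fjobs. \<exists>a. (a, b) \<in> M)"

lemma fully_popular_iff: "fully_popular G M \<longleftrightarrow> (\<exists>x y. fp_witness M x y)"
  unfolding fully_popular_def popular_iff_witness A_popular_iff fp_witness_def
  using witnessD(1) by blast

definition base :: "'a \<Rightarrow> 'b \<Rightarrow> nat" where "base a b = (if ra a b < sr a then 1 else 0)"
definition usable :: "'a \<Rightarrow> 'b \<Rightarrow> bool" where "usable a b \<longleftrightarrow> ra a b = 0 \<or> ra a b = sr a"
text \<open>The least state of an agent whom \<open>b\<close> has left behind: strictly above
  \<open>b\<close> if \<open>b\<close> is one of its two choices, otherwise whatever choice beats
  \<open>b\<close>. A job between the two choices demands the first choice, a job after the second
  choice demands nothing.\<close>

definition pv :: "'a \<Rightarrow> 'b \<Rightarrow> nat" where "pv a b = base a b + (if usable a b then 1 else 0)"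

text \<open>The states of an agent form the chain second choice at dual value \<open>-1\<close>, first choice at
  \<open>-1\<close>, second choice at \<open>1\<close>, first choice at \<open>1\<close>, dual value \<open>0\<close>. The states of a job form the
  opposite chain: its list at \<open>y = -1\<close>, its list again at \<open>y = 1\<close>, and finally \<open>y = 0\<close>.\<close>

definition astate :: "('a \<times> 'b) set \<Rightarrow> ('a \<Rightarrow> int) \<Rightarrow> 'a \<Rightarrow> nat" where
  "astate M x a = (if x a = 0 then 4 else (if x a = 1 then 2 else 0) + (if ka M a < sr a then 1 else 0))"
definition jstate :: "('a \<times> 'b) set \<Rightarrow> ('b \<Rightarrow> int) \<Rightarrow> 'b \<Rightarrow> nat" where
  "jstate M y b = (if y b = 0 then 2 * db b else (if y b = 1 then db b else 0) + kb M b)"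

end

text \<open>\<open>opt\<close> contains the usual agent-optimality, since a stable matching is
  certified by dual values 0, but it speaks of all popular matchings: they do not beat
  \<open>S\<close> at any agent of nonnegative dual value.\<close>

locale agent_optimal = marriage +
  fixes S :: "('a \<times> 'b) set"
  assumes S: "matching G S"
    and stable: "\<And>a b. (a, b) \<in> edges G \<Longrightarrow> ra a b < ka S a \<Longrightarrow> kb S b < rb b a"
    and opt: "\<And>M x y a. witness M x y \<Longrightarrow> a \<in> agents G \<Longrightarrow> 0 \<le> x a \<Longrightarrow> ka S a \<le> ka M a"

section \<open>The structure of one certified fully popular matching\<close>

locale fp_solution = agent_optimal +
  fixes M :: "('a \<times> 'b) set" and x :: "'a \<Rightarrow> int" and y :: "'b \<Rightarrow> int"
  assumes fp: "fp_witness M x y"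
begin

lemma wit: "witness M x y" and M: "matching G M"
  using fp witnessD(1) by (auto simp: fp_witness_def)

lemma ka_cases: "a \<in> agents G \<Longrightarrow> ka M a = 0 \<or> ka M a = sr a"
  using fp by (simp add: fp_witness_def)

text \<open>Its partner cannot have it as second choice, because second choices are nobody's first
  choice.\<close>

lemma fjob_matched: "b \<in> fjobs \<Longrightarrow> \<exists>a. (a, b) \<in> M \<and> ra a b = 0"
proof -
  assume b: "b \<in> fjobs"
  then obtain a where a: "(a, b) \<in> M" using fp by (auto simp: fp_witness_def)
  then have e: "(a, b) \<in> edges G" using matchingD(1)[OF M] by blast
  then have "ra a b = 0 \<or> ra a b = sr a" using ka_cases ka_matched[OF M a] edge_vertices by force
  then show ?thesis using a b eq_sr[OF e] by blast
qed

lemma x_cases: "x a = -1 \<or> x a = 0 \<or> x a = 1" and y_cases: "y b = -1 \<or> y b = 0 \<or> y b = 1"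
  using witnessD(2,4)[OF wit] by blast+

lemma x_unmatched: "x a \<noteq> 0 \<Longrightarrow> ka M a < da a" and y_unmatched: "y b \<noteq> 0 \<Longrightarrow> kb M b < db b"
  using witnessD(3,5)[OF wit] ka_less_iff[OF M] kb_less_iff[OF M] by blast+

lemma x_eq_y: "(a, b) \<in> M \<Longrightarrow> x a = y b"
  using witnessD(6)[OF wit] .

lemma edge_ineq: "(a, b) \<in> edges G \<Longrightarrow> wt M a b \<le> x a - y b"
  using witnessD(7)[OF wit] .

lemma agent_would_gain: "(a, b) \<in> edges G \<Longrightarrow> ra a b < ka M a \<Longrightarrow> 1 + sgn (int (kb M b) - int (rb b a)) \<le> x a - y b"
  using edge_ineq[of a b] by (simp add: wt_def sgn_int_simps)

lemma job_would_gain: "(a, b) \<in> edges G \<Longrightarrow> rb b a < kb M b \<Longrightarrow> sgn (int (ka M a) - int (ra a b)) + 1 \<le> x a - y b"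
  using edge_ineq[of a b] by (simp add: wt_def sgn_int_simps)

lemma both_would_gain: "(a, b) \<in> edges G \<Longrightarrow> ra a b < ka M a \<Longrightarrow> rb b a < kb M b \<Longrightarrow> x a = 1 \<and> y b = -1"
  using agent_would_gain[of a b] x_cases[of a] y_cases[of b] by (auto simp: sgn_int_simps)

text \<open>By \<open>opt\<close> the agent could only be worse off than in \<open>S\<close>. Then
  its partner in \<open>S\<close> comes before its second choice, so it is a first choice and
  \<open>M\<close> gives it to an agent ranking it first; by stability it prefers \<open>a\<close>.
  Both ends of this edge would gain, which needs \<open>x a\<close> = 1.\<close>

lemma zero_agent: "a \<in> agents G \<Longrightarrow> x a = 0 \<Longrightarrow> ka M a = ka S a"
proof (rule ccontr)
  assume a: "a \<in> agents G" and x: "x a = 0" and "ka M a \<noteq> ka S a"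
  then have l: "ka S a < ka M a" using opt[OF wit a] by simp
  then have "ka S a < da a" using ka_le[OF M, of a] by simp
  then obtain b where b: "(a, b) \<in> S" using ka_less_iff[OF S] by blast
  then have e: "(a, b) \<in> edges G" using matchingD(1)[OF S] by blast
  have r: "ra a b < ka M a" using l ka_matched[OF S b] by simp
  then have "ra a b < sr a" using ka_cases[OF a] by auto
  then have "b \<in> fjobs" using less_sr e by blast
  then obtain c where c: "(c, b) \<in> M" "ra c b = 0" using fjob_matched by blast
  then have ec: "(c, b) \<in> edges G" using matchingD(1)[OF M] by blast
  have "c \<noteq> a" using r ka_matched[OF M c(1)] by auto
  then have "(c, b) \<notin> S" using matchingD(3)[OF S b] by blast
  then have "0 < ka S c" using ka_eq_ra[OF S ec] c by auto
  then have "kb S b < rb b c" using stable[OF ec] c by simp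
  then have "rb b a < kb M b" using kb_matched[OF S b] kb_matched[OF M c(1)] by simp
  then show False using both_would_gain[OF e r] x by simp
qed

text \<open>A matched job inherits this from its partner. An unmatched job with a partner
  \<open>a\<close> in \<open>S\<close> would gain from \<open>a\<close>. If \<open>x a\<close> is
  nonnegative, \<open>opt\<close> makes \<open>a\<close> gain too, and the edge inequality would
  need \<open>x a\<close> = 2; if \<open>x a\<close> = -1, the vote of the job alone already makes
  the weight of the edge too large.\<close>

lemma zero_job: "b \<in> jobs G \<Longrightarrow> y b = 0 \<Longrightarrow> kb M b = kb S b"
proof (cases "\<exists>a. (a, b) \<in> M")
  case True
  assume y: "y b = 0"
  from True obtain a where a: "(a, b) \<in> M" by blast
  then have e: "(a, b) \<in> edges G" using matchingD(1)[OF M] by blast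
  have "ka M a = ka S a" using zero_agent[of a] x_eq_y[OF a] y edge_vertices[OF e] by simp
  then have "(a, b) \<in> S" using ka_eq_ra[OF S e] ka_matched[OF M a] by simp
  then show ?thesis using kb_matched[OF S] kb_matched[OF M a] by simp
next
  case False
  assume y: "y b = 0"
  have u: "kb M b = db b" using False by (simp add: kb_unmatched)
  have "(a, b) \<notin> S" for a
  proof
    assume ab: "(a, b) \<in> S"
    then have e: "(a, b) \<in> edges G" using matchingD(1)[OF S] by blast
    have g: "sgn (int (ka M a) - int (ra a b)) + 1 \<le> x a"
      using job_would_gain[OF e] u rb_less[OF e] y by simp
    have ne: "ka M a \<noteq> ra a b" using False ka_eq_ra[OF M e] by blast
    show False
    proof (cases "0 \<le> x a")
      case True
      then have "ra a b < ka M a"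
        using opt[OF wit, of a] ka_matched[OF S ab] ne edge_vertices[OF e] by simp
      then show False using g x_cases[of a] by (auto simp: sgn_int_simps)
    next
      case False
      then show False using g by (auto simp: sgn_if split: if_splits)
    qed
  qed
  then show ?thesis using u kb_unmatched by simp
qed

text \<open>A job doing worse than in \<open>S\<close> would gain from its partner \<open>a\<close>
  in \<open>S\<close>. With \<open>y b\<close> = 1 the edge inequality is satisfied only if
  \<open>a\<close> has positive dual value and something better than \<open>b\<close>, against
  \<open>opt\<close>.\<close>

lemma one_job: "y b = 1 \<Longrightarrow> kb M b \<le> kb S b"
proof (cases "\<exists>a. (a, b) \<in> S")
  case False
  then show ?thesis using kb_unmatched[of b S] kb_le[OF M, of b] by simp
next
  case True
  assume y: "y b = 1"
  from True obtain a where ab: "(a, b) \<in> S" by blast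
  then have e: "(a, b) \<in> edges G" using matchingD(1)[OF S] by blast
  show ?thesis
  proof (rule ccontr)
    assume "\<not> ?thesis"
    then have l: "rb b a < kb M b" using kb_matched[OF S ab] by simp
    then have "(a, b) \<notin> M" using kb_matched[OF M] by auto
    then have ne: "ka M a \<noteq> ra a b" using ka_eq_ra[OF M e] by blast
    have g: "sgn (int (ka M a) - int (ra a b)) + 1 \<le> x a - 1"
      using job_would_gain[OF e l] y by simp
    then have "0 \<le> x a" "ka M a < ra a b" using x_cases[of a] ne by (auto simp: sgn_if split: if_splits)
    then show False using opt[OF wit, of a] ka_matched[OF S ab] edge_vertices[OF e] by simp
  qed
qed

lemma jstate_passed: "(a, b) \<in> edges G \<Longrightarrow> rb b a < jstate M y b \<Longrightarrow> y b = -1 \<Longrightarrow> rb b a < kb M b"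
  by (simp add: jstate_def)

lemma jstate_passed_twice:
  "(a, b) \<in> edges G \<Longrightarrow> db b + rb b a < jstate M y b \<Longrightarrow> y b = 0 \<or> (y b = 1 \<and> rb b a < kb M b)"
  using y_cases[of b] kb_le[OF M, of b] by (auto simp: jstate_def split: if_splits)

lemma passed_nonneg: 
  assumes e: "(a, b) \<in> edges G" and p: "rb b a < jstate M y b" and r: "ra a b < ka M a"
  shows "0 \<le> x a" "y b = -1 \<Longrightarrow> x a = 1" "y b = 1 \<Longrightarrow> x a = 1"
  using agent_would_gain[OF e r] both_would_gain[OF e r] jstate_passed[OF e p] y_cases[of b] x_cases[of a]
  by (auto simp: sgn_if split: if_splits)

lemma astate_matched: "(a, b) \<in> M \<Longrightarrow> astate M x a =
    (if y b = 0 then 4 else (if y b = 1 then 2 else 0) + base a b)"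
  using x_eq_y[of a b] ka_matched[OF M, of a b] by (simp add: astate_def base_def)

text \<open>A job beyond \<open>a\<close> in its chain either would gain from \<open>a\<close> or
  has \<open>y b\<close> at least 0. Either way the edge inequality gives \<open>a\<close> a
  nonnegative dual value, hence a state of at least 2, if \<open>a\<close> would like
  \<open>b\<close> better than its partner. Otherwise the partner of \<open>a\<close> already
  guarantees the bound.\<close>

lemma astate_passed:
  assumes e: "(a, b) \<in> edges G" and p: "rb b a < jstate M y b"
  shows "pv a b \<le> astate M x a"
proof (cases "(a, b) \<in> M")
  case True
  then have "y b \<noteq> -1" using p kb_matched[OF M True] by (auto simp: jstate_def)
  then show ?thesis
    using astate_matched[OF True] y_cases[of b] by (auto simp: pv_def base_def)
next
  case False
  then have ne: "ka M a \<noteq> ra a b" using ka_eq_ra[OF M e] by blast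
  have a: "a \<in> agents G" using edge_vertices[OF e] by simp
  show ?thesis
  proof (cases "ra a b < ka M a")
    case True
    then show ?thesis using passed_nonneg(1)[OF e p True] x_cases[of a]
      by (auto simp: astate_def pv_def base_def)
  next
    case False
    then show ?thesis using ne ka_cases[OF a] sr_pos[OF e]
      by (auto simp: astate_def pv_def base_def usable_def)
  qed
qed

text \<open>The hypothesis \<open>s\<close> matters when \<open>y b\<close> = 0: the state then
  counts as \<open>2 * db b\<close> although \<open>b\<close> is matched as in \<open>S\<close>, so
  \<open>b\<close> would gain only from agents it prefers to its partner in
  \<open>S\<close>.\<close>

lemma astate_passed_twice:
  assumes e: "(a, b) \<in> edges G" and p: "db b + rb b a < jstate M y b" and s: "rb b a < kb S b"
  shows "2 + pv a b \<le> astate M x a"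
proof -
  have b: "b \<in> jobs G" "a \<in> agents G" using edge_vertices[OF e] by auto
  have l: "rb b a < kb M b" using jstate_passed_twice[OF e p] zero_job[OF b(1)] s by auto
  then have "(a, b) \<notin> M" using kb_matched[OF M] by auto
  then have ne: "ka M a \<noteq> ra a b" using ka_eq_ra[OF M e] by blast
  have "x a = 0 \<or> x a = 1 \<and> ka M a < ra a b"
    using job_would_gain[OF e l] jstate_passed_twice[OF e p] x_cases[of a] ne
    by (auto simp: sgn_if split: if_splits)
  then show ?thesis using sr_pos[OF e] ka_cases[OF b(2)]
    by (auto simp: astate_def pv_def base_def usable_def)
qed

lemma astate_zero: "astate M x a = 4 \<longleftrightarrow> x a = 0"
  by (auto simp: astate_def)

text \<open>Not having its first choice in \<open>S\<close>, the agent has its second choice in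
  \<open>M\<close> and would gain from \<open>b\<close>. A job beyond \<open>a\<close> with nonzero
  \<open>y b\<close> would then force \<open>x a\<close> = 1.\<close>

lemma zero_passed:
  assumes e: "(a, b) \<in> edges G" and p: "rb b a < jstate M y b" and x: "x a = 0"
    and r: "ra a b < sr a" and s: "ka S a \<noteq> 0"
  shows "y b = 0"
proof -
  have "ka M a = sr a" using zero_agent[of a] ka_cases[of a] edge_vertices[OF e] x s by auto
  then show ?thesis using passed_nonneg[OF e p] r x y_cases[of b] by auto
qed

lemma zero_passed_twice:
  assumes e: "(a, b) \<in> edges G" and p: "db b + rb b a < jstate M y b" and x: "x a = 0"
  shows "y b = 0"
  using jstate_passed_twice[OF e p] job_would_gain[OF e] x by (auto simp: sgn_if split: if_splits)

lemma zero_partner: "(a, b) \<in> S \<Longrightarrow> x a = 0 \<Longrightarrow> y b = 0"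
  using zero_agent[of a] ka_eq_ra[OF M, of a b] ka_matched[OF S, of a b] x_eq_y[of a b]
    matchingD(1)[OF S, of a b] edge_vertices[of a b] by auto

lemma zero_partner': "(a, b) \<in> S \<Longrightarrow> y b = 0 \<Longrightarrow> x a = 0"
  using zero_job[of b] kb_eq_rb[OF M, of a b] kb_matched[OF S, of a b] x_eq_y[of a b]
    matchingD(1)[OF S, of a b] edge_vertices[of a b] by auto

lemma at_first: "(a, b) \<in> edges G \<Longrightarrow> jstate M y b = rb b a \<Longrightarrow> (a, b) \<in> M \<and> y b = -1"
  using rb_less[of a b] y_cases[of b] kb_eq_rb[OF M, of a b] by (auto simp: jstate_def split: if_splits)

lemma at_second: "(a, b) \<in> edges G \<Longrightarrow> jstate M y b = db b + rb b a \<Longrightarrow> (a, b) \<in> M \<and> y b = 1"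
  using rb_less[of a b] y_cases[of b] kb_eq_rb[OF M, of a b] y_unmatched[of b]
  by (auto simp: jstate_def split: if_splits)

lemma sit_first:
  assumes e: "(a, b) \<in> edges G" and p: "rb b a \<le> jstate M y b"
  shows "base a b \<le> astate M x a"
proof (cases "rb b a = jstate M y b")
  case True then show ?thesis using at_first[OF e] astate_matched[of a b] by simp
next
  case False then show ?thesis using astate_passed[OF e] p by (simp add: pv_def)
qed

text \<open>In effect the chain of \<open>b\<close> ends at the second visit to its partner in
  \<open>S\<close>: with \<open>y b\<close> = 0 this is its partner anyway, and with
  \<open>y b\<close> = 1 \<open>one_job\<close> allows no worse one.\<close>

lemma at_stable:
  assumes ab: "(a, b) \<in> S" and p: "db b + rb b a \<le> jstate M y b"
  shows "(a, b) \<in> M" "y b = 0 \<or> y b = 1"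
proof -
  have e: "(a, b) \<in> edges G" using ab matchingD(1)[OF S] by blast
  have b: "b \<in> jobs G" using edge_vertices[OF e] by simp
  have k: "kb S b = rb b a" using kb_matched[OF S ab] .
  show y: "y b = 0 \<or> y b = 1" using y_cases[of b] p y_unmatched[of b] by (auto simp: jstate_def)
  have "kb M b = rb b a"
  proof (cases "y b = 0")
    case True then show ?thesis using zero_job[OF b] k by simp
  next
    case False
    then show ?thesis using y one_job[of b] p k by (simp add: jstate_def)
  qed
  then show "(a, b) \<in> M" using kb_eq_rb[OF M e] by simp
qed

lemma sit_second:
  assumes e: "(a, b) \<in> edges G" and p: "db b + rb b a \<le> jstate M y b" and s: "rb b a \<le> kb S b"
  shows "2 + base a b \<le> astate M x a"
proof (cases "rb b a = kb S b")
  case True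
  then have "(a, b) \<in> S" using kb_eq_rb[OF S e] by simp
  then show ?thesis using at_stable[OF _ p] astate_matched[of a b] by (auto simp: base_def)
next
  case False
  then have s': "rb b a < kb S b" using s by simp
  show ?thesis
  proof (cases "db b + rb b a = jstate M y b")
    case True then show ?thesis using at_second[OF e] astate_matched[of a b] by simp
  next
    case False then show ?thesis using astate_passed_twice[OF e _ s'] p by (simp add: pv_def)
  qed
qed

lemma matched_usable: "(a, b) \<in> M \<Longrightarrow> usable a b"
  using ka_cases[of a] ka_matched[OF M, of a b] matchingD(1)[OF M, of a b] edge_vertices[of a b]
  by (auto simp: usable_def)

text \<open>The disjunction \<open>n\<close> lists what rules out a seat of \<open>b\<close> at
  \<open>a\<close>: \<open>a\<close> may not take \<open>b\<close>, \<open>a\<close> is known to be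
  in a better state, or \<open>b\<close> must have dual value 0.\<close>

lemma advance_first:
  assumes e: "(a, b) \<in> edges G" and p: "rb b a \<le> jstate M y b"
    and n: "\<not> usable a b \<or> base a b < astate M x a \<or> y b = 0"
  shows "rb b a < jstate M y b"
  using at_first[OF e] matched_usable[of a b] astate_matched[of a b] p n by (auto simp: le_less)

lemma advance_second:
  assumes e: "(a, b) \<in> edges G" and p: "db b + rb b a \<le> jstate M y b"
    and n: "\<not> usable a b \<or> 2 + base a b < astate M x a \<or> y b = 0"
  shows "db b + rb b a < jstate M y b"
  using at_second[OF e] matched_usable[of a b] astate_matched[of a b] p n by (auto simp: le_less)

lemma zero_stable:
  assumes ab: "(a, b) \<in> S" and p: "db b + rb b a \<le> jstate M y b"
    and n: "2 + base a b < astate M x a \<or> y b = 0"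
  shows "usable a b" "y b = 0" "x a = 0"
  using at_stable[OF ab p] matched_usable[of a b] astate_matched[of a b] n x_eq_y[of a b] by auto

lemma jstate_end: "2 * db b \<le> jstate M y b \<Longrightarrow> y b = 0"
  using y_unmatched[of b] by (auto simp: jstate_def split: if_splits)

lemma astate_le: "astate M x a \<le> 4"
  by (auto simp: astate_def)

end

section \<open>Proposals of the jobs\<close>

text \<open>Jobs propose along their chains. \<open>P b\<close> is the position of job \<open>b\<close> in its chain (the list
  of \<open>b\<close> twice over), \<open>v a\<close> a lower bound for the state of agent \<open>a\<close>; \<open>flag b\<close> says that job \<open>b\<close>
  must have dual value \<open>0\<close>. In \<open>hold\<close> and \<open>sat\<close> partners are shifted by one, \<open>0\<close> meaning none.
  The stack \<open>jst\<close> holds the jobs that may have to move, \<open>zst\<close> the agents whose lower bound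
  became \<open>4\<close> and whose lists have yet to be scanned, \<open>cst\<close> the agents that may lack a partner;
  \<open>zc\<close> is being scanned at the positions from \<open>zi\<close> up to but excluding \<open>ze\<close>.\<close>

record mach =
  P :: "nat \<Rightarrow> nat"
  v :: "nat \<Rightarrow> nat"
  hold :: "nat \<Rightarrow> nat"
  sat :: "nat \<Rightarrow> nat"
  flag :: "nat \<Rightarrow> nat"
  jst :: "nat list"
  zst :: "nat list"
  cst :: "nat list"
  zc :: nat
  zi :: nat
  ze :: nat

definition release :: "nat \<Rightarrow> mach \<Rightarrow> mach" where
  "release c m = (if hold m c = 0 then m else
     m\<lparr>sat := (sat m)(hold m c - 1 := 0), jst := (hold m c - 1) # jst m,
       hold := (hold m)(c := 0), cst := c # cst m\<rparr>)"

definition lift_to :: "nat \<Rightarrow> nat \<Rightarrow> mach \<Rightarrow> mach" where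
  "lift_to c w m = (if v m c < w
     then release c (m\<lparr>v := (v m)(c := w), zst := (if w = 4 then c # zst m else zst m)\<rparr>) else m)"

definition set_flag :: "nat \<Rightarrow> mach \<Rightarrow> mach" where
  "set_flag b m = m\<lparr>flag := (flag m)(b := 1)\<rparr>"

text \<open>A seat taken before the flag was raised presumes a nonzero dual value. So it is given
  up, and the job resumes its chain from where it stands.\<close>

definition flag_release :: "nat \<Rightarrow> mach \<Rightarrow> mach" where
  "flag_release b m = (if sat m b = 0 then set_flag b m else release (sat m b - 1) (set_flag b m))"

definition seat :: "nat \<Rightarrow> nat \<Rightarrow> mach \<Rightarrow> mach" where
  "seat b c m = m\<lparr>hold := (hold m)(c := Suc b), sat := (sat m)(b := Suc c)\<rparr>"

definition pop_job :: "mach \<Rightarrow> mach" where "pop_job m = m\<lparr>jst := tl (jst m)\<rparr>"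

section \<open>The abstract machine and its invariant\<close>

locale job_phase = agent_optimal G S
  for G :: "(nat, nat) marriage" and S :: "(nat \<times> nat) set"
begin

text \<open>The three reasons why dual value 0 at \<open>c\<close> implies dual value 0 at
  \<open>b\<close>: \<open>zero_passed_twice\<close>, \<open>zero_passed\<close> and
  \<open>zero_partner\<close>.\<close>

definition trig :: "mach \<Rightarrow> nat \<Rightarrow> nat \<Rightarrow> bool" where
  "trig m c b \<longleftrightarrow> db b + rb b c < P m b \<or> (rb b c < P m b \<and> ra c b < sr c \<and> ka S c \<noteq> 0) \<or>
     ra c b = ka S c"

definition scan_step :: "mach \<Rightarrow> mach" where
  "scan_step m = (let b = agent_ranking G (zc m) ! zi m; m' = m\<lparr>zi := Suc (zi m)\<rparr> in
     if flag m b = 0 \<and> trig m (zc m) b then flag_release b m' else m')"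

definition scan_next :: "mach \<Rightarrow> mach" where
  "scan_next m = m\<lparr>zst := tl (zst m), zc := hd (zst m), zi := 0, ze := da (hd (zst m))\<rparr>"

text \<open>The scan of \<open>c\<close> may be over when \<open>P b\<close> grows, so the two
  triggers that depend on \<open>P\<close> are tested here as well. The job is unseated at this
  point, so setting the flag revokes nothing.\<close>

definition pass :: "nat \<Rightarrow> nat \<Rightarrow> nat \<Rightarrow> bool \<Rightarrow> mach \<Rightarrow> mach" where
  "pass b c w two m = (let m1 = lift_to c w m;
      m2 = (if v m1 c = 4 \<and> (two \<or> (ra c b < sr c \<and> ka S c \<noteq> 0)) then set_flag b m1 else m1)
    in m2\<lparr>P := (P m2)(b := Suc (P m2 b))\<rparr>)"

text \<open>A flagged job walks on until it meets its partner in \<open>S\<close> for the second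
  time. There the only option left is dual value 0 for both, and if this agent may not take the job,
  no solution exists.\<close>

definition job_step :: "mach \<Rightarrow> mach option" where
  "job_step m = (let b = hd (jst m) in
     if sat m b \<noteq> 0 then Some (pop_job m)
     else if P m b = 2 * db b then Some (set_flag b (pop_job m))
     else let two = (db b \<le> P m b); j = (if two then P m b - db b else P m b);
            c = job_ranking G b ! j; w = (if two then 2 else 0) + base c b in
       if flag m b = 0 \<and> usable c b \<and> v m c \<le> w then Some (seat b c (lift_to c w (pop_job m)))
       else if two \<and> (c, b) \<in> S then
         (if usable c b then Some (seat b c (lift_to c 4 (set_flag b (pop_job m)))) else None)
       else Some (pass b c (w + (if usable c b then 1 else 0)) two m))"

text \<open>An agent without a job has dual value 0 in every solution once all jobs rest, so it is
  matched as in \<open>S\<close>. If \<open>S\<close> leaves it unmatched although it has a second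
  choice, this contradicts \<open>A_popular_iff\<close>, and there is no solution.\<close>

definition cand_step :: "mach \<Rightarrow> mach option" where
  "cand_step m = (let c = hd (cst m); m' = m\<lparr>cst := tl (cst m)\<rparr> in
     if hold m c = 0 \<and> v m c < 4 then
       (if ka S c = da c \<and> sr c < da c then None
        else Some (m'\<lparr>v := (v m)(c := 4), zst := c # zst m\<rparr>))
     else Some m')"

text \<open>Candidates come last because \<open>unheld_zero\<close> needs a configuration with no
  scan pending and no job on the move.\<close>

definition step :: "mach \<Rightarrow> mach option" where
  "step m = (if zi m < ze m then Some (scan_step m)
     else if zst m \<noteq> [] then Some (scan_next m)
     else if jst m \<noteq> [] then job_step m else cand_step m)"

definition finished :: "mach \<Rightarrow> bool" where
  "finished m \<longleftrightarrow> \<not> zi m < ze m \<and> zst m = [] \<and> jst m = [] \<and> cst m = []"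

definition sits :: "mach \<Rightarrow> nat \<Rightarrow> nat \<Rightarrow> bool" where
  "sits m b c \<longleftrightarrow> (c, b) \<in> edges G \<and> hold m c = Suc b \<and> usable c b \<and>
     (if flag m b = 0
      then P m b = rb b c \<and> v m c = base c b \<or> P m b = db b + rb b c \<and> v m c = 2 + base c b
      else (c, b) \<in> S \<and> P m b = db b + rb b c \<and> v m c = 4)"

definition sound :: "mach \<Rightarrow> bool" where
  "sound m \<longleftrightarrow> (\<forall>M x y. fp_witness M x y \<longrightarrow>
     (\<forall>b\<in>jobs G. P m b \<le> jstate M y b \<and> (flag m b \<noteq> 0 \<longrightarrow> y b = 0)) \<and>
     (\<forall>a\<in>agents G. v m a \<le> astate M x a))"

text \<open>The set \<open>X\<close> contains jobs that have been taken off the stack for the time being.\<close>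

definition inv :: "nat set \<Rightarrow> mach \<Rightarrow> bool" where
  "inv X m \<longleftrightarrow>
     (\<forall>b\<in>jobs G. P m b \<le> db b + kb S b) \<and>
     (\<forall>(c, b)\<in>edges G. rb b c < P m b \<longrightarrow> pv c b \<le> v m c) \<and>
     (\<forall>(c, b)\<in>edges G. db b + rb b c < P m b \<longrightarrow> 2 + pv c b \<le> v m c) \<and>
     (\<forall>(c, b)\<in>edges G. v m c = 4 \<and> flag m b = 0 \<and> trig m c b \<longrightarrow>
        c \<in> set (zst m) \<or> c = zc m \<and> zi m \<le> ra c b \<and> ra c b < ze m) \<and>
     (\<forall>b\<in>jobs G. sat m b \<noteq> 0 \<longrightarrow> sits m b (sat m b - 1)) \<and>
     (\<forall>c\<in>agents G. hold m c \<noteq> 0 \<longrightarrow> hold m c - 1 \<in> jobs G \<and> sat m (hold m c - 1) = Suc c) \<and>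
     (\<forall>b\<in>jobs G - X. sat m b = 0 \<longrightarrow>
        b \<in> set (jst m) \<or> flag m b \<noteq> 0 \<and> kb S b = db b \<and> P m b = 2 * db b) \<and>
     (\<forall>c\<in>agents G. hold m c = 0 \<longrightarrow> v m c = 4 \<or> c \<in> set (cst m)) \<and>
     (\<forall>c\<in>agents G. v m c = 4 \<and> ka S c = da c \<longrightarrow> sr c = da c) \<and>
     (\<forall>c\<in>agents G. v m c \<le> 4) \<and>
     set (jst m) \<subseteq> jobs G \<and> set (zst m) \<subseteq> agents G \<and> set (cst m) \<subseteq> agents G \<and>
     (zi m < ze m \<longrightarrow> zc m \<in> agents G \<and> v m (zc m) = 4 \<and> ze m = da (zc m)) \<and>
     (\<forall>c\<in>set (zst m). v m c = 4) \<and>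
     sound m"

lemma invI:
  assumes "\<And>b. b \<in> jobs G \<Longrightarrow> P m b \<le> db b + kb S b"
    "\<And>b c. (c, b) \<in> edges G \<Longrightarrow> rb b c < P m b \<Longrightarrow> pv c b \<le> v m c"
    "\<And>b c. (c, b) \<in> edges G \<Longrightarrow> db b + rb b c < P m b \<Longrightarrow> 2 + pv c b \<le> v m c"
    "\<And>b c. (c, b) \<in> edges G \<Longrightarrow> v m c = 4 \<Longrightarrow> flag m b = 0 \<Longrightarrow> trig m c b \<Longrightarrow> c \<in> set (zst m) \<or> c = zc m \<and> zi m \<le> ra c b \<and> ra c b < ze m"
    "\<And>b. b \<in> jobs G \<Longrightarrow> sat m b \<noteq> 0 \<Longrightarrow> sits m b (sat m b - 1)"
    "\<And>c. c \<in> agents G \<Longrightarrow> hold m c \<noteq> 0 \<Longrightarrow> hold m c - 1 \<in> jobs G \<and> sat m (hold m c - 1) = Suc c"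
    "\<And>b. b \<in> jobs G \<Longrightarrow> b \<notin> X \<Longrightarrow> sat m b = 0 \<Longrightarrow> b \<in> set (jst m) \<or> flag m b \<noteq> 0 \<and> kb S b = db b \<and> P m b = 2 * db b"
    "\<And>c. c \<in> agents G \<Longrightarrow> hold m c = 0 \<Longrightarrow> v m c = 4 \<or> c \<in> set (cst m)"
    "\<And>c. c \<in> agents G \<Longrightarrow> v m c = 4 \<Longrightarrow> ka S c = da c \<Longrightarrow> sr c = da c"
    "\<And>c. c \<in> agents G \<Longrightarrow> v m c \<le> 4"
    "set (jst m) \<subseteq> jobs G"
    "set (zst m) \<subseteq> agents G"
    "set (cst m) \<subseteq> agents G"
    "zi m < ze m \<Longrightarrow> zc m \<in> agents G \<and> v m (zc m) = 4 \<and> ze m = da (zc m)"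
    "\<And>c. c \<in> set (zst m) \<Longrightarrow> v m c = 4"
    "sound m"
  shows "inv X m"
  unfolding inv_def
  by (intro conjI; (intro ballI)?; (intro impI)?)
    (use assms(1) in blast, use assms(2) in blast, use assms(3) in blast, use assms(4) in blast, use assms(5) in blast, use assms(6) in blast, use assms(7) in blast, use assms(8) in blast, use assms(9) in blast, use assms(10) in blast, use assms(11) in blast, use assms(12) in blast, use assms(13) in blast, use assms(14) in blast, use assms(15) in blast, use assms(16) in blast)

lemma invD:
  assumes "inv X m"
  shows "b \<in> jobs G \<Longrightarrow> P m b \<le> db b + kb S b"
    "(c, b) \<in> edges G \<Longrightarrow> rb b c < P m b \<Longrightarrow> pv c b \<le> v m c"
    "(c, b) \<in> edges G \<Longrightarrow> db b + rb b c < P m b \<Longrightarrow> 2 + pv c b \<le> v m c"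
    "(c, b) \<in> edges G \<Longrightarrow> v m c = 4 \<Longrightarrow> flag m b = 0 \<Longrightarrow> trig m c b \<Longrightarrow>
        c \<in> set (zst m) \<or> c = zc m \<and> zi m \<le> ra c b \<and> ra c b < ze m"
    "b \<in> jobs G \<Longrightarrow> sat m b \<noteq> 0 \<Longrightarrow> sits m b (sat m b - 1)"
    "c \<in> agents G \<Longrightarrow> hold m c \<noteq> 0 \<Longrightarrow> hold m c - 1 \<in> jobs G \<and> sat m (hold m c - 1) = Suc c"
    "b \<in> jobs G \<Longrightarrow> b \<notin> X \<Longrightarrow> sat m b = 0 \<Longrightarrow>
        b \<in> set (jst m) \<or> flag m b \<noteq> 0 \<and> kb S b = db b \<and> P m b = 2 * db b"
    "c \<in> agents G \<Longrightarrow> hold m c = 0 \<Longrightarrow> v m c = 4 \<or> c \<in> set (cst m)"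
    "c \<in> agents G \<Longrightarrow> v m c = 4 \<Longrightarrow> ka S c = da c \<Longrightarrow> sr c = da c"
    "c \<in> agents G \<Longrightarrow> v m c \<le> 4"
    "set (jst m) \<subseteq> jobs G" "set (zst m) \<subseteq> agents G" "set (cst m) \<subseteq> agents G"
    "zi m < ze m \<Longrightarrow> zc m \<in> agents G \<and> v m (zc m) = 4 \<and> ze m = da (zc m)"
    "c \<in> set (zst m) \<Longrightarrow> v m c = 4"
    "sound m"
  using assms unfolding inv_def by (elim conjE; simp; fastforce)+

lemma soundD:
  assumes "sound m" "fp_witness M x y"
  shows "b \<in> jobs G \<Longrightarrow> P m b \<le> jstate M y b" "b \<in> jobs G \<Longrightarrow> flag m b \<noteq> 0 \<Longrightarrow> y b = 0"
    "a \<in> agents G \<Longrightarrow> v m a \<le> astate M x a"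
  using assms unfolding sound_def by blast+

lemma trig_cong: "P m' = P m \<Longrightarrow> trig m' c b = trig m c b"
  by (simp add: trig_def)

lemma sits_cong: "P m' = P m \<Longrightarrow> hold m' c = hold m c \<Longrightarrow> v m' c = v m c \<Longrightarrow> flag m' b = flag m b \<Longrightarrow>
    sits m' b c = sits m b c"
  by (simp add: sits_def)

lemma frame:
  assumes "P m' = P m" "v m' = v m" "hold m' = hold m" "flag m' = flag m"
  shows "sits m' = sits m" "trig m' = trig m" "sound m' = sound m"
  using assms by (simp_all add: fun_eq_iff sits_def trig_def sound_def)

section \<open>Preservation of the invariant\<close>

lemma holder:
  assumes "inv X m" "c \<in> agents G" "hold m c \<noteq> 0"
  shows "sits m (hold m c - 1) c"
  using invD(5)[OF assms(1), of "hold m c - 1"] invD(6)[OF assms] by simp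

text \<open>The seat at \<open>c\<close> was tied to the old value, so raising it dissolves the
  seat. Job and agent go back on their stacks, which keeps the clauses on unseated jobs and unheld
  agents true.\<close>

lemma lift_to_inv:
  assumes I: "inv X m" and c: "c \<in> agents G" and w: "w \<le> 4"
    and s: "\<And>M x y. fp_witness M x y \<Longrightarrow> w \<le> astate M x c"
    and z: "w = 4 \<Longrightarrow> ka S c = da c \<Longrightarrow> sr c = da c"
  shows "inv X (lift_to c w m)"
proof (cases "v m c < w")
  case False
  then show ?thesis using I by (simp add: lift_to_def)
next
  case lt: True
  define h where "h = hold m c"
  define m' where "m' = lift_to c w m"
  have f: "P m' = P m" "v m' = (v m)(c := w)" "flag m' = flag m" "hold m' = (hold m)(c := 0)"
    "sat m' = (if h = 0 then sat m else (sat m)(h - 1 := 0))"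
    "jst m' = (if h = 0 then jst m else (h - 1) # jst m)"
    "cst m' = (if h = 0 then cst m else c # cst m)"
    "zst m' = (if w = 4 then c # zst m else zst m)" "zc m' = zc m" "zi m' = zi m" "ze m' = ze m"
    using lt by (auto simp: m'_def lift_to_def release_def h_def fun_eq_iff)
  have hh: "h \<noteq> 0 \<Longrightarrow> h - 1 \<in> jobs G \<and> sat m (h - 1) = Suc c" using invD(6)[OF I c] h_def by simp
  have vv: "v m a \<le> v m' a" for a using lt f by simp
  have v4: "v m a = 4 \<Longrightarrow> a \<noteq> c" for a using lt w by auto
  have only: "sat m b = Suc c \<Longrightarrow> b \<in> jobs G \<Longrightarrow> h = Suc b" for b
    using invD(5)[OF I, of b] by (simp add: sits_def h_def)
  have t: "trig m' = trig m" using trig_cong[OF f(1)] by (simp add: fun_eq_iff)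
  show ?thesis
    unfolding m'_def[symmetric]
  proof (rule invI)
    show "P m' b \<le> db b + kb S b" if "b \<in> jobs G" for b using invD(1)[OF I that] f by simp
    show "pv a b \<le> v m' a" if "(a, b) \<in> edges G" "rb b a < P m' b" for a b
      using invD(2)[OF I that(1)] that f(1) vv[of a] by simp
    show "2 + pv a b \<le> v m' a" if "(a, b) \<in> edges G" "db b + rb b a < P m' b" for a b
      using invD(3)[OF I that(1)] that f(1) vv[of a] by simp
    show "a \<in> set (zst m') \<or> a = zc m' \<and> zi m' \<le> ra a b \<and> ra a b < ze m'"
      if "(a, b) \<in> edges G" "v m' a = 4" "flag m' b = 0" "trig m' a b" for a b
      using invD(4)[OF I that(1)] that v4 by (auto simp: f t split: if_splits)
    show "sits m' b (sat m' b - 1)" if b: "b \<in> jobs G" "sat m' b \<noteq> 0" for b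
    proof -
      have a: "sat m' b = sat m b" "sat m b \<noteq> 0" using b by (auto simp: f split: if_splits)
      have "sat m b \<noteq> Suc c" using only[of b] b by (auto simp: f split: if_splits)
      then have ne: "sat m b - 1 \<noteq> c" using a by auto
      have "sits m' b (sat m b - 1) = sits m b (sat m b - 1)" by (rule sits_cong) (use f ne in auto)
      then show ?thesis using invD(5)[OF I b(1) a(2)] a(1) by simp
    qed
    show "hold m' a - 1 \<in> jobs G \<and> sat m' (hold m' a - 1) = Suc a" if a: "a \<in> agents G" "hold m' a \<noteq> 0" for a
    proof -
      have "a \<noteq> c" "hold m' a = hold m a" "hold m a \<noteq> 0" using a by (auto simp: f split: if_splits)
      then show ?thesis using invD(6)[OF I a(1)] hh by (cases "h = 0") (auto simp: f)
    qed
  next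
    show "b \<in> set (jst m') \<or> flag m' b \<noteq> 0 \<and> kb S b = db b \<and> P m' b = 2 * db b" if "b \<in> jobs G" "b \<notin> X" "sat m' b = 0" for b
      using invD(7)[OF I that(1,2)] that by (auto simp: f split: if_splits)
    show "v m' a = 4 \<or> a \<in> set (cst m')" if "a \<in> agents G" "hold m' a = 0" for a
      using invD(8)[OF I that(1)] that invD(8)[OF I c] lt w h_def by (auto simp: f split: if_splits)
    show "sr a = da a" if "a \<in> agents G" "v m' a = 4" "ka S a = da a" for a
      using invD(9)[OF I that(1)] that z by (auto simp: f split: if_splits)
    show "v m' a \<le> 4" if "a \<in> agents G" for a using invD(10)[OF I that] w by (auto simp: f)
    show "set (jst m') \<subseteq> jobs G" using invD(11)[OF I] hh by (auto simp: f split: if_splits)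
    show "set (zst m') \<subseteq> agents G" using invD(12)[OF I] c by (auto simp: f split: if_splits)
    show "set (cst m') \<subseteq> agents G" using invD(13)[OF I] c by (auto simp: f split: if_splits)
    show "v m' a = 4" if "a \<in> set (zst m')" for a using invD(15)[OF I, of a] that v4 by (auto simp: f split: if_splits)
    show "zc m' \<in> agents G \<and> v m' (zc m') = 4 \<and> ze m' = da (zc m')" if "zi m' < ze m'"
      using invD(14)[OF I] that v4 by (auto simp: f)
    show "sound m'" using invD(16)[OF I] s unfolding sound_def by (auto simp: f)
  qed
qed

lemma flag_release_inv:
  assumes I: "inv X m" and b: "b \<in> jobs G" "flag m b = 0"
    and s: "\<And>M x y. fp_witness M x y \<Longrightarrow> y b = 0"
  shows "inv X (flag_release b m)"
proof -
  define h where "h = sat m b"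
  define m' where "m' = flag_release b m"
  have sb: "h \<noteq> 0 \<Longrightarrow> sits m b (h - 1)" using invD(5)[OF I b(1)] h_def by simp
  then have hh: "h \<noteq> 0 \<Longrightarrow> hold m (h - 1) = Suc b \<and> h - 1 \<in> agents G"
    using edge_vertices by (auto simp: sits_def)
  have f: "P m' = P m" "v m' = v m" "flag m' = (flag m)(b := 1)"
    "hold m' = (if h = 0 then hold m else (hold m)(h - 1 := 0))"
    "sat m' = (sat m)(b := 0)"
    "jst m' = (if h = 0 then jst m else b # jst m)"
    "cst m' = (if h = 0 then cst m else (h - 1) # cst m)"
    "zst m' = zst m" "zc m' = zc m" "zi m' = zi m" "ze m' = ze m"
    using hh by (auto simp: m'_def flag_release_def release_def set_flag_def h_def fun_eq_iff)
  have t: "trig m' = trig m" using trig_cong[OF f(1)] by (simp add: fun_eq_iff)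
  show ?thesis
    unfolding m'_def[symmetric]
  proof (rule invI)
    show "P m' b \<le> db b + kb S b" if "b \<in> jobs G" for b using invD(1)[OF I that] f by simp
    show "pv a b \<le> v m' a" if "(a, b) \<in> edges G" "rb b a < P m' b" for a b
      using invD(2)[OF I that(1)] that f(1,2) by simp
    show "2 + pv a b \<le> v m' a" if "(a, b) \<in> edges G" "db b + rb b a < P m' b" for a b
      using invD(3)[OF I that(1)] that f(1,2) by simp
    show "a \<in> set (zst m') \<or> a = zc m' \<and> zi m' \<le> ra a b \<and> ra a b < ze m'"
      if "(a, b) \<in> edges G" "v m' a = 4" "flag m' b = 0" "trig m' a b" for a b
      using invD(4)[OF I that(1)] that by (auto simp: f t split: if_splits)
    show "sits m' b' (sat m' b' - 1)" if b': "b' \<in> jobs G" "sat m' b' \<noteq> 0" for b'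
    proof -
      have a: "b' \<noteq> b" "sat m' b' = sat m b'" "sat m b' \<noteq> 0" using b' by (auto simp: f split: if_splits)
      have sb': "sits m b' (sat m b' - 1)" using invD(5)[OF I b'(1) a(3)] .
      then have "h = 0 \<or> sat m b' - 1 \<noteq> h - 1" using hh a(1) by (auto simp: sits_def)
      then have "sits m' b' (sat m b' - 1) = sits m b' (sat m b' - 1)" using f a by (intro sits_cong) auto
      then show ?thesis using sb' a(2) by simp
    qed
    show "hold m' a - 1 \<in> jobs G \<and> sat m' (hold m' a - 1) = Suc a" if a: "a \<in> agents G" "hold m' a \<noteq> 0" for a
    proof -
      have "hold m' a = hold m a" "hold m a \<noteq> 0" "h = 0 \<or> a \<noteq> h - 1" using a by (auto simp: f split: if_splits)
      then show ?thesis using invD(6)[OF I a(1)] h_def by (auto simp: f)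
    qed
  next
    show "b' \<in> set (jst m') \<or> flag m' b' \<noteq> 0 \<and> kb S b' = db b' \<and> P m' b' = 2 * db b'" if "b' \<in> jobs G" "b' \<notin> X" "sat m' b' = 0" for b'
      using invD(7)[OF I that(1,2)] that b h_def by (auto simp: f split: if_splits)
    show "v m' a = 4 \<or> a \<in> set (cst m')" if "a \<in> agents G" "hold m' a = 0" for a
      using invD(8)[OF I that(1)] that by (auto simp: f split: if_splits)
    show "sr a = da a" if "a \<in> agents G" "v m' a = 4" "ka S a = da a" for a
      using invD(9)[OF I that(1)] that by (auto simp: f)
    show "v m' a \<le> 4" if "a \<in> agents G" for a using invD(10)[OF I that] by (auto simp: f)
    show "set (jst m') \<subseteq> jobs G" using invD(11)[OF I] b by (auto simp: f split: if_splits)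
    show "set (zst m') \<subseteq> agents G" using invD(12)[OF I] by (auto simp: f)
    show "set (cst m') \<subseteq> agents G" using invD(13)[OF I] hh by (auto simp: f split: if_splits)
    show "v m' a = 4" if "a \<in> set (zst m')" for a using invD(15)[OF I, of a] that by (auto simp: f)
    show "zc m' \<in> agents G \<and> v m' (zc m') = 4 \<and> ze m' = da (zc m')" if "zi m' < ze m'"
      using invD(14)[OF I] that by (auto simp: f)
    show "sound m'" using invD(16)[OF I] s unfolding sound_def by (auto simp: f)
  qed
qed

lemma flag_cong_inv:
  assumes "inv X m" "\<And>b. f b = 0 \<longleftrightarrow> flag m b = 0"
  shows "inv X (m\<lparr>flag := f\<rparr>)"
proof -
  have "sits (m\<lparr>flag := f\<rparr>) = sits m" "trig (m\<lparr>flag := f\<rparr>) = trig m"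
    "sound (m\<lparr>flag := f\<rparr>) = sound m"
    using assms(2) by (simp_all add: fun_eq_iff sits_def trig_def sound_def)
  then show ?thesis using assms unfolding inv_def by simp
qed

lemma set_flag_inv:
  assumes "inv X m" "b \<in> jobs G" "sat m b = 0" "\<And>M x y. fp_witness M x y \<Longrightarrow> y b = 0"
  shows "inv X (set_flag b m)"
proof (cases "flag m b = 0")
  case True
  then show ?thesis using flag_release_inv[OF assms(1,2)] assms(3,4) by (fastforce simp: flag_release_def)
next
  case False
  then show ?thesis unfolding set_flag_def by (intro flag_cong_inv[OF assms(1)]) auto
qed

text \<open>Closes the exception made for \<open>b\<close>: it was taken off the stack beforehand
  and is from now on accounted for by its seat.\<close>

lemma seat_inv:
  assumes I: "inv {b} m" and b: "b \<in> jobs G" "sat m b = 0" and c: "hold m c = 0"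
    and s: "sits (seat b c m) b c"
  shows "inv {} (seat b c m)"
proof -
  define m' where "m' = seat b c m"
  have f: "P m' = P m" "v m' = v m" "flag m' = flag m" "hold m' = (hold m)(c := Suc b)"
    "sat m' = (sat m)(b := Suc c)" "jst m' = jst m" "cst m' = cst m" "zst m' = zst m"
    "zc m' = zc m" "zi m' = zi m" "ze m' = ze m"
    by (simp_all add: m'_def seat_def)
  have t: "trig m' = trig m" using trig_cong[OF f(1)] by (simp add: fun_eq_iff)
  have cA: "c \<in> agents G" using s edge_vertices by (auto simp: sits_def)
  show ?thesis
    unfolding m'_def[symmetric]
  proof (rule invI)
    show "P m' b \<le> db b + kb S b" if "b \<in> jobs G" for b using invD(1)[OF I that] f by simp
    show "pv a b \<le> v m' a" if "(a, b) \<in> edges G" "rb b a < P m' b" for a b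
      using invD(2)[OF I that(1)] that f(1,2) by simp
    show "2 + pv a b \<le> v m' a" if "(a, b) \<in> edges G" "db b + rb b a < P m' b" for a b
      using invD(3)[OF I that(1)] that f(1,2) by simp
    show "a \<in> set (zst m') \<or> a = zc m' \<and> zi m' \<le> ra a b \<and> ra a b < ze m'"
      if "(a, b) \<in> edges G" "v m' a = 4" "flag m' b = 0" "trig m' a b" for a b
      using invD(4)[OF I that(1)] that by (auto simp: f t)
    show "sits m' b' (sat m' b' - 1)" if b': "b' \<in> jobs G" "sat m' b' \<noteq> 0" for b'
    proof (cases "b' = b")
      case True
      then show ?thesis using s f by (simp add: m'_def)
    next
      case False
      then have sb': "sits m b' (sat m b' - 1)" using invD(5)[OF I b'(1)] b' f by simp
      then have "sat m b' - 1 \<noteq> c" using c by (auto simp: sits_def)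
      then have "sits m' b' (sat m b' - 1) = sits m b' (sat m b' - 1)" using f by (intro sits_cong) auto
      then show ?thesis using sb' False f by simp
    qed
    show "hold m' a - 1 \<in> jobs G \<and> sat m' (hold m' a - 1) = Suc a" if a: "a \<in> agents G" "hold m' a \<noteq> 0" for a
      using invD(6)[OF I a(1)] a b by (auto simp: f split: if_splits)
  next
    show "b' \<in> set (jst m') \<or> flag m' b' \<noteq> 0 \<and> kb S b' = db b' \<and> P m' b' = 2 * db b'" if "b' \<in> jobs G" "b' \<notin> {}" "sat m' b' = 0" for b'
      using invD(7)[OF I that(1)] that b by (auto simp: f split: if_splits)
    show "v m' a = 4 \<or> a \<in> set (cst m')" if "a \<in> agents G" "hold m' a = 0" for a
      using invD(8)[OF I that(1)] that by (auto simp: f split: if_splits)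
    show "sr a = da a" if "a \<in> agents G" "v m' a = 4" "ka S a = da a" for a
      using invD(9)[OF I that(1)] that by (auto simp: f)
    show "v m' a \<le> 4" if "a \<in> agents G" for a using invD(10)[OF I that] by (auto simp: f)
    show "set (jst m') \<subseteq> jobs G" using invD(11)[OF I] by (auto simp: f)
    show "set (zst m') \<subseteq> agents G" using invD(12)[OF I] by (auto simp: f)
    show "set (cst m') \<subseteq> agents G" using invD(13)[OF I] by (auto simp: f)
    show "v m' a = 4" if "a \<in> set (zst m')" for a using invD(15)[OF I, of a] that by (auto simp: f)
    show "zc m' \<in> agents G \<and> v m' (zc m') = 4 \<and> ze m' = da (zc m')" if "zi m' < ze m'"
      using invD(14)[OF I] that by (auto simp: f)
    show "sound m'" using invD(16)[OF I] unfolding sound_def by (auto simp: f)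
  qed
qed

lemma advance_inv:
  assumes I: "inv X m" and e: "(c, b) \<in> edges G" and a0: "sat m b = 0"
    and p: "P m b = rb b c \<or> P m b = db b + rb b c \<and> rb b c < kb S b"
    and low: "pv c b \<le> v m c" and high: "P m b = db b + rb b c \<Longrightarrow> 2 + pv c b \<le> v m c"
    and fl: "v m c = 4 \<Longrightarrow> db b \<le> P m b \<or> (ra c b < sr c \<and> ka S c \<noteq> 0) \<Longrightarrow> flag m b \<noteq> 0"
    and s: "\<And>M x y. fp_witness M x y \<Longrightarrow> P m b < jstate M y b"
    and j: "b \<in> set (jst m)"
  shows "inv X (m\<lparr>P := (P m)(b := Suc (P m b))\<rparr>)"
proof -
  define m' where "m' = m\<lparr>P := (P m)(b := Suc (P m b))\<rparr>"
  have f: "P m' = (P m)(b := Suc (P m b))" "v m' = v m" "flag m' = flag m" "hold m' = hold m"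
    "sat m' = sat m" "jst m' = jst m" "cst m' = cst m" "zst m' = zst m"
    "zc m' = zc m" "zi m' = zi m" "ze m' = ze m"
    by (simp_all add: m'_def)
  have b: "b \<in> jobs G" using edge_vertices[OF e] by simp
  have lt: "rb b c < db b" using rb_less[OF e] .
  \<comment> \<open>Advancing \<open>b\<close> leaves behind exactly one new agent, namely
    \<open>c\<close>, in the first traversal of the list (\<open>one\<close>) or in the second
    (\<open>two\<close>). All other instances of the clauses are old.\<close>
  have one: "(a, b') \<in> edges G \<Longrightarrow> rb b' a < P m' b' \<Longrightarrow> rb b' a < P m b' \<or> (a, b') = (c, b)" for a b'
    using p lt rb_inj[OF _ e, of a] rb_less[of a b'] by (auto simp: f less_Suc_eq split: if_splits)
  have two: "(a, b') \<in> edges G \<Longrightarrow> db b' + rb b' a < P m' b' \<Longrightarrow>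
      db b' + rb b' a < P m b' \<or> ((a, b') = (c, b) \<and> P m b = db b + rb b c)" for a b'
    using p lt rb_inj[OF _ e, of a] rb_less[of a b'] by (auto simp: f less_Suc_eq split: if_splits)
  show ?thesis
    unfolding m'_def[symmetric]
  proof (rule invI)
    show "P m' b' \<le> db b' + kb S b'" if "b' \<in> jobs G" for b' using invD(1)[OF I that] p lt by (auto simp: f)
    show "pv a b' \<le> v m' a" if "(a, b') \<in> edges G" "rb b' a < P m' b'" for a b'
      using invD(2)[OF I that(1)] one[OF that] low by (auto simp: f(2))
    show "2 + pv a b' \<le> v m' a" if "(a, b') \<in> edges G" "db b' + rb b' a < P m' b'" for a b'
      using invD(3)[OF I that(1)] two[OF that] high by (auto simp: f(2))
    show "a \<in> set (zst m') \<or> a = zc m' \<and> zi m' \<le> ra a b' \<and> ra a b' < ze m'"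
      if h: "(a, b') \<in> edges G" "v m' a = 4" "flag m' b' = 0" "trig m' a b'" for a b'
    proof -
      have "trig m a b'"
      proof (rule ccontr)
        assume n: "\<not> trig m a b'"
        then consider "db b' + rb b' a < P m' b'" "\<not> db b' + rb b' a < P m b'"
          | "rb b' a < P m' b'" "\<not> rb b' a < P m b'" "ra a b' < sr a" "ka S a \<noteq> 0"
          using h(4) by (auto simp: trig_def)
        then show False
        proof cases
          case 1
          then have "(a, b') = (c, b)" "P m b = db b + rb b c" using two[OF h(1)] by auto
          then show False using fl h(2,3) by (auto simp: f)
        next
          case 2
          then have "(a, b') = (c, b)" using one[OF h(1)] by auto
          then show False using fl h(2,3) 2 by (auto simp: f)
        qed
      qed
      then show ?thesis using invD(4)[OF I h(1)] h by (auto simp: f)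
    qed
    show "sits m' b' (sat m' b' - 1)" if b': "b' \<in> jobs G" "sat m' b' \<noteq> 0" for b'
    proof -
      have "b' \<noteq> b" using b' a0 f by auto
      then show ?thesis using invD(5)[OF I b'(1)] b' by (auto simp: f sits_def split: if_splits)
    qed
    show "hold m' a - 1 \<in> jobs G \<and> sat m' (hold m' a - 1) = Suc a" if "a \<in> agents G" "hold m' a \<noteq> 0" for a
      using invD(6)[OF I that(1)] that by (simp add: f)
  next
    show "b' \<in> set (jst m') \<or> flag m' b' \<noteq> 0 \<and> kb S b' = db b' \<and> P m' b' = 2 * db b'" if "b' \<in> jobs G" "b' \<notin> X" "sat m' b' = 0" for b'
      using invD(7)[OF I that(1,2)] that j by (auto simp: f split: if_splits)
    show "v m' a = 4 \<or> a \<in> set (cst m')" if "a \<in> agents G" "hold m' a = 0" for a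
      using invD(8)[OF I that(1)] that by (auto simp: f)
    show "sr a = da a" if "a \<in> agents G" "v m' a = 4" "ka S a = da a" for a
      using invD(9)[OF I that(1)] that by (auto simp: f)
    show "v m' a \<le> 4" if "a \<in> agents G" for a using invD(10)[OF I that] by (auto simp: f)
    show "set (jst m') \<subseteq> jobs G" using invD(11)[OF I] by (auto simp: f)
    show "set (zst m') \<subseteq> agents G" using invD(12)[OF I] by (auto simp: f)
    show "set (cst m') \<subseteq> agents G" using invD(13)[OF I] by (auto simp: f)
    show "v m' a = 4" if "a \<in> set (zst m')" for a using invD(15)[OF I, of a] that by (auto simp: f)
    show "zc m' \<in> agents G \<and> v m' (zc m') = 4 \<and> ze m' = da (zc m')" if "zi m' < ze m'"
      using invD(14)[OF I] that by (auto simp: f)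
    show "sound m'" using invD(16)[OF I] s unfolding sound_def by (auto simp: f Suc_le_eq)
  qed
qed

lemma solution: "fp_witness M x y \<Longrightarrow> fp_solution G S M x y"
  by unfold_locales (auto intro: S stable opt)

lemma lift_to_simps [simp]:
  "P (lift_to c w m) = P m" "flag (lift_to c w m) = flag m"
  "v (lift_to c w m) = (v m)(c := max (v m c) w)" "sat m b = 0 \<Longrightarrow> sat (lift_to c w m) b = 0"
  "zc (lift_to c w m) = zc m" "zi (lift_to c w m) = zi m" "ze (lift_to c w m) = ze m"
  "set (jst m) \<subseteq> set (jst (lift_to c w m))"
  by (auto simp: lift_to_def release_def fun_eq_iff max_def)

lemma set_flag_simps [simp]:
  "P (set_flag b m) = P m" "flag (set_flag b m) = (flag m)(b := 1)" "v (set_flag b m) = v m"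
  "sat (set_flag b m) = sat m" "hold (set_flag b m) = hold m" "jst (set_flag b m) = jst m"
  "cst (set_flag b m) = cst m" "zst (set_flag b m) = zst m"
  "zc (set_flag b m) = zc m" "zi (set_flag b m) = zi m" "ze (set_flag b m) = ze m"
  by (simp_all add: set_flag_def)

lemma pop_job_simps [simp]:
  "P (pop_job m) = P m" "flag (pop_job m) = flag m" "v (pop_job m) = v m"
  "sat (pop_job m) = sat m" "hold (pop_job m) = hold m" "jst (pop_job m) = tl (jst m)"
  "cst (pop_job m) = cst m" "zst (pop_job m) = zst m"
  "zc (pop_job m) = zc m" "zi (pop_job m) = zi m" "ze (pop_job m) = ze m"
  by (simp_all add: pop_job_def)

lemma pop_job_inv: 
  assumes I: "inv {} m" and ne: "jst m \<noteq> []"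
  shows "inv {hd (jst m)} (pop_job m)"
    "sat m (hd (jst m)) \<noteq> 0 \<Longrightarrow> inv {} (pop_job m)"
    "flag m (hd (jst m)) \<noteq> 0 \<and> kb S (hd (jst m)) = db (hd (jst m)) \<and> P m (hd (jst m)) = 2 * db (hd (jst m))
       \<Longrightarrow> inv {} (pop_job m)"
proof -
  obtain b js where j: "jst m = b # js" using ne by (cases "jst m") auto
  have eq: "sits (pop_job m) = sits m" "trig (pop_job m) = trig m" "sound (pop_job m) = sound m"
    by (rule frame; simp)+
  show "inv {hd (jst m)} (pop_job m)"
    using I unfolding inv_def eq pop_job_simps j
    by (elim conjE, intro conjI) (assumption | force)+
  show "inv {} (pop_job m)" if "sat m (hd (jst m)) \<noteq> 0"
    using I that unfolding inv_def eq pop_job_simps j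
    by (elim conjE, intro conjI) (assumption | force)+
  show "inv {} (pop_job m)" if "flag m (hd (jst m)) \<noteq> 0 \<and> kb S (hd (jst m)) = db (hd (jst m)) \<and>
      P m (hd (jst m)) = 2 * db (hd (jst m))"
    using I that unfolding inv_def eq pop_job_simps j
    by (elim conjE, intro conjI) (assumption | force)+
qed

lemma scan_step_inv:
  assumes I: "inv {} m" and z: "zi m < ze m"
  shows "inv {} (scan_step m)"
proof -
  define c b where "c = zc m" and "b = agent_ranking G (zc m) ! zi m"
  have c: "c \<in> agents G" "v m c = 4" "ze m = da c" using invD(14)[OF I z] by (auto simp: c_def)
  have e: "(c, b) \<in> edges G" "ra c b = zi m" using agent_nth[OF c(1)] z c(3) by (auto simp: b_def c_def)
  have b: "b \<in> jobs G" using edge_vertices[OF e(1)] by simp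
  \<comment> \<open>Moving the scan on gives up the promise for a single edge, which is harmless if
    its job is flagged by then or the edge has no trigger.\<close>
  have *: "inv {} (m'\<lparr>zi := Suc (zi m')\<rparr>)"
    if I': "inv {} m'" and m': "zc m' = c" "zi m' = zi m" "ze m' = ze m" "flag m' b \<noteq> 0 \<or> \<not> trig m' c b" for m'
  proof -
    define m2 where "m2 = m'\<lparr>zi := Suc (zi m')\<rparr>"
    have f: "P m2 = P m'" "v m2 = v m'" "flag m2 = flag m'" "hold m2 = hold m'"
      "sat m2 = sat m'" "jst m2 = jst m'" "cst m2 = cst m'" "zst m2 = zst m'"
      "zc m2 = zc m'" "zi m2 = Suc (zi m')" "ze m2 = ze m'"
      by (simp_all add: m2_def)
    have "a \<in> set (zst m2) \<or> a = zc m2 \<and> zi m2 \<le> ra a b' \<and> ra a b' < ze m2"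
      if h: "(a, b') \<in> edges G" "v m2 a = 4" "flag m2 b' = 0" "trig m2 a b'" for a b'
    proof -
      have t: "trig m' a b'" using h(4) trig_cong[of m2 m'] f by simp
      then have "(a, b') \<noteq> (c, b)" using m'(4) h(3) f by auto
      then have "a = c \<Longrightarrow> ra a b' \<noteq> zi m" using e h(1) ra_inj[of c b b'] by auto
      then show ?thesis using invD(4)[OF I' h(1)] h t m' f by auto
    qed
    then have z: "\<forall>(c, b)\<in>edges G. v m2 c = 4 \<and> flag m2 b = 0 \<and> trig m2 c b \<longrightarrow>
        c \<in> set (zst m2) \<or> c = zc m2 \<and> zi m2 \<le> ra c b \<and> ra c b < ze m2" by blast
    have eq: "sits m2 = sits m'" "sound m2 = sound m'"
      by (rule frame; simp add: f)+
    have "zi m2 < ze m2 \<longrightarrow> zc m2 \<in> agents G \<and> v m2 (zc m2) = 4 \<and> ze m2 = da (zc m2)"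
      using invD(14)[OF I'] by (simp add: f)
    then show ?thesis
      using I' z unfolding m2_def[symmetric] inv_def eq f
      by (elim conjE, intro conjI) (assumption | force)+
  qed
  show ?thesis
  proof (cases "flag m b = 0 \<and> trig m c b")
    case False
    then show ?thesis using *[OF I] by (auto simp: scan_step_def c_def b_def Let_def)
  next
    case True
    have s: "y b = 0" if f: "fp_witness M x y" for M x y
    proof -
      interpret fp_solution G S M x y using solution[OF f] .
      have "x c = 0" using soundD(3)[OF invD(16)[OF I] f c(1)] c(2) astate_le[of c] astate_zero[of c] by simp
      moreover have "P m b \<le> jstate M y b" using soundD(1)[OF invD(16)[OF I] f b] .
      moreover have "ra c b = ka S c \<Longrightarrow> (c, b) \<in> S" using ka_eq_ra[OF S e(1)] by simp
      ultimately show ?thesis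
        using True zero_passed[OF e(1)] zero_passed_twice[OF e(1)] zero_partner[of c b]
        unfolding trig_def by fastforce
    qed
    have I': "inv {} (flag_release b m)"
    proof (rule flag_release_inv[OF I b])
      show "flag m b = 0" using True by simp
      show "y b = 0" if "fp_witness M x y" for M x y using s[OF that] .
    qed
    have "zc (flag_release b m) = c" "zi (flag_release b m) = zi m" "ze (flag_release b m) = ze m"
      "flag (flag_release b m) b \<noteq> 0"
      by (auto simp: flag_release_def release_def set_flag_def c_def)
    then have "inv {} ((flag_release b m)\<lparr>zi := Suc (zi (flag_release b m))\<rparr>)" using *[OF I'] by blast
    moreover have "scan_step m = (flag_release b m)\<lparr>zi := Suc (zi (flag_release b m))\<rparr>"
      using True by (simp add: scan_step_def c_def b_def Let_def flag_release_def release_def set_flag_def)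
    ultimately show ?thesis by simp
  qed
qed

lemma scan_next_inv:
  assumes I: "inv {} m" and z: "\<not> zi m < ze m" "zst m \<noteq> []"
  shows "inv {} (scan_next m)"
proof -
  obtain c zs where zs: "zst m = c # zs" using z by (cases "zst m") auto
  have c: "c \<in> agents G" "v m c = 4" using invD(12,15)[OF I] zs by auto
  define m2 where "m2 = scan_next m"
  have f: "P m2 = P m" "v m2 = v m" "flag m2 = flag m" "hold m2 = hold m"
      "sat m2 = sat m" "jst m2 = jst m" "cst m2 = cst m" "zst m2 = zs"
      "zc m2 = c" "zi m2 = 0" "ze m2 = da c"
    by (simp_all add: m2_def scan_next_def zs)
  have t: "trig m2 = trig m" using trig_cong[of m2 m] f by (simp add: fun_eq_iff)
  have eq: "sits m2 = sits m" "sound m2 = sound m" by (rule frame; simp add: f)+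
  have "a \<in> set (zst m2) \<or> a = zc m2 \<and> zi m2 \<le> ra a b' \<and> ra a b' < ze m2"
    if h: "(a, b') \<in> edges G" "v m2 a = 4" "flag m2 b' = 0" "trig m2 a b'" for a b'
    using invD(4)[OF I h(1)] h z ra_less[OF h(1)] by (auto simp: f t zs)
  then have "\<forall>(c, b)\<in>edges G. v m2 c = 4 \<and> flag m2 b = 0 \<and> trig m2 c b \<longrightarrow>
      c \<in> set (zst m2) \<or> c = zc m2 \<and> zi m2 \<le> ra c b \<and> ra c b < ze m2" by blast
  then show ?thesis
    using I c unfolding m2_def[symmetric] inv_def eq f zs
    by (elim conjE, intro conjI) (assumption | force)+
qed

lemma job_facts:
  assumes I: "inv {} m" and b: "b \<in> jobs G" and p: "P m b \<noteq> 2 * db b"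
    and two: "two = (db b \<le> P m b)" and j: "j = (if two then P m b - db b else P m b)"
    and c: "c = job_ranking G b ! j"
  shows "(c, b) \<in> edges G" "rb b c = j" "P m b = (if two then db b + rb b c else rb b c)"
    "two \<Longrightarrow> rb b c \<le> kb S b" "two \<Longrightarrow> (c, b) \<notin> S \<Longrightarrow> rb b c < kb S b"
proof -
  have l: "P m b \<le> db b + kb S b" "kb S b \<le> db b" using invD(1)[OF I b] kb_le[OF S] by auto
  have jl: "j < db b" using j p two l by (auto split: if_splits)
  then show e: "(c, b) \<in> edges G" "rb b c = j" using job_nth[OF b] c by auto
  then show p': "P m b = (if two then db b + rb b c else rb b c)" using j two by auto
  show le: "two \<Longrightarrow> rb b c \<le> kb S b" using p' l by simp
  show "two \<Longrightarrow> (c, b) \<notin> S \<Longrightarrow> rb b c < kb S b"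
    using le kb_eq_rb[OF S e(1)] by (auto simp: le_less)
qed

lemma hold_after_lift: "v m c < w \<Longrightarrow> hold (lift_to c w m) c = 0"
  by (simp add: lift_to_def release_def)

text \<open>A holder of the same rank class would be the job itself.\<close>

lemma same_value_unheld:
  assumes I: "inv X m" and e: "(c, b) \<in> edges G" and u: "usable c b" and a0: "sat m b = 0"
    and w: "v m c = base c b \<or> v m c = 2 + base c b"
  shows "hold m c = 0"
proof (rule ccontr)
  assume h: "hold m c \<noteq> 0"
  define b' where "b' = hold m c - 1"
  have cA: "c \<in> agents G" using edge_vertices[OF e] by simp
  have st: "sits m b' c" using holder[OF I cA h] by (simp add: b'_def)
  have eq: "base c b' = base c b" using st w by (auto simp: sits_def base_def split: if_splits)
  have "(c, b') \<in> edges G" "usable c b'" using st by (auto simp: sits_def)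
  then have "ra c b' = ra c b"
    using u eq sr_pos[OF e] by (auto simp: usable_def base_def split: if_splits)
  then have "b' = b" using ra_inj[OF e \<open>(c, b') \<in> edges G\<close>] by simp
  then show False using invD(6)[OF I cA h] a0 by (simp add: b'_def)
qed

lemma job_step_inv:
  assumes I: "inv {} m" and ne: "jst m \<noteq> []"
  shows "case job_step m of None \<Rightarrow> \<not> (\<exists>M x y. fp_witness M x y) | Some m' \<Rightarrow> inv {} m'"
proof -
  define b where "b = hd (jst m)"
  have bj: "b \<in> set (jst m)" using ne by (simp add: b_def)
  then have b: "b \<in> jobs G" using invD(11)[OF I] by auto
  define two where "two = (db b \<le> P m b)"
  define j where "j = (if two then P m b - db b else P m b)"
  define c where "c = job_ranking G b ! j"
  define w where "w = (if two then 2 else 0) + base c b"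
  note sound = invD(16)[OF I]
  show ?thesis
  proof (cases "sat m b \<noteq> 0 \<or> P m b = 2 * db b")
    case True
    show ?thesis
    proof (cases "sat m b = 0")
      case False
      then show ?thesis using pop_job_inv(2)[OF I ne] by (simp add: job_step_def b_def)
    next
      case a0: True
      then have p: "P m b = 2 * db b" using True by simp
      \<comment> \<open>Positions never exceed \<open>db b + kb S b\<close>, so only a job that
        \<open>S\<close> leaves unmatched reaches the end of its chain.\<close>
      then have k: "kb S b = db b" using invD(1)[OF I b] kb_le[OF S, of b] by simp
      have "y b = 0" if f: "fp_witness M x y" for M x y
      proof -
        interpret fp_solution G S M x y using solution[OF f] .
        show ?thesis using soundD(1)[OF sound f b] p jstate_end by simp
      qed
      then have "inv {} (set_flag b m)" using set_flag_inv[OF I b a0] by blast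
      then have "inv {} (pop_job (set_flag b m))"
        using pop_job_inv(3)[of "set_flag b m"] ne p k by (simp add: b_def)
      moreover have "pop_job (set_flag b m) = set_flag b (pop_job m)"
        by (simp add: pop_job_def set_flag_def)
      moreover have "job_step m = Some (set_flag b (pop_job m))"
        using a0 p by (simp add: job_step_def b_def)
      ultimately show ?thesis by simp
    qed
  next
    case False
    then have a0: "sat m b = 0" and p: "P m b \<noteq> 2 * db b" by auto
    note jf = job_facts[OF I b p two_def j_def c_def]
    note e = jf(1)
    have cA: "c \<in> agents G" using edge_vertices[OF e] by simp
    have step: "job_step m = (if flag m b = 0 \<and> usable c b \<and> v m c \<le> w
        then Some (seat b c (lift_to c w (pop_job m)))
       else if two \<and> (c, b) \<in> S then
         (if usable c b then Some (seat b c (lift_to c 4 (set_flag b (pop_job m)))) else None)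
       else Some (pass b c (w + (if usable c b then 1 else 0)) two m))"
      using a0 p by (simp add: job_step_def b_def two_def j_def c_def w_def Let_def)
    have base1: "base c b \<le> 1" by (simp add: base_def)
    have I1: "inv {b} (pop_job m)" using pop_job_inv(1)[OF I ne] by (simp add: b_def)
    show ?thesis
    proof (cases "flag m b = 0 \<and> usable c b \<and> v m c \<le> w")
      case True
      have "w \<le> astate M x c" if f: "fp_witness M x y" for M x y
      proof -
        interpret fp_solution G S M x y using solution[OF f] .
        show ?thesis using soundD(1)[OF sound f b] sit_first[OF e] sit_second[OF e] jf
          by (auto simp: w_def split: if_splits)
      qed
      then have I2: "inv {b} (lift_to c w (pop_job m))"
        using lift_to_inv[OF I1 cA] base1 by (auto simp: w_def)
      have h0: "hold (lift_to c w (pop_job m)) c = 0"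
      proof (cases "v m c < w")
        case True then show ?thesis using hold_after_lift by simp
      next
        case lt: False
        then have "hold m c = 0"
          using same_value_unheld[OF I e _ a0] True by (auto simp: w_def split: if_splits)
        then show ?thesis using lt by (simp add: lift_to_def)
      qed
      have "inv {} (seat b c (lift_to c w (pop_job m)))"
        using seat_inv[OF I2 b _ h0] a0 True e jf(3)
        by (auto simp: sits_def seat_def w_def max_def split: if_splits)
      then show ?thesis using True step by simp
    next
      case ns: False
      \<comment> \<open>The failure to take the seat becomes a statement about all solutions,
        because by \<open>sound\<close> flags and lower bounds hold in each of them.\<close>
      have zero: "\<not> usable c b \<or> w < astate M x c \<or> y b = 0" if f: "fp_witness M x y" for M x y
        using ns soundD(2)[OF sound f b] soundD(3)[OF sound f cA] by auto
      show ?thesis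
      proof (cases "two \<and> (c, b) \<in> S")
        case True
        have z: "usable c b" "y b = 0" "x c = 0" if f: "fp_witness M x y" for M x y
        proof -
          interpret fp_solution G S M x y using solution[OF f] .
          have p: "db b + rb b c \<le> jstate M y b" using soundD(1)[OF sound f b] jf(3) True by simp
          show u: "usable c b" using at_stable(1)[of c b] True p matched_usable by blast
          have "2 + base c b < astate M x c \<or> y b = 0" using zero[OF f] u True by (simp add: w_def)
          then show "y b = 0" "x c = 0" using zero_stable[of c b] True p by blast+
        qed
        show ?thesis
        proof (cases "usable c b")
          case False
          then show ?thesis using step ns True z by auto
        next
          case u: True
          have I2: "inv {b} (set_flag b (pop_job m))"
            using set_flag_inv[OF I1 b] a0 z by simp
          have I3: "inv {b} (lift_to c 4 (set_flag b (pop_job m)))"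
          proof (rule lift_to_inv[OF I2 cA])
            show "4 \<le> astate M x c" if "fp_witness M x y" for M x y
              using z(3)[OF that] by (simp add: astate_def)
            show "sr c = da c" if "ka S c = da c"
              using that ka_matched[OF S, of c b] ra_less[OF e] True by simp
          qed simp
          \<comment> \<open>An agent of value 4 is held only by its partner in \<open>S\<close>,
            since the seat of an unflagged job has value at most 3. Here that partner is
            \<open>b\<close>, which is not seated.\<close>
          have h0: "hold (lift_to c 4 (set_flag b (pop_job m))) c = 0"
          proof (cases "v m c < 4")
            case True then show ?thesis using hold_after_lift by simp
          next
            case lt: False
            have "hold m c = 0"
            proof (rule ccontr)
              assume h: "hold m c \<noteq> 0"
              have v4: "v m c = 4" using lt invD(10)[OF I cA] by simp
              have st: "sits m (hold m c - 1) c" using holder[OF I cA h] .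
              then have "(c, hold m c - 1) \<in> S" using v4 by (auto simp: sits_def base_def split: if_splits)
              then have "hold m c - 1 = b" using matchingD(2)[OF S] True by blast
              then show False using invD(6)[OF I cA h] a0 by simp
            qed
            then show ?thesis using lt by (simp add: lift_to_def)
          qed
          have "v m c \<le> 4" using invD(10)[OF I cA] .
          then have "inv {} (seat b c (lift_to c 4 (set_flag b (pop_job m))))"
            using seat_inv[OF I3 b _ h0] a0 True u e jf(3)
            by (auto simp: sits_def seat_def max_def)
          then show ?thesis using ns True step u by auto
        qed
      next
        case np: False
        define pw where "pw = w + (if usable c b then 1 else 0)"
        have pw: "pw = (if two then 2 else 0) + pv c b" by (simp add: pw_def w_def pv_def)
        have lts: "two \<Longrightarrow> rb b c < kb S b" using jf(5) np by blast
        have adv: "P m b < jstate M y b" "pw \<le> astate M x c" if f: "fp_witness M x y" for M x y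
        proof -
          interpret fp_solution G S M x y using solution[OF f] .
          have "P m b \<le> jstate M y b" using soundD(1)[OF sound f b] .
          then show l: "P m b < jstate M y b"
            using advance_first[OF e] advance_second[OF e] zero[OF f] jf(3)
            by (auto simp: w_def split: if_splits)
          show "pw \<le> astate M x c"
            using l astate_passed[OF e] astate_passed_twice[OF e] lts jf(3)
            by (auto simp: pw split: if_splits)
        qed
        \<comment> \<open>The value 4 could arise only if \<open>b\<close>, the first choice of
          \<open>c\<close>, left \<open>c\<close> behind for the second time. But then
          \<open>b\<close> would have passed its partner in \<open>S\<close>: by stability this
          partner is \<open>c\<close> itself or somebody whom \<open>b\<close> prefers to
          \<open>c\<close>.\<close>
        have pw3: "pw \<le> 3"
        proof (cases "two \<and> ra c b = 0")
          case False
          then show ?thesis using sr_pos[OF e] by (auto simp: pw pv_def base_def usable_def)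
        next
          case True
          then have "ka S c = 0 \<or> kb S b < rb b c" using stable[OF e] by auto
          then show ?thesis using True lts ka_eq_ra[OF S e] np by auto
        qed
        define m1 where "m1 = lift_to c pw m"
        have I1: "inv {} m1" unfolding m1_def using lift_to_inv[OF I cA] adv pw3 by simp
        define cond where "cond = (v m1 c = 4 \<and> (two \<or> (ra c b < sr c \<and> ka S c \<noteq> 0)))"
        define m2 where "m2 = (if cond then set_flag b m1 else m1)"
        have v1: "v m1 c = max (v m c) pw" "P m1 = P m" "sat m1 b = 0" by (simp_all add: m1_def a0)
        have I2: "inv {} m2"
        proof (cases cond)
          case True
          have "y b = 0" if f: "fp_witness M x y" for M x y
          proof -
            interpret fp_solution G S M x y using solution[OF f] .
            have x: "x c = 0" using soundD(3)[OF invD(16)[OF I1] f cA] True astate_le[of c] astate_zero[of c]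
              by (simp add: cond_def)
            have l: "P m b < jstate M y b" using adv(1)[OF f] .
            show ?thesis
            proof (cases two)
              case True
              then show ?thesis using zero_passed_twice[OF e _ x] l jf(3) by simp
            next
              case False
              then show ?thesis using zero_passed[OF e _ x] l jf(3) \<open>cond\<close> by (simp add: cond_def)
            qed
          qed
          then show ?thesis using set_flag_inv[OF I1 b v1(3)] True by (simp add: m2_def)
        next
          case False then show ?thesis using I1 by (simp add: m2_def)
        qed
        have m2: "P m2 = P m" "v m2 c = max (v m c) pw" "sat m2 b = 0"
          using v1 by (auto simp: m2_def)
        have jm2: "b \<in> set (jst m2)" using subsetD[OF lift_to_simps(8) bj] by (auto simp: m2_def m1_def)
        have "inv {} (m2\<lparr>P := (P m2)(b := Suc (P m2 b))\<rparr>)"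
        proof (rule advance_inv[OF I2 e m2(3)])
          show "P m2 b = rb b c \<or> P m2 b = db b + rb b c \<and> rb b c < kb S b"
            using jf(3) lts by (auto simp: m2)
          show "pv c b \<le> v m2 c" by (simp add: m2 pw)
          show "2 + pv c b \<le> v m2 c" if "P m2 b = db b + rb b c"
            using that jf(3) rb_less[OF e] by (auto simp: m2 pw split: if_splits)
          show "flag m2 b \<noteq> 0" if "v m2 c = 4" "db b \<le> P m2 b \<or> ra c b < sr c \<and> ka S c \<noteq> 0"
            using that v1 m2 by (auto simp: m2_def cond_def two_def)
          show "P m2 b < jstate M y b" if "fp_witness M x y" for M x y using adv(1)[OF that] m2 by simp
        qed (rule jm2)
        moreover have "job_step m = Some (m2\<lparr>P := (P m2)(b := Suc (P m2 b))\<rparr>)"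
          using step ns np by (auto simp: pass_def m2_def cond_def m1_def pw_def Let_def)
        ultimately show ?thesis by simp
      qed
    qed
  qed
qed

text \<open>If no job is active, then mapping an agent to the agent that currently holds its partner
  in a solution \<open>M\<close> is an injection of the agents with nonzero dual value into themselves. So
  all of these agents are held.\<close>

lemma unheld_zero:
  assumes I: "inv {} m" and q: "\<not> zi m < ze m" "zst m = []" "jst m = []"
    and c: "c \<in> agents G" "hold m c = 0" and f: "fp_witness M x y"
  shows "x c = 0"
proof (rule ccontr)
  assume xc: "x c \<noteq> 0"
  interpret fp_solution G S M x y using solution[OF f] .
  note sound = invD(16)[OF I]
  define Y where "Y = {a \<in> agents G. x a \<noteq> 0}"
  define g where "g a = sat m (mate M a) - 1" for a
  have g: "\<exists>b. (a, b) \<in> M \<and> g a \<in> Y \<and> hold m (g a) = Suc b" if a: "a \<in> Y" for a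
  proof -
    have "ka M a < da a" using a x_unmatched[of a] by (simp add: Y_def)
    then obtain b where ab: "(a, b) \<in> M" using ka_less_iff[OF M] by blast
    have yb: "y b \<noteq> 0" using x_eq_y[OF ab] a by (simp add: Y_def)
    have b: "b \<in> jobs G" using matchingD(1)[OF M ab] edge_vertices by blast
    have fl: "flag m b = 0" using soundD(2)[OF sound f b] yb by auto
    then have at0: "sat m b \<noteq> 0" using invD(7)[OF I b] q by auto
    define c1 where "c1 = sat m b - 1"
    have st: "sits m b c1" using invD(5)[OF I b at0] by (simp add: c1_def)
    then have e1: "(c1, b) \<in> edges G" and u1: "usable c1 b" and h1: "hold m c1 = Suc b"
      and p1: "P m b = rb b c1 \<and> v m c1 = base c1 b \<or> P m b = db b + rb b c1 \<and> v m c1 = 2 + base c1 b"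
      using fl by (auto simp: sits_def)
    have c1A: "c1 \<in> agents G" using edge_vertices[OF e1] by simp
    have "x c1 \<noteq> 0"
    proof
      assume x1: "x c1 = 0"
      have nM: "(c1, b) \<notin> M" using x_eq_y[of c1 b] x1 yb by auto
      \<comment> \<open>In the solution \<open>b\<close> is not matched to \<open>c1\<close>, so its
        state there lies strictly beyond its position in the run.\<close>
      have l: "P m b < jstate M y b"
        using soundD(1)[OF sound f b] at_first[OF e1] at_second[OF e1] nM p1 by (auto simp: le_less)
      have n1: "P m b \<noteq> db b + rb b c1" using zero_passed_twice[OF e1 _ x1] l yb by auto
      then have p: "P m b = rb b c1" "v m c1 = base c1 b" using p1 by auto
      have k1: "ka M c1 = ka S c1" using zero_agent[OF c1A x1] .
      show False
      proof (cases "ra c1 b < sr c1")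
        case True
        then have "ra c1 b = 0" using u1 by (simp add: usable_def)
        then have "ka S c1 \<noteq> 0" using k1 ka_eq_ra[OF M e1] nM by auto
        then show False using zero_passed[OF e1 _ x1 True] l p yb by simp
      next
        case False
        then have r: "ra c1 b = sr c1" using u1 sr_pos[OF e1] by (auto simp: usable_def)
        then have v0: "v m c1 = 0" using p by (simp add: base_def)
        have ka0: "ka M c1 = 0" using ka_cases[OF c1A] ka_eq_ra[OF M e1] nM r by auto
        moreover have "0 < da c1" using ra_less[OF e1] by simp
        ultimately obtain b' where b': "(c1, b') \<in> M" using ka_less_iff[OF M, of c1] by auto
        then have e': "(c1, b') \<in> edges G" using matchingD(1)[OF M] by blast
        have r0: "ra c1 b' = 0" using ka_matched[OF M b'] ka0 by simp
        have y0: "y b' = 0" using x_eq_y[OF b'] x1 by simp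
        have bJ: "b' \<in> jobs G" using edge_vertices[OF e'] by simp
        \<comment> \<open>In \<open>M\<close> the agent \<open>c1\<close> has its first choice
          \<open>b'\<close>, but its value in the run is still 0, so \<open>b'\<close> has not gone
          past it. Hence \<open>b'\<close> is seated at some \<open>c2\<close> whom it prefers to
          \<open>c1\<close> and who ranks it first. Both would gain over \<open>M\<close>, which
          needs \<open>y b'\<close> = -1, whereas \<open>y b'\<close> = \<open>x c1\<close> =
          0.\<close>
        have np: "P m b' \<le> rb b' c1"
        proof (rule ccontr)
          assume "\<not> ?thesis"
          then have "pv c1 b' \<le> v m c1" using invD(2)[OF I e'] by simp
          then show False using v0 r0 by (simp add: pv_def usable_def)
        qed
        then have np2: "P m b' < db b'" using rb_less[OF e'] by simp
        have at': "sat m b' \<noteq> 0" using invD(7)[OF I bJ] q np2 by auto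
        define c2 where "c2 = sat m b' - 1"
        have st': "sits m b' c2" using invD(5)[OF I bJ at'] by (simp add: c2_def)
        then have e2: "(c2, b') \<in> edges G" and u2: "usable c2 b'"
          and p2: "P m b' = rb b' c2" "v m c2 = base c2 b'"
          using np2 by (auto simp: sits_def split: if_splits)
        have "c2 \<noteq> c1" using p2 v0 r0 sr_pos[OF e'] by (auto simp: base_def)
        then have less: "rb b' c2 < rb b' c1" using np p2 rb_inj[OF e2 e'] by (simp add: le_less)
        have "b' \<in> fjobs" using e' r0 by (auto simp: fjobs_def)
        then have "ra c2 b' = 0" using u2 eq_sr[OF e2] by (auto simp: usable_def)
        moreover have "(c2, b') \<notin> M" using matchingD(3)[OF M b'] \<open>c2 \<noteq> c1\<close> by blast
        ultimately have "ra c2 b' < ka M c2" using ka_eq_ra[OF M e2] by auto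
        then show False using both_would_gain[OF e2] less kb_matched[OF M b'] y0 by simp
      qed
    qed
    then show ?thesis using ab h1 c1A mate_eq[OF M ab] by (auto simp: Y_def g_def c1_def)
  qed
  have "inj_on g Y"
  proof (rule inj_onI)
    fix a a' assume "a \<in> Y" "a' \<in> Y" "g a = g a'"
    then obtain b where "(a, b) \<in> M" "(a', b) \<in> M" using g[of a] g[of a'] by auto
    then show "a = a'" using matchingD(3)[OF M] by blast
  qed
  moreover have "g ` Y \<subseteq> Y" using g by auto
  moreover have "finite Y" by (simp add: Y_def)
  ultimately have "g ` Y = Y" by (simp add: endo_inj_surj)
  moreover have "c \<in> Y" using c xc by (simp add: Y_def)
  ultimately obtain a where "a \<in> Y" "c = g a" by auto
  then show False using g[of a] c by auto
qed

lemma cand_step_inv: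
  assumes I: "inv {} m" and q: "\<not> zi m < ze m" "zst m = []" "jst m = []" and ne: "cst m \<noteq> []"
  shows "case cand_step m of None \<Rightarrow> \<not> (\<exists>M x y. fp_witness M x y) | Some m' \<Rightarrow> inv {} m'"
proof -
  obtain c cs where cs: "cst m = c # cs" using ne by (cases "cst m") auto
  have c: "c \<in> agents G" using invD(13)[OF I] cs by auto
  show ?thesis
  proof (cases "hold m c = 0 \<and> v m c < 4")
    case False
    then have h: "hold m c \<noteq> 0 \<or> v m c = 4" using invD(10)[OF I c] by auto
    define m2 where "m2 = m\<lparr>cst := cs\<rparr>"
    have f: "P m2 = P m" "v m2 = v m" "flag m2 = flag m" "hold m2 = hold m"
      "sat m2 = sat m" "jst m2 = jst m" "cst m2 = cs" "zst m2 = zst m"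
      "zc m2 = zc m" "zi m2 = zi m" "ze m2 = ze m"
      by (simp_all add: m2_def)
    have eq: "sits m2 = sits m" "trig m2 = trig m" "sound m2 = sound m" by (rule frame; simp add: f)+
    have "inv {} m2"
      using I h unfolding inv_def eq f cs by (elim conjE, intro conjI) (assumption | force)+
    then show ?thesis using False by (auto simp: cand_step_def cs m2_def Let_def)
  next
    case True
    have x0: "x c = 0" if "fp_witness M x y" for M x y
      using unheld_zero[OF I q c] True that by blast
    show ?thesis
    proof (cases "ka S c = da c \<and> sr c < da c")
      case fail: True
      have False if f: "fp_witness M x y" for M x y
      proof -
        interpret fp_solution G S M x y using solution[OF f] .
        show False using zero_agent[OF c x0[OF f]] ka_cases[OF c] fail by auto
      qed
      then show ?thesis using True fail by (auto simp: cand_step_def cs)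
    next
      case ok: False
      define m2 where "m2 = m\<lparr>cst := cs, v := (v m)(c := 4), zst := c # zst m\<rparr>"
      have z: "ka S c = da c \<Longrightarrow> sr c = da c" using ok sr_le[of c] by auto
      have s4: "4 \<le> astate M x c" if "fp_witness M x y" for M x y
        using x0[OF that] by (simp add: astate_def)
      have l: "lift_to c 4 m = m\<lparr>v := (v m)(c := 4), zst := c # zst m\<rparr>"
        using True by (simp add: lift_to_def release_def)
      have I2: "inv {} (lift_to c 4 m)" using lift_to_inv[OF I c _ s4 z] by simp
      have m2: "m2 = (lift_to c 4 m)\<lparr>cst := cs\<rparr>" by (simp add: l m2_def)
      define m1 where "m1 = lift_to c 4 m"
      have f: "P m2 = P m1" "v m2 = v m1" "flag m2 = flag m1" "hold m2 = hold m1"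
        "sat m2 = sat m1" "jst m2 = jst m1" "cst m2 = cs" "zst m2 = zst m1"
        "zc m2 = zc m1" "zi m2 = zi m1" "ze m2 = ze m1" "cst m1 = c # cs" "v m1 c = 4"
        by (simp_all add: m2 m1_def l cs)
      have eq: "sits m2 = sits m1" "trig m2 = trig m1" "sound m2 = sound m1" by (rule frame; simp add: f)+
      have "inv {} m2"
        using I2 f(12,13) unfolding m1_def[symmetric] inv_def eq f(1-11)
        by (elim conjE, intro conjI) (assumption | force)+
      then show ?thesis using True ok by (auto simp: cand_step_def cs m2_def)
    qed
  qed
qed

theorem step_inv:
  assumes "inv {} m" "\<not> finished m"
  shows "case step m of None \<Rightarrow> \<not> (\<exists>M x y. fp_witness M x y) | Some m' \<Rightarrow> inv {} m'"
  using assms scan_step_inv[of m] scan_next_inv[of m] job_step_inv[of m] cand_step_inv[of m]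
  by (auto simp: step_def finished_def)

section \<open>Reading off the extreme solution\<close>

definition result :: "mach \<Rightarrow> (nat \<times> nat) set" where
  "result m = {(a, b). a \<in> agents G \<and> hold m a = Suc b}"

definition xres :: "mach \<Rightarrow> nat \<Rightarrow> int" where
  "xres m a = (if a \<in> agents G then if v m a = 4 then 0 else if 2 \<le> v m a then 1 else -1 else 0)"

definition yres :: "mach \<Rightarrow> nat \<Rightarrow> int" where
  "yres m b = (if b \<in> jobs G \<and> sat m b \<noteq> 0 then xres m (sat m b - 1) else 0)"

context
  fixes m
  assumes I: "inv {} m" and fin: "finished m"
begin

lemma result_iff: "(a, b) \<in> result m \<longleftrightarrow> a \<in> agents G \<and> b \<in> jobs G \<and> sat m b = Suc a"
proof
  assume "(a, b) \<in> result m"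
  then show "a \<in> agents G \<and> b \<in> jobs G \<and> sat m b = Suc a"
    using invD(6)[OF I, of a] by (auto simp: result_def)
next
  assume *: "a \<in> agents G \<and> b \<in> jobs G \<and> sat m b = Suc a"
  then show "(a, b) \<in> result m" using invD(5)[OF I, of b] by (auto simp: result_def sits_def)
qed

lemma result_sits: "(a, b) \<in> result m \<Longrightarrow> sits m b a"
  using result_iff invD(5)[OF I, of b] by auto

lemma result_matching: "matching G (result m)"
  unfolding matching_def
proof (intro conjI allI impI)
  show "result m \<subseteq> edges G" using result_sits by (auto simp: sits_def)
  show "b = b'" if "(a, b) \<in> result m" "(a, b') \<in> result m" for a b b'
    using that by (simp add: result_def)
  show "a = a'" if "(a, b) \<in> result m" "(a', b) \<in> result m" for a a' b
    using that by (simp add: result_iff)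
qed

text \<open>Such an agent has value 4 and has been scanned. A partner in \<open>S\<close> would have
  been flagged by the scan, and a flagged job that is matched in \<open>S\<close> ends up seated at
  its partner in \<open>S\<close>, that is, at \<open>a\<close>. So \<open>S\<close> leaves
  \<open>a\<close> unmatched, and the invariant excludes a second choice.\<close>

lemma unheld: "a \<in> agents G \<Longrightarrow> hold m a = 0 \<Longrightarrow> v m a = 4 \<and> ka S a = da a \<and> sr a = da a"
proof -
  assume a: "a \<in> agents G" and h: "hold m a = 0"
  have v: "v m a = 4" using invD(8)[OF I a h] fin by (simp add: finished_def)
  have "ka S a = da a"
  proof (rule ccontr)
    assume "ka S a \<noteq> da a"
    then have "ka S a < da a" using ka_le[OF S, of a] by simp
    then obtain b where b: "(a, b) \<in> S" using ka_less_iff[OF S] by blast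
    then have e: "(a, b) \<in> edges G" using matchingD(1)[OF S] by blast
    have bJ: "b \<in> jobs G" using edge_vertices[OF e] by simp
    have "trig m a b" using ka_matched[OF S b] by (simp add: trig_def)
    then have f: "flag m b \<noteq> 0" using invD(4)[OF I e v] fin by (cases "flag m b = 0") (auto simp: finished_def)
    have "kb S b < db b" using kb_less_iff[OF S] b by blast
    then have "sat m b \<noteq> 0" using invD(7)[OF I bJ] fin by (auto simp: finished_def)
    then have st: "sits m b (sat m b - 1)" using invD(5)[OF I bJ] by simp
    then have "(sat m b - 1, b) \<in> S" using f by (simp add: sits_def)
    then have "sat m b - 1 = a" using matchingD(3)[OF S b] by blast
    then show False using st h by (simp add: sits_def)
  qed
  then show ?thesis using v invD(9)[OF I a v] by simp
qed

lemma result_ka: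
  assumes a: "a \<in> agents G"
  shows "ka (result m) a = 0 \<or> ka (result m) a = sr a"
    "v m a = 4 \<Longrightarrow> ka (result m) a = ka S a"
    "v m a \<noteq> 4 \<Longrightarrow> ka (result m) a = 0 \<Longrightarrow> v m a = 1 \<or> v m a = 3"
    "v m a \<noteq> 4 \<Longrightarrow> ka (result m) a = sr a \<Longrightarrow> v m a = 0 \<or> v m a = 2"
proof -
  have "(ka (result m) a = 0 \<or> ka (result m) a = sr a) \<and> (v m a = 4 \<longrightarrow> ka (result m) a = ka S a) \<and>
    (v m a \<noteq> 4 \<longrightarrow> ka (result m) a = 0 \<longrightarrow> v m a = 1 \<or> v m a = 3) \<and>
    (v m a \<noteq> 4 \<longrightarrow> ka (result m) a = sr a \<longrightarrow> v m a = 0 \<or> v m a = 2)"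
  proof (cases "hold m a = 0")
    case True
    then have "ka (result m) a = da a" by (intro ka_unmatched) (simp add: result_def)
    then show ?thesis using unheld[OF a True] by simp
  next
    case False
    define b where "b = hold m a - 1"
    have r: "(a, b) \<in> result m" using False a by (simp add: result_def b_def)
    then have st: "sits m b a" using result_sits by blast
    then have e: "(a, b) \<in> edges G" by (simp add: sits_def)
    have k: "ka (result m) a = ra a b" using ka_matched[OF result_matching r] .
    have u: "ra a b = 0 \<or> ra a b = sr a" using st by (simp add: sits_def usable_def)
    have "v m a = 4 \<Longrightarrow> (a, b) \<in> S" using st by (auto simp: sits_def base_def split: if_splits)
    then show ?thesis using st k u ka_matched[OF S, of a b] sr_pos[OF e]
      by (auto simp: sits_def base_def split: if_splits)
  qed
  then show "ka (result m) a = 0 \<or> ka (result m) a = sr a"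
    "v m a = 4 \<Longrightarrow> ka (result m) a = ka S a"
    "v m a \<noteq> 4 \<Longrightarrow> ka (result m) a = 0 \<Longrightarrow> v m a = 1 \<or> v m a = 3"
    "v m a \<noteq> 4 \<Longrightarrow> ka (result m) a = sr a \<Longrightarrow> v m a = 0 \<or> v m a = 2" by blast+
qed

text \<open>The final positions are the states of the jobs, except that a job of dual value 0 stands
  at \<open>db b + kb S b\<close> where \<open>jstate\<close> counts
  \<open>2 * db b\<close>.\<close>

lemma result_kb:
  assumes b: "b \<in> jobs G"
  shows "(flag m b = 0 \<and> yres m b = -1 \<and> P m b = kb (result m) b) \<or>
    (flag m b = 0 \<and> yres m b = 1 \<and> P m b = db b + kb (result m) b) \<or>
    (yres m b = 0 \<and> P m b = db b + kb S b \<and> kb (result m) b = kb S b)"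
proof (cases "sat m b = 0")
  case True
  then have "(a, b) \<notin> result m" for a by (simp add: result_iff)
  then have "kb (result m) b = db b" by (rule kb_unmatched)
  then show ?thesis using invD(7)[OF I b _ True] fin True by (simp add: finished_def yres_def)
next
  case False
  define c where "c = sat m b - 1"
  have st: "sits m b c" using invD(5)[OF I b False] by (simp add: c_def)
  then have e: "(c, b) \<in> edges G" by (simp add: sits_def)
  then have r: "(c, b) \<in> result m" using b False edge_vertices[OF e] by (simp add: result_iff c_def)
  have "kb (result m) b = rb b c" using kb_matched[OF result_matching r] .
  moreover have "yres m b = xres m c" using b False by (simp add: yres_def c_def)
  ultimately show ?thesis using st edge_vertices[OF e] kb_matched[OF S, of c b]
    by (auto simp: sits_def xres_def base_def split: if_splits)
qed

text \<open>An agent that would gain from \<open>b\<close> has its second choice, so its value is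
  even; left behind once by \<open>b\<close> it has value 2 or 4, left behind twice it has value 4.
  For an unflagged job the triggers exclude 4, since all scans are over. For a job of dual value 0,
  an agent of value 4 with mutual gain would block \<open>S\<close>.\<close>

lemma result_edge:
  assumes e: "(a, b) \<in> edges G"
  shows "wt (result m) a b \<le> xres m a - yres m b"
proof (cases "(a, b) \<in> result m")
  case True
  then have "yres m b = xres m a" by (simp add: result_iff yres_def)
  then show ?thesis using ka_matched[OF result_matching True] kb_matched[OF result_matching True]
    by (simp add: wt_def)
next
  case False
  have v: "a \<in> agents G" "b \<in> jobs G" using edge_vertices[OF e] by auto
  let ?ka = "ka (result m) a" and ?kb = "kb (result m) b"
  have ne: "?ka \<noteq> ra a b" "?kb \<noteq> rb b a"
    using False ka_eq_ra[OF result_matching e] kb_eq_rb[OF result_matching e] by auto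
  have x: "xres m a = (if v m a = 4 then 0 else if 2 \<le> v m a then 1 else -1)"
    using v by (simp add: xres_def)
  have v4: "v m a \<le> 4" using invD(10)[OF I v(1)] .
  note ra = result_ka[OF v(1)]
  have sp: "0 < sr a" using sr_pos[OF e] .
  have up: "ra a b < sr a" "?ka = sr a" if "ra a b < ?ka" using that ra(1) by auto
  have wt: "wt (result m) a b = (if ra a b < ?ka then 1 else -1) + (if rb b a < ?kb then 1 else -1)"
    using ne by (simp add: wt_def sgn_if)
  have p1: "pv a b \<le> v m a" if "rb b a < P m b" using invD(2)[OF I e that] .
  have p2: "2 + pv a b \<le> v m a" if "db b + rb b a < P m b" using invD(3)[OF I e that] .
  have z: "flag m b \<noteq> 0" if "v m a = 4" "trig m a b"
    using invD(4)[OF I e that(1)] that(2) fin by (cases "flag m b = 0") (auto simp: finished_def)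
  have pvu: "1 \<le> pv a b" if "ra a b < ?ka" using up[OF that] by (simp add: pv_def base_def)
  have low: "v m a = 2 \<or> v m a = 4" if "ra a b < ?ka" "rb b a < P m b"
    using ra(4) up[OF that(1)] p1[OF that(2)] pvu[OF that(1)] by fastforce
  have low4: "flag m b \<noteq> 0" if "ra a b < ?ka" "rb b a < P m b" "v m a = 4"
  proof (rule z[OF that(3)])
    show "trig m a b" using that up[OF that(1)] ra(2) sp by (simp add: trig_def)
  qed
  have high: "v m a = 4" if "ra a b < ?ka" "db b + rb b a < P m b"
    using low[OF that(1)] p2[OF that(2)] pvu[OF that(1)] that(2) by fastforce
  have rl: "rb b a < db b" using rb_less[OF e] .
  from result_kb[OF v(2)] show ?thesis
  proof (elim disjE conjE)
    assume f: "flag m b = 0" and y: "yres m b = -1" and p: "P m b = ?kb"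
    show ?thesis
    proof (cases "ra a b < ?ka \<and> rb b a < ?kb")
      case True
      then have "v m a = 2" using low low4 f p by auto
      then show ?thesis using x y wt by auto
    next
      case False then show ?thesis using x y wt by auto
    qed
  next
    assume f: "flag m b = 0" and y: "yres m b = 1" and p: "P m b = db b + ?kb"
    show ?thesis
    proof (cases "rb b a < ?kb")
      case True
      then have t: "db b + rb b a < P m b" using p by simp
      have "v m a \<noteq> 4" using z t f by (auto simp: trig_def)
      moreover have "2 \<le> v m a" using p2[OF t] by simp
      moreover have "\<not> ra a b < ?ka" using high[OF _ t] \<open>v m a \<noteq> 4\<close> by blast
      ultimately show ?thesis using x y wt by auto
    next
      case nkb: False
      show ?thesis
      proof (cases "ra a b < ?ka")
        case True
        then have "v m a = 2" using low low4 f p rl by auto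
        then show ?thesis using x y wt nkb by auto
      next
        case False then show ?thesis using x y wt nkb by auto
      qed
    qed
  next
    assume y: "yres m b = 0" and p: "P m b = db b + kb S b" and k: "?kb = kb S b"
    show ?thesis
    proof (cases "rb b a < ?kb")
      case True
      then have t: "db b + rb b a < P m b" using p k by simp
      have "\<not> ra a b < ?ka"
      proof
        assume r: "ra a b < ?ka"
        then have "ra a b < ka S a" using high[OF r t] ra(2) by simp
        then show False using stable[OF e] True k by simp
      qed
      moreover have "2 \<le> v m a" using p2[OF t] by simp
      ultimately show ?thesis using x y wt by auto
    next
      case nkb: False
      show ?thesis
      proof (cases "ra a b < ?ka")
        case True
        then have "v m a = 2 \<or> v m a = 4" using low p rl by auto
        then show ?thesis using x y wt nkb by auto
      next
        case False then show ?thesis using x y wt nkb by auto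
      qed
    qed
  qed
qed

theorem result_fp: "fp_witness (result m) (xres m) (yres m)"
  unfolding fp_witness_def witness_def
proof (intro conjI)
  show "matching G (result m)" by (rule result_matching)
  show "\<forall>(a, b)\<in>result m. xres m a = yres m b \<and> xres m a \<in> {-1, 0, 1}"
  proof clarify
    fix a b assume "(a, b) \<in> result m"
    then show "xres m a = yres m b \<and> xres m a \<in> {-1, 0, 1}"
      unfolding result_iff by (simp add: yres_def) (simp add: xres_def)
  qed
  show "\<forall>a. (\<forall>b. (a, b) \<notin> result m) \<longrightarrow> xres m a = 0"
  proof (intro allI impI)
    fix a assume n: "\<forall>b. (a, b) \<notin> result m"
    show "xres m a = 0"
    proof (cases "a \<in> agents G")
      case True
      then have "hold m a = 0" using n by (cases "hold m a") (auto simp: result_def)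
      then show ?thesis using unheld[OF True] by (simp add: xres_def)
    qed (simp add: xres_def)
  qed
  show "\<forall>b. (\<forall>a. (a, b) \<notin> result m) \<longrightarrow> yres m b = 0"
  proof (intro allI impI)
    fix b assume n: "\<forall>a. (a, b) \<notin> result m"
    show "yres m b = 0"
    proof (rule ccontr)
      assume "yres m b \<noteq> 0"
      then have b: "b \<in> jobs G" "sat m b \<noteq> 0" by (auto simp: yres_def split: if_splits)
      then have "sits m b (sat m b - 1)" using invD(5)[OF I] by blast
      then have "sat m b - 1 \<in> agents G" using edge_vertices by (auto simp: sits_def)
      then show False using n b by (auto simp: result_iff)
    qed
  qed
  show "\<forall>(a, b)\<in>edges G. wt (result m) a b \<le> xres m a - yres m b" using result_edge by blast
  show "\<forall>a\<in>agents G. ka (result m) a = 0 \<or> ka (result m) a = sr a" using result_ka(1) by blast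
  show "\<forall>b\<in>fjobs. \<exists>a. (a, b) \<in> result m"
  proof
    fix b assume "b \<in> fjobs"
    then obtain c where c: "(c, b) \<in> edges G" "ra c b = 0" by (auto simp: fjobs_def)
    have b: "b \<in> jobs G" using edge_vertices[OF c(1)] by simp
    \<comment> \<open>By stability \<open>S\<close> matches every first choice: either
      \<open>c\<close> gets \<open>b\<close>, or \<open>b\<close> has somebody it prefers to
      \<open>c\<close>. So \<open>b\<close> cannot end up unseated.\<close>
    have "kb S b < db b"
    proof (cases "ka S c = 0")
      case True
      then have "(c, b) \<in> S" using ka_eq_ra[OF S c(1)] c by simp
      then show ?thesis using kb_less_iff[OF S] by blast
    next
      case False
      then show ?thesis using stable[OF c(1)] c rb_less[OF c(1)] by simp
    qed
    then have n: "sat m b \<noteq> 0" using invD(7)[OF I b] fin by (auto simp: finished_def)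
    then have "sits m b (sat m b - 1)" using invD(5)[OF I b] by blast
    then have "sat m b - 1 \<in> agents G" using edge_vertices by (auto simp: sits_def)
    then show "\<exists>a. (a, b) \<in> result m" using n b by (intro exI[of _ "sat m b - 1"]) (simp add: result_iff)
  qed
qed

theorem result_max: "max_fully_popular G (result m)"
  unfolding max_fully_popular_def
proof (intro conjI allI impI)
  show "fully_popular G (result m)" using result_fp fully_popular_iff by blast
  fix N assume "fully_popular G N"
  then obtain x y where f: "fp_witness N x y" using fully_popular_iff by blast
  interpret fp_solution G S N x y using solution[OF f] .
  have sub: "fst ` N \<subseteq> fst ` result m"
  proof
    fix a assume "a \<in> fst ` N"
    then obtain b where b: "(a, b) \<in> N" by force
    have a: "a \<in> agents G" using matchingD(1)[OF M b] edge_vertices by blast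
    \<comment> \<open>An unheld agent has lower bound 4, so it has dual value 0 in \<open>N\<close>
      too and is matched there as in \<open>S\<close>, that is, not at all.\<close>
    have "hold m a \<noteq> 0"
    proof
      assume h: "hold m a = 0"
      then have "x a = 0" using unheld[OF a] soundD(3)[OF invD(16)[OF I] f a] astate_le[of a] astate_zero[of a]
        by simp
      then have "ka N a = da a" using zero_agent[OF a] unheld[OF a h] by simp
      then show False using ka_less_iff[OF M, of a] b by auto
    qed
    then have "(a, hold m a - 1) \<in> result m" using a by (simp add: result_def)
    then show "a \<in> fst ` result m" by force
  qed
  have inj: "inj_on fst K" if "matching G K" for K :: "(nat \<times> nat) set"
    using that unfolding matching_def inj_on_def by auto
  have "finite (fst ` result m)"
    by (rule finite_subset[OF _ finite_agents]) (auto simp: result_def)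
  then have "card (fst ` N) \<le> card (fst ` result m)" using sub by (rule card_mono)
  then show "card N \<le> card (result m)" using inj[OF M] inj[OF result_matching] by (simp add: card_image)
qed

end

text \<open>Each agent is scanned at most once, at a cost proportional to its degree, and each release
  is paid for by a raised lower bound or by a new flag.\<close>

definition potential :: "mach \<Rightarrow> nat" where
  "potential m = (\<Sum>b\<in>jobs G. 2 * db b - P m b) + (\<Sum>a\<in>agents G. 2 * (4 - v m a)) +
     (\<Sum>a\<in>agents G. if v m a < 4 then da a + 2 else 0) + (\<Sum>b\<in>jobs G. if flag m b = 0 then 2 else 0) +
     length (jst m) + length (cst m) + (\<Sum>c\<leftarrow>zst m. da c + 1) + (ze m - zi m)"

lemma sum_upd:
  fixes f :: "nat \<Rightarrow> nat \<Rightarrow> nat"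
  assumes "finite A" "c \<in> A"
  shows "(\<Sum>a\<in>A. f a ((g(c := w)) a)) + f c (g c) = (\<Sum>a\<in>A. f a (g a)) + f c w"
proof -
  have "(\<Sum>a\<in>A - {c}. f a ((g(c := w)) a)) = (\<Sum>a\<in>A - {c}. f a (g a))"
    by (intro sum.cong) auto
  then show ?thesis using assms by (simp add: sum.remove[of A c])
qed

lemma potential_release: "potential (release c m) \<le> potential m + 2"
  by (simp add: potential_def release_def)

lemma potential_lift:
  assumes "c \<in> agents G" "w \<le> 4"
  shows "potential (lift_to c w m) \<le> potential m"
proof (cases "v m c < w")
  case False then show ?thesis by (simp add: lift_to_def)
next
  case True
  define m1 where "m1 = m\<lparr>v := (v m)(c := w), zst := (if w = 4 then c # zst m else zst m)\<rparr>"
  have "lift_to c w m = release c m1" using True by (simp add: lift_to_def m1_def)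
  then have "potential (lift_to c w m) \<le> potential m1 + 2" using potential_release by simp
  \<comment> \<open>The raised value lowers \<open>2 * (4 - v m a)\<close> by at least 2, the price
    of the two stack entries of a release. On reaching 4, the term \<open>da a + 2\<close> is freed
    and pays for the scan entry of weight \<open>da a + 1\<close>.\<close>
  also have "potential m1 + 2 \<le> potential m"
    using sum_upd[OF finite_agents assms(1), of "\<lambda>a k. 2 * (4 - k)" "v m" w]
      sum_upd[OF finite_agents assms(1), of "\<lambda>a k. if k < 4 then da a + 2 else 0" "v m" w] True assms(2)
    by (auto simp: potential_def m1_def split: if_splits)
  finally show ?thesis .
qed

lemma potential_set_flag: "b \<in> jobs G \<Longrightarrow> potential (set_flag b m) \<le> potential m"
  "b \<in> jobs G \<Longrightarrow> flag m b = 0 \<Longrightarrow> potential (set_flag b m) + 2 \<le> potential m"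
  using sum_upd[OF finite_jobs, of b "\<lambda>a k. if k = 0 then 2 else 0" "flag m" 1]
  by (auto simp: potential_def set_flag_def split: if_splits)

lemma potential_pop: "jst m \<noteq> [] \<Longrightarrow> potential (pop_job m) < potential m"
  by (simp add: potential_def pop_job_def)

lemma potential_seat: "potential (seat b c m) = potential m"
  by (simp add: potential_def seat_def)

lemma potential_advance:
  assumes "b \<in> jobs G" "P m b < 2 * db b"
  shows "potential (m\<lparr>P := (P m)(b := Suc (P m b))\<rparr>) < potential m"
  using sum_upd[OF finite_jobs assms(1), of "\<lambda>b k. 2 * db b - k" "P m" "Suc (P m b)"] assms(2)
  by (simp add: potential_def)

theorem step_potential:
  assumes I: "inv {} m" and nf: "\<not> finished m" and st: "step m = Some m'"
  shows "potential m' < potential m"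
proof -
  consider "zi m < ze m" "m' = scan_step m" | "\<not> zi m < ze m" "zst m \<noteq> []" "m' = scan_next m"
    | "jst m \<noteq> []" "job_step m = Some m'" | "cst m \<noteq> []" "cand_step m = Some m'"
    using nf st by (auto simp: step_def finished_def split: if_splits)
  then show ?thesis
  proof cases
    case 1
    define b where "b = agent_ranking G (zc m) ! zi m"
    define m1 where "m1 = m\<lparr>zi := Suc (zi m)\<rparr>"
    have c: "zc m \<in> agents G" "ze m = da (zc m)" using invD(14)[OF I 1(1)] by auto
    have b: "b \<in> jobs G" using agent_nth[OF c(1), of "zi m"] 1(1) c(2) edge_vertices by (auto simp: b_def)
    have m1: "potential m1 < potential m" using 1(1) by (simp add: potential_def m1_def)
    show ?thesis
    proof (cases "flag m b = 0 \<and> trig m (zc m) b")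
      case False
      then show ?thesis using 1 m1 by (auto simp: scan_step_def b_def m1_def Let_def)
    next
      case True
      have "potential (flag_release b m1) \<le> potential (set_flag b m1) + 2"
        using potential_release by (auto simp: flag_release_def)
      also have "\<dots> \<le> potential m1" using potential_set_flag(2)[OF b, of m1] True by (simp add: m1_def)
      finally show ?thesis using 1 m1 True by (simp add: scan_step_def b_def m1_def Let_def)
    qed
  next
    case 2
    then show ?thesis by (cases "zst m") (auto simp: potential_def scan_next_def)
  next
    case 3
    define b where "b = hd (jst m)"
    have b: "b \<in> jobs G" using invD(11)[OF I] 3(1) by (auto simp: b_def)
    note pop = potential_pop[OF 3(1)]
    define two where "two = (db b \<le> P m b)"
    define j where "j = (if two then P m b - db b else P m b)"
    define c where "c = job_ranking G b ! j"
    define w where "w = (if two then 2 else 0) + base c b"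
    show ?thesis
    proof (cases "sat m b \<noteq> 0 \<or> P m b = 2 * db b")
      case True
      then show ?thesis using 3(2) pop potential_set_flag(1)[OF b, of "pop_job m"]
        by (auto simp: job_step_def b_def[symmetric] split: if_splits)
    next
      case False
      then have p: "P m b \<noteq> 2 * db b" by simp
      note jf = job_facts[OF I b p two_def j_def c_def]
      have cA: "c \<in> agents G" using edge_vertices[OF jf(1)] by simp
      have base1: "base c b \<le> 1" by (simp add: base_def)
      have Pl: "P m b < 2 * db b" using invD(1)[OF I b] kb_le[OF S, of b] p by simp
      have "m' = seat b c (lift_to c w (pop_job m)) \<or> m' = seat b c (lift_to c 4 (set_flag b (pop_job m)))
          \<or> m' = pass b c (w + (if usable c b then 1 else 0)) two m"
        using 3(2) False by (auto simp: job_step_def b_def[symmetric] two_def j_def c_def w_def Let_def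
            split: if_splits)
      then show ?thesis
      proof (elim disjE)
        assume "m' = seat b c (lift_to c w (pop_job m))"
        moreover have "w \<le> 4" using base1 by (simp add: w_def)
        ultimately show ?thesis using potential_seat potential_lift[OF cA, of w "pop_job m"] pop by simp
      next
        assume "m' = seat b c (lift_to c 4 (set_flag b (pop_job m)))"
        then show ?thesis using potential_seat potential_lift[OF cA, of 4 "set_flag b (pop_job m)"] pop
            potential_set_flag(1)[OF b, of "pop_job m"] by simp
      next
        define pw where "pw = w + (if usable c b then 1 else 0)"
        assume "m' = pass b c (w + (if usable c b then 1 else 0)) two m"
        then have m': "m' = pass b c pw two m" by (simp add: pw_def)
        define m1 where "m1 = lift_to c pw m"
        have "potential m1 \<le> potential m"
          using potential_lift[OF cA, of pw m] base1 by (auto simp: pw_def w_def m1_def)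
        moreover define m2 where "m2 = (if v m1 c = 4 \<and> (two \<or> (ra c b < sr c \<and> ka S c \<noteq> 0))
          then set_flag b m1 else m1)"
        have "potential m2 \<le> potential m1" using potential_set_flag(1)[OF b] by (simp add: m2_def)
        moreover have "P m2 b = P m b" by (simp add: m2_def m1_def)
        moreover have "m' = m2\<lparr>P := (P m2)(b := Suc (P m2 b))\<rparr>"
          unfolding m' pass_def m2_def m1_def by (simp add: Let_def)
        ultimately show ?thesis using potential_advance[OF b, of m2] Pl by simp
      qed
    qed
  next
    case 4
    then obtain c cs where cs: "cst m = c # cs" by (cases "cst m") auto
    have c: "c \<in> agents G" using invD(13)[OF I] cs by auto
    show ?thesis
    proof (cases "hold m c = 0 \<and> v m c < 4")
      case False
      then have "m' = m\<lparr>cst := cs\<rparr>" using 4(2) by (auto simp: cand_step_def cs Let_def split: if_splits)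
      then show ?thesis by (simp add: potential_def cs)
    next
      case True
      then have m': "m' = m\<lparr>cst := cs, v := (v m)(c := 4), zst := c # zst m\<rparr>"
        using 4(2) by (auto simp: cand_step_def cs Let_def split: if_splits)
      show ?thesis
        using sum_upd[OF finite_agents c, of "\<lambda>a k. 2 * (4 - k)" "v m" 4]
          sum_upd[OF finite_agents c, of "\<lambda>a k. if k < 4 then da a + 2 else 0" "v m" 4] True
        by (simp add: m' potential_def cs)
    qed
  qed
qed

end

section \<open>The agent-optimal stable matching\<close>

record gs =
  cur :: "nat \<Rightarrow> nat"
  sb :: "nat \<Rightarrow> nat"
  gx :: nat
  gi :: nat

locale numbered_marriage = marriage G for G :: "(nat, nat) marriage" +
  assumes numbered: "numbered G"
begin

definition nA :: nat where "nA = card (agents G)"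
definition nB :: nat where "nB = card (jobs G)"

lemma agents_iff [simp]: "a \<in> agents G \<longleftrightarrow> a < nA" and jobs_iff [simp]: "b \<in> jobs G \<longleftrightarrow> b < nB"
  using numbered unfolding numbered_def nA_def nB_def by blast+

lemma agents_eq: "agents G = {..<nA}" and jobs_eq: "jobs G = {..<nB}"
  by auto

text \<open>\<open>gx\<close> is the agent about to propose and \<open>sb b\<close> the agent engaged to job \<open>b\<close>, both shifted
  by one, \<open>0\<close> meaning none; the agents from \<open>gi\<close> on have not yet proposed.\<close>

definition gs_step :: "gs \<Rightarrow> gs" where
  "gs_step g = (if gx g = 0 then g\<lparr>gx := Suc (gi g), gi := Suc (gi g)\<rparr> else
     let a = gx g - 1 in
     if cur g a = da a then g\<lparr>gx := 0\<rparr> else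
     let b = agent_ranking G a ! cur g a in
     if sb g b = 0 then g\<lparr>sb := (sb g)(b := gx g), gx := 0\<rparr>
     else let a' = sb g b - 1 in
       if rb b a < rb b a' then g\<lparr>sb := (sb g)(b := gx g), gx := sb g b,
           cur := (cur g)(a' := Suc (cur g a'))\<rparr>
       else g\<lparr>cur := (cur g)(a := Suc (cur g a))\<rparr>)"

definition gs_finished :: "gs \<Rightarrow> bool" where
  "gs_finished g \<longleftrightarrow> gx g = 0 \<and> \<not> gi g < nA"

text \<open>The last conjunct goes beyond the classical invariants: no agent of nonnegative dual
  value has been turned down by its partner in a popular matching. It becomes
  \<open>opt\<close>.\<close>

definition gs_inv :: "gs \<Rightarrow> bool" where
  "gs_inv g \<longleftrightarrow> gi g \<le> nA \<and> gx g \<le> gi g \<and>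
     (\<forall>a<nA. cur g a \<le> da a) \<and>
     (\<forall>b<nB. sb g b \<noteq> 0 \<longrightarrow> (sb g b - 1, b) \<in> edges G \<and> cur g (sb g b - 1) = ra (sb g b - 1) b \<and>
        sb g b \<le> gi g \<and> sb g b \<noteq> gx g) \<and>
     (\<forall>a<gi g. Suc a = gx g \<or> cur g a = da a \<or> sb g (agent_ranking G a ! cur g a) = Suc a) \<and>
     (\<forall>(a, b)\<in>edges G. ra a b < cur g a \<longrightarrow> sb g b \<noteq> 0 \<and> rb b (sb g b - 1) < rb b a) \<and>
     (\<forall>M x y. witness M x y \<longrightarrow> (\<forall>a<nA. 0 \<le> x a \<longrightarrow> cur g a \<le> ka M a))"

lemma gs_invD:
  assumes "gs_inv g"
  shows "gi g \<le> nA" "gx g \<le> gi g"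
    "a < nA \<Longrightarrow> cur g a \<le> da a"
    "b < nB \<Longrightarrow> sb g b \<noteq> 0 \<Longrightarrow> (sb g b - 1, b) \<in> edges G \<and> cur g (sb g b - 1) = ra (sb g b - 1) b \<and>
        sb g b \<le> gi g \<and> sb g b \<noteq> gx g"
    "a < gi g \<Longrightarrow> Suc a = gx g \<or> cur g a = da a \<or> sb g (agent_ranking G a ! cur g a) = Suc a"
    "(a, b) \<in> edges G \<Longrightarrow> ra a b < cur g a \<Longrightarrow> sb g b \<noteq> 0 \<and> rb b (sb g b - 1) < rb b a"
    "witness M x y \<Longrightarrow> a < nA \<Longrightarrow> 0 \<le> x a \<Longrightarrow> cur g a \<le> ka M a"
  using assms unfolding gs_inv_def by blast+

text \<open>The reason why Gale and Shapley's algorithm never separates an agent of nonnegative dual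
  value from its partner in a popular matching.\<close>

lemma rejection:
  assumes w: "witness M x y" and e: "(a, b) \<in> edges G" "(a', b) \<in> edges G" and r: "rb b a' < rb b a"
    and c': "0 \<le> x a' \<Longrightarrow> ra a' b \<le> ka M a'" and x: "0 \<le> x a"
  shows "ka M a \<noteq> ra a b"
proof
  assume k: "ka M a = ra a b"
  have M: "matching G M" using witnessD(1)[OF w] .
  have ab: "(a, b) \<in> M" using k ka_eq_ra[OF M e(1)] by simp
  have y: "y b = x a" using witnessD(6)[OF w ab] by simp
  have "a' \<noteq> a" using r by auto
  then have "(a', b) \<notin> M" using matchingD(3)[OF M ab] by blast
  then have ne: "ka M a' \<noteq> ra a' b" using ka_eq_ra[OF M e(2)] by simp
  have "wt M a' b \<le> x a' - x a" using witnessD(7)[OF w e(2)] y by simp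
  then have "sgn (int (ka M a') - int (ra a' b)) + 1 \<le> x a' - x a"
    using kb_matched[OF M ab] r by (simp add: wt_def sgn_int_simps)
  \<comment> \<open>If \<open>x a'\<close> is nonnegative, \<open>a'\<close> would gain as well and
    the left side is 2, which is too much; if \<open>x a'\<close> = -1, the right side is negative
    while the left side is not.\<close>
  then show False using c' ne x witnessD(2)[OF w, of a'] by (auto simp: sgn_if split: if_splits)
qed

lemma gs_step_inv:
  assumes I: "gs_inv g" and nf: "\<not> gs_finished g"
  shows "gs_inv (gs_step g)"
proof (cases "gx g = 0")
  case True
  have lt: "gi g < nA" using nf True by (simp add: gs_finished_def)
  have "gs_step g = g\<lparr>gx := Suc (gi g), gi := Suc (gi g)\<rparr>" using True by (simp add: gs_step_def)
  then show ?thesis using I lt True by (auto simp: gs_inv_def less_Suc_eq)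
next
  case False
  define a where "a = gx g - 1"
  have gxa: "gx g = Suc a" using False by (simp add: a_def)
  have alt: "a < gi g" "a < nA" using I gxa by (auto simp: gs_inv_def)
  have i1: "gi g \<le> nA" using gs_invD(1)[OF I] .
  have i3: "cur g a \<le> da a" if "a < nA" for a using gs_invD(3)[OF I that] .
  have i4: "(sb g b - 1, b) \<in> edges G \<and>
      cur g (sb g b - 1) = ra (sb g b - 1) b \<and> sb g b \<le> gi g \<and> sb g b \<noteq> Suc a"
    if "b < nB" "sb g b \<noteq> 0" for b using gs_invD(4)[OF I that] gxa by simp
  have i5: "a' = a \<or> cur g a' = da a' \<or> sb g (agent_ranking G a' ! cur g a') = Suc a'"
    if "a' < gi g" for a' using gs_invD(5)[OF I that] gxa by auto
  have i6: "sb g b \<noteq> 0 \<and> rb b (sb g b - 1) < rb b a" if "(a, b) \<in> edges G" "ra a b < cur g a" for a b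
    using gs_invD(6)[OF I that] .
  have i7: "cur g a \<le> ka M a" if "witness M x y" "a < nA" "0 \<le> x a" for M x y a
    using gs_invD(7)[OF I that] .
  show ?thesis
  proof (cases "cur g a = da a")
    case True
    then have "gs_step g = g\<lparr>gx := 0\<rparr>" using False by (simp add: gs_step_def a_def Let_def)
    then show ?thesis using I gxa True by (auto simp: gs_inv_def)
  next
    case nd: False
    then have lt: "cur g a < da a" using i3[OF alt(2)] by simp
    define b where "b = agent_ranking G a ! cur g a"
    have e: "(a, b) \<in> edges G" "ra a b = cur g a" using agent_nth[of a "cur g a"] alt lt by (auto simp: b_def)
    have bB: "b < nB" using edge_vertices[OF e(1)] by simp
    show ?thesis
    proof (cases "sb g b = 0")
      case True
      have st: "gs_step g = g\<lparr>sb := (sb g)(b := Suc a), gx := 0\<rparr>"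
        using False nd True gxa by (simp add: gs_step_def Let_def flip: b_def)
      have q: "b' \<noteq> b" if "(a', b') \<in> edges G" "ra a' b' < cur g a'" for a' b'
        using i6[OF that] True by auto
      have "sb g b' \<noteq> Suc a" if "b' < nB" for b' using i4[OF that] by auto
      define g' where "g' = gs_step g"
      have f: "sb g' = (sb g)(b := Suc a)" "gx g' = 0" "cur g' = cur g" "gi g' = gi g"
        by (simp_all add: g'_def st)
      show ?thesis
        unfolding gs_inv_def g'_def[symmetric]
      proof (intro conjI allI impI ballI)
        show "gi g' \<le> nA" "gx g' \<le> gi g'" using i1 by (simp_all add: f)
        show "cur g' a1 \<le> da a1" if "a1 < nA" for a1 using i3[OF that] by (simp add: f)
        show "(sb g' b' - 1, b') \<in> edges G" "cur g' (sb g' b' - 1) = ra (sb g' b' - 1) b'"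
          "sb g' b' \<le> gi g'" "sb g' b' \<noteq> gx g'" if "b' < nB" "sb g' b' \<noteq> 0" for b'
          using i4[of b'] that e alt by (auto simp: f split: if_splits)
        show "Suc a1 = gx g' \<or> cur g' a1 = da a1 \<or> sb g' (agent_ranking G a1 ! cur g' a1) = Suc a1"
          if "a1 < gi g'" for a1
          using i5[of a1] that True b_def by (auto simp: f)
        show "case p of (a1, b1) \<Rightarrow> ra a1 b1 < cur g' a1 \<longrightarrow> sb g' b1 \<noteq> 0 \<and> rb b1 (sb g' b1 - 1) < rb b1 a1"
          if p: "p \<in> edges G" for p using p i6 q by (auto simp: f)
        show "cur g' a1 \<le> ka M a1" if h: "witness M x y" "a1 < nA" "0 \<le> x a1" for M x y a1
          using i7[OF h] by (simp add: f)
      qed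
    next
      case sb: False
      define a' where "a' = sb g b - 1"
      have sba: "sb g b = Suc a'" using sb by (simp add: a'_def)
      have e': "(a', b) \<in> edges G" "cur g a' = ra a' b" "a' < gi g" "a' \<noteq> a"
        using i4[OF bB sb] by (auto simp: sba)
      have a'A: "a' < nA" using e'(3) i1 by simp
      have uniq: "sb g b' = Suc a' \<Longrightarrow> b' < nB \<Longrightarrow> b' = b" for b'
        using i4[of b'] e' ra_inj[OF e'(1), of b'] by auto
      have step: "ra a1 b1 < Suc (cur g a1) \<Longrightarrow> (a1, b1) \<in> edges G \<Longrightarrow> cur g a1 = ra a1 b2 \<Longrightarrow>
          (a1, b2) \<in> edges G \<Longrightarrow> ra a1 b1 < cur g a1 \<or> b1 = b2" for a1 b1 b2
        using ra_inj[of a1 b1 b2] by (auto simp: less_Suc_eq)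
      show ?thesis
      proof (cases "rb b a < rb b a'")
        case True
        define g' where "g' = gs_step g"
        have f: "sb g' = (sb g)(b := Suc a)" "gx g' = Suc a'" "cur g' = (cur g)(a' := Suc (cur g a'))"
          "gi g' = gi g"
          using False nd sb True gxa sba by (simp_all add: g'_def gs_step_def Let_def flip: b_def)
        show ?thesis
          unfolding gs_inv_def g'_def[symmetric]
        proof (intro conjI allI impI ballI)
          show "gi g' \<le> nA" "gx g' \<le> gi g'" using i1 e'(3) by (simp_all add: f)
          show "cur g' a1 \<le> da a1" if "a1 < nA" for a1
            using i3[OF that] e' ra_less[OF e'(1)] by (auto simp: f)
          show "(sb g' b' - 1, b') \<in> edges G" "cur g' (sb g' b' - 1) = ra (sb g' b' - 1) b'"
            "sb g' b' \<le> gi g'" "sb g' b' \<noteq> gx g'" if "b' < nB" "sb g' b' \<noteq> 0" for b'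
            using i4[of b'] that e e' alt uniq[of b'] by (auto simp: f split: if_splits)
          show "Suc a1 = gx g' \<or> cur g' a1 = da a1 \<or> sb g' (agent_ranking G a1 ! cur g' a1) = Suc a1"
            if "a1 < gi g'" for a1
            using i5[of a1] that sba b_def by (auto simp: f)
          show "case p of (a1, b1) \<Rightarrow> ra a1 b1 < cur g' a1 \<longrightarrow> sb g' b1 \<noteq> 0 \<and> rb b1 (sb g' b1 - 1) < rb b1 a1"
            if p: "p \<in> edges G" for p
          proof (cases p, simp only: prod.case, intro impI)
            fix a1 b1 assume p1: "p = (a1, b1)" and r: "ra a1 b1 < cur g' a1"
            then have "ra a1 b1 < cur g a1 \<or> (a1 = a' \<and> b1 = b)"
              using step[of a' b1 b] p e' by (auto simp: f split: if_splits)
            then show "sb g' b1 \<noteq> 0 \<and> rb b1 (sb g' b1 - 1) < rb b1 a1"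
              using i6[of a1 b1] p p1 True sba by (auto simp: f)
          qed
          show "cur g' a1 \<le> ka M a1" if h: "witness M x y" "a1 < nA" "0 \<le> x a1" for M x y a1
          proof (cases "a1 = a'")
            case t: True
            \<comment> \<open>Here the job drops \<open>a'\<close> in favour of the proposer
              \<open>a\<close>, so the two agents change roles in \<open>rejection\<close>. Its
              condition on \<open>a\<close> is the invariant, as \<open>a\<close> is just proposing
              to \<open>b\<close>.\<close>
            have "ka M a' \<noteq> ra a' b"
              using rejection[OF h(1) e'(1) e(1) True] i7[OF h(1) alt(2)] e(2) h(3) t by simp
            moreover have "cur g a' \<le> ka M a'" using i7[OF h(1) a'A] h(3) t by simp
            ultimately show ?thesis using t e'(2) by (simp add: f)
          next
            case False then show ?thesis using i7[OF h] by (simp add: f)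
          qed
        qed
      next
        case nr: False
        have r: "rb b a' < rb b a" using nr rb_inj[OF e(1) e'(1)] e'(4) by linarith
        define g' where "g' = gs_step g"
        have f: "sb g' = sb g" "gx g' = Suc a" "cur g' = (cur g)(a := Suc (cur g a))" "gi g' = gi g"
          using False nd sb nr gxa sba by (simp_all add: g'_def gs_step_def Let_def flip: b_def)
        show ?thesis
          unfolding gs_inv_def g'_def[symmetric]
        proof (intro conjI allI impI ballI)
          show "gi g' \<le> nA" "gx g' \<le> gi g'" using i1 alt by (simp_all add: f)
          show "cur g' a1 \<le> da a1" if "a1 < nA" for a1 using i3[OF that] lt by (auto simp: f)
          show "(sb g' b' - 1, b') \<in> edges G" "cur g' (sb g' b' - 1) = ra (sb g' b' - 1) b'"
            "sb g' b' \<le> gi g'" "sb g' b' \<noteq> gx g'" if "b' < nB" "sb g' b' \<noteq> 0" for b'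
            using i4[of b'] that by (auto simp: f)
          show "Suc a1 = gx g' \<or> cur g' a1 = da a1 \<or> sb g' (agent_ranking G a1 ! cur g' a1) = Suc a1"
            if "a1 < gi g'" for a1
            using i5[of a1] that by (auto simp: f)
          show "case p of (a1, b1) \<Rightarrow> ra a1 b1 < cur g' a1 \<longrightarrow> sb g' b1 \<noteq> 0 \<and> rb b1 (sb g' b1 - 1) < rb b1 a1"
            if p: "p \<in> edges G" for p
          proof (cases p, simp only: prod.case, intro impI)
            fix a1 b1 assume p1: "p = (a1, b1)" and r1: "ra a1 b1 < cur g' a1"
            have "ra a1 b1 < cur g a1 \<or> (a1 = a \<and> b1 = b)"
            proof (cases "a1 = a")
              case True
              then have "ra a b1 < Suc (cur g a)" using r1 by (simp add: f)
              then show ?thesis using step[OF _ _ e(2)[symmetric] e(1), of b1] p p1 True by blast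
            next
              case False then show ?thesis using r1 by (simp add: f)
            qed
            then show "sb g' b1 \<noteq> 0 \<and> rb b1 (sb g' b1 - 1) < rb b1 a1"
              using i6[of a1 b1] p p1 r sba by (auto simp: f)
          qed
          show "cur g' a1 \<le> ka M a1" if h: "witness M x y" "a1 < nA" "0 \<le> x a1" for M x y a1
          proof (cases "a1 = a")
            case t: True
            have "ka M a \<noteq> ra a b"
              using rejection[OF h(1) e(1) e'(1) r] i7[OF h(1) a'A] e'(2) h(3) t by simp
            moreover have "cur g a \<le> ka M a" using i7[OF h(1) alt(2)] h(3) t by simp
            ultimately show ?thesis using t e(2) by (simp add: f)
          next
            case False then show ?thesis using i7[OF h] by (simp add: f)
          qed
        qed
      qed
    qed
  qed
qed

text \<open>The factor 2 pays for admitting a new agent, which makes \<open>gx\<close> nonzero and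
  so adds 1 elsewhere.\<close>

definition gs_potential :: "gs \<Rightarrow> nat" where
  "gs_potential g = (\<Sum>a\<in>agents G. da a - cur g a) + 2 * (nA - gi g) + (if gx g = 0 then 0 else 1)"

lemma gs_step_potential:
  assumes I: "gs_inv g" and nf: "\<not> gs_finished g"
  shows "gs_potential (gs_step g) < gs_potential g"
proof (cases "gx g = 0")
  case True
  then have "gi g < nA" using nf by (simp add: gs_finished_def)
  then show ?thesis using True by (simp add: gs_step_def gs_potential_def)
next
  case False
  define a where "a = gx g - 1"
  have gxa: "gx g = Suc a" using False by (simp add: a_def)
  have a: "a < nA" "cur g a \<le> da a" using I gxa by (auto simp: gs_inv_def)
  have bump: "gs_potential (g\<lparr>sb := s, gx := z, cur := (cur g)(c := Suc (cur g c))\<rparr>) < gs_potential g"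
    if "c < nA" "cur g c < da c" "z \<noteq> 0" for c s z
  proof -
    have "(\<Sum>a\<in>agents G. da a - ((cur g)(c := Suc (cur g c))) a) + (da c - cur g c)
        = (\<Sum>a\<in>agents G. da a - cur g a) + (da c - Suc (cur g c))"
    proof -
      have "(\<Sum>a\<in>agents G - {c}. da a - ((cur g)(c := Suc (cur g c))) a)
          = (\<Sum>a\<in>agents G - {c}. da a - cur g a)" by (intro sum.cong) auto
      then show ?thesis using that by (simp add: sum.remove[of "agents G" c])
    qed
    then show ?thesis using that False by (simp add: gs_potential_def)
  qed
  show ?thesis
  proof (cases "cur g a = da a")
    case True
    then have "gs_step g = g\<lparr>gx := 0\<rparr>" using False by (simp add: gs_step_def a_def Let_def)
    then show ?thesis using False by (simp add: gs_potential_def)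
  next
    case nd: False
    then have lt: "cur g a < da a" using a by simp
    define b where "b = agent_ranking G a ! cur g a"
    have bB: "b < nB" using agent_nth[of a "cur g a"] a lt edge_vertices[of a b] by (auto simp: b_def)
    show ?thesis
    proof (cases "sb g b = 0")
      case True
      then show ?thesis using False nd gxa by (simp add: gs_step_def gs_potential_def Let_def flip: b_def)
    next
      case sb: False
      define a' where "a' = sb g b - 1"
      have sba: "sb g b = Suc a'" using sb by (simp add: a'_def)
      have e': "(a', b) \<in> edges G" "cur g a' = ra a' b" using gs_invD(4)[OF I bB sb] by (simp_all add: a'_def)
      have a': "a' < nA" "cur g a' < da a'" using edge_vertices[OF e'(1)] ra_less[OF e'(1)] e'(2) by auto
      show ?thesis
      proof (cases "rb b a < rb b a'")
        case True
        have "gs_step g = g\<lparr>sb := (sb g)(b := Suc a), gx := sb g b, cur := (cur g)(a' := Suc (cur g a'))\<rparr>"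
          using False nd True gxa by (simp add: gs_step_def Let_def sba flip: b_def)
        then show ?thesis using bump[OF a', of "sb g b" "(sb g)(b := Suc a)"] sb by simp
      next
        case nr: False
        have "gs_step g = g\<lparr>cur := (cur g)(a := Suc (cur g a))\<rparr>"
          using False nd nr gxa by (simp add: gs_step_def Let_def sba flip: b_def)
        then show ?thesis using bump[OF a(1) lt, of "gx g" "sb g"] gxa by (simp add: gs_potential_def)
      qed
    qed
  qed
qed

definition gs_result :: "gs \<Rightarrow> (nat \<times> nat) set" where
  "gs_result g = {(a, b). a < nA \<and> cur g a < da a \<and> b = agent_ranking G a ! cur g a}"

text \<open>Stability holds because an agent has gone past only those jobs that are engaged to
  somebody they prefer. The other two claims allow later phases to read ranks and partners in
  \<open>S\<close> straight from the arrays.\<close>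

lemma gs_result_props:
  assumes I: "gs_inv g" and fin: "gs_finished g"
  shows "agent_optimal G (gs_result g)"
    "a < nA \<Longrightarrow> ka (gs_result g) a = cur g a"
    "b < nB \<Longrightarrow> (a, b) \<in> gs_result g \<longleftrightarrow> sb g b = Suc a"
proof -
  let ?S = "gs_result g"
  have gi: "gi g = nA" "gx g = 0" using I fin by (auto simp: gs_inv_def gs_finished_def)
  have i3: "cur g a \<le> da a" if "a < nA" for a using I that by (simp add: gs_inv_def)
  have i4: "(sb g b - 1, b) \<in> edges G \<and> cur g (sb g b - 1) = ra (sb g b - 1) b"
    if "b < nB" "sb g b \<noteq> 0" for b using I that unfolding gs_inv_def by blast
  have i5: "cur g a = da a \<or> sb g (agent_ranking G a ! cur g a) = Suc a" if "a < nA" for a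
    using I that gi unfolding gs_inv_def by auto
  have i6: "sb g b \<noteq> 0 \<and> rb b (sb g b - 1) < rb b a" if "(a, b) \<in> edges G" "ra a b < cur g a" for a b
    using I that unfolding gs_inv_def by blast
  have E: "(a, b) \<in> edges G" "ra a b = cur g a" if "(a, b) \<in> ?S" for a b
    using that agent_nth[of a "cur g a"] by (auto simp: gs_result_def)
  have SB: "(a, b) \<in> ?S \<longleftrightarrow> sb g b = Suc a" if b: "b < nB" for a b
  proof
    assume "(a, b) \<in> ?S" then show "sb g b = Suc a" using i5[of a] by (auto simp: gs_result_def)
  next
    assume s: "sb g b = Suc a"
    then have e: "(a, b) \<in> edges G" "cur g a = ra a b" using i4[OF b] by auto
    then show "(a, b) \<in> ?S"
      using edge_vertices[OF e(1)] ra_less[OF e(1)] nth_ra[OF e(1)] by (simp add: gs_result_def)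
  qed
  then show "b < nB \<Longrightarrow> (a, b) \<in> ?S \<longleftrightarrow> sb g b = Suc a" .
  have Sb: "b < nB" if "(a, b) \<in> ?S" for a b using E(1)[OF that] edge_vertices by fastforce
  have S: "matching G ?S"
    unfolding matching_def
  proof (intro conjI allI impI)
    show "?S \<subseteq> edges G" using E by auto
    show "b = b'" if "(a, b) \<in> ?S" "(a, b') \<in> ?S" for a b b' using that by (auto simp: gs_result_def)
    show "a = a'" if "(a, b) \<in> ?S" "(a', b) \<in> ?S" for a a' b
      using that SB[OF Sb[OF that(1)]] by auto
  qed
  have KA: "ka ?S a = cur g a" if a: "a < nA" for a
  proof (cases "cur g a < da a")
    case True
    then have "(a, agent_ranking G a ! cur g a) \<in> ?S" using a by (simp add: gs_result_def)
    then show ?thesis using ka_matched[OF S] E(2) by simp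
  next
    case False
    then have "(a, b) \<notin> ?S" for b by (simp add: gs_result_def)
    then have "ka ?S a = da a" by (rule ka_unmatched)
    then show ?thesis using i3[OF a] False by simp
  qed
  then show "a < nA \<Longrightarrow> ka ?S a = cur g a" .
  show "agent_optimal G ?S"
  proof unfold_locales
    show "matching G ?S" by (rule S)
    show "kb ?S b < rb b a" if e: "(a, b) \<in> edges G" "ra a b < ka ?S a" for a b
    proof -
      have v: "a < nA" "b < nB" using edge_vertices[OF e(1)] by auto
      have r: "sb g b \<noteq> 0" "rb b (sb g b - 1) < rb b a" using i6[OF e(1)] e(2) KA[OF v(1)] by auto
      then have "(sb g b - 1, b) \<in> ?S" using SB[OF v(2)] by simp
      then show ?thesis using kb_matched[OF S] r by simp
    qed
    show "ka ?S a \<le> ka M a" if "witness M x y" "a \<in> agents G" "0 \<le> x a" for M x y a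
    proof -
      have "a < nA" using that(2) by simp
      then show ?thesis using gs_invD(7)[OF I that(1) _ that(3)] KA by simp
    qed
  qed
qed

definition gs_init :: gs where
  "gs_init = \<lparr>cur = \<lambda>_. 0, sb = \<lambda>_. 0, gx = 0, gi = 0\<rparr>"

lemma gs_init_inv: "gs_inv gs_init"
  by (simp add: gs_inv_def gs_init_def)

end

section \<open>Program logic\<close>

text \<open>Total correctness, with the elapsed time passed to \<open>Q\<close>. Asking for one run
  is enough because \<open>exec\<close> is deterministic.\<close>

definition wp :: "nat \<Rightarrow> prog \<Rightarrow> (nat \<Rightarrow> state \<Rightarrow> bool) \<Rightarrow> state \<Rightarrow> bool" where
  "wp W p Q s \<longleftrightarrow> (\<exists>t s'. exec W p s t s' \<and> Q t s')"

lemma wp_Skip: "wp W Skip Q s \<longleftrightarrow> Q 1 s"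
  unfolding wp_def
  by (rule iffI, (elim exE conjE, erule exec_SkipE, simp), (intro exI conjI, rule exec_Skip; simp))

lemma wp_Assign: "wp W (Assign x e) Q s \<longleftrightarrow> expr_val e s \<le> W \<and> Q 1 (set_reg x (expr_val e s) s)"
  unfolding wp_def
  by (rule iffI, (elim exE conjE, erule exec_AssignE, simp), (intro exI conjI, rule exec_Assign; simp))

lemma wp_Store: "wp W (Store d u w) Q s \<longleftrightarrow> operand_val u s \<le> W \<and> operand_val w s \<le> W \<and>
    Q 1 (set_mem d (operand_val u s) (operand_val w s) s)"
  unfolding wp_def
  by (rule iffI, (elim exE conjE, erule exec_StoreE, simp), (intro exI conjI, rule exec_Store; simp))

lemma wp_Seq: "wp W (Seq p q) Q s \<longleftrightarrow> wp W p (\<lambda>t. wp W q (\<lambda>t'. Q (t + t'))) s"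
  unfolding wp_def by (blast intro: exec_Seq elim: exec_SeqE)

lemma wp_Cond: "wp W (Cond b p q) Q s \<longleftrightarrow>
    (if test_val b s then wp W p (\<lambda>t. Q (Suc t)) s else wp W q (\<lambda>t. Q (Suc t)) s)"
  unfolding wp_def by (cases "test_val b s") (simp; blast intro: exec_CondT exec_CondF elim: exec_CondE)+

lemma wp_mono: "wp W p Q s \<Longrightarrow> (\<And>t s'. Q t s' \<Longrightarrow> R t s') \<Longrightarrow> wp W p R s"
  unfolding wp_def by blast

text \<open>A single function serves as termination measure and as time budget: an iteration lowers
  \<open>f\<close> by strictly more than its body costs, and the surplus covers the test.\<close>

lemma wp_While:
  assumes "\<And>s. I s \<Longrightarrow> test_val b s \<Longrightarrow> wp W p (\<lambda>t s'. I s' \<and> f s' + t < f s) s" and "I s"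
  shows "wp W (While b p) (\<lambda>t s'. I s' \<and> \<not> test_val b s' \<and> t \<le> Suc (f s)) s"
  using assms(2)
proof (induction "f s" arbitrary: s rule: less_induct)
  case less
  show ?case
  proof (cases "test_val b s")
    case False
    then show ?thesis unfolding wp_def using exec_WhileF less.prems by (intro exI[of _ 1] exI[of _ s]) auto
  next
    case True
    then obtain t1 s1 where 1: "exec W p s t1 s1" "I s1" "f s1 + t1 < f s"
      using assms(1)[OF less.prems] unfolding wp_def by blast
    then obtain t2 s2 where 2: "exec W (While b p) s1 t2 s2" "I s2" "\<not> test_val b s2" "t2 \<le> Suc (f s1)"
      using less.hyps[of s1] unfolding wp_def by auto
    have "exec W (While b p) s (Suc (t1 + t2)) s2" using exec_WhileT[OF True 1(1) 2(1)] .
    then show ?thesis unfolding wp_def using 1 2 by (intro exI[of _ "Suc (t1 + t2)"] exI[of _ s2]) auto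
  qed
qed

fun block :: "prog list \<Rightarrow> prog" where
  "block [] = Skip"
| "block [p] = p"
| "block (p # q # ps) = Seq p (block (q # ps))"

lemma set_reg_simps [simp]:
  "reg (set_reg x n s) = (reg s)(x := n)" "mem (set_reg x n s) = mem s"
  by (simp_all add: set_reg_def)

lemma set_mem_simps [simp]:
  "reg (set_mem d i n s) = reg s" "mem (set_mem d i n s) = (mem s)(d := (mem s d)(i := n))"
  by (simp_all add: set_mem_def)

lemmas wp_simps = wp_Skip wp_Assign wp_Store wp_Seq wp_Cond

section \<open>Preprocessing\<close>

lemma offset_Suc: "offset f (Suc a) = offset f a + length (f a)"
  by (simp add: offset_def)

lemma offset_mono: "a \<le> a' \<Longrightarrow> offset f a \<le> offset f a'"
  by (rule lift_Suc_mono_le[of "offset f"]) (simp_all add: offset_Suc)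

lemma offset_inj:
  assumes "offset f a + i = offset f a' + i'" "i < length (f a)" "i' < length (f a')"
  shows "a = a' \<and> i = i'"
proof -
  have "\<not> a < a'" using offset_mono[of "Suc a" a' f] assms(1,2) by (auto simp: offset_Suc)
  moreover have "\<not> a' < a" using offset_mono[of "Suc a'" a f] assms(1,3) by (auto simp: offset_Suc)
  ultimately show ?thesis using assms(1) by simp
qed

lemma concat_nth:
  "a < n \<Longrightarrow> i < length (f a) \<Longrightarrow> offset f a + i < length (concat (map f [0..<n])) \<and>
     concat (map f [0..<n]) ! (offset f a + i) = f a ! i"
proof (induction n)
  case (Suc n)
  have len: "length (concat (map f [0..<n])) = offset f n" for n
    by (induction n) (simp_all add: offset_def)
  show ?case
  proof (cases "a < n")
    case True
    then show ?thesis using Suc by (simp add: nth_append)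
  next
    case False
    then have "a = n" using Suc.prems by simp
    then show ?thesis using Suc.prems len by (simp add: nth_append)
  qed
qed simp

lemma ranking_array_nth:
  "a < n \<Longrightarrow> i < length (f a) \<Longrightarrow> ranking_array f n (offset f a + i) = f a ! i"
  using concat_nth by (simp add: ranking_array_def array_def)

lemma offset_array_nth: "a \<le> n \<Longrightarrow> offset_array f n a = offset f a"
  by (simp add: offset_array_def array_def del: upt_Suc)

lemma pair_index_inj:
  fixes a b n :: nat
  assumes "a * n + b = a' * n + b'" "b < n" "b' < n"
  shows "a = a' \<and> b = b'"
proof -
  have "(a * n + b) div n = a" "(a' * n + b') div n = a'" using assms(2,3) by auto
  then show ?thesis using assms(1) by simp
qed

text \<open>The bound is quadratic because of the table addresses \<open>a * nB + b\<close>. The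
  factor 20 makes room for the linear quantities, above all for the stack heights, which are bounded
  through \<open>potential\<close>.\<close>

locale ram = numbered_marriage +
  fixes W :: nat
  assumes W_large: "20 * (input_size G + 2) * (input_size G + 2) \<le> W"
begin

definition offA :: "nat \<Rightarrow> nat" where "offA = offset (agent_ranking G)"
definition offB :: "nat \<Rightarrow> nat" where "offB = offset (job_ranking G)"

lemma offA_Suc: "offA (Suc a) = offA a + da a" and offB_Suc: "offB (Suc b) = offB b + db b"
  by (simp_all add: offA_def offB_def offset_Suc da_def db_def)

lemma offA_0: "offA 0 = 0" and offB_0: "offB 0 = 0"
  by (simp_all add: offA_def offB_def offset_def)

lemma offA_mono: "a \<le> a' \<Longrightarrow> offA a \<le> offA a'" and offB_mono: "a \<le> a' \<Longrightarrow> offB a \<le> offB a'"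
  by (simp_all add: offA_def offB_def offset_mono)

lemma offA_inj: "offA a + i = offA a' + i' \<Longrightarrow> i < da a \<Longrightarrow> i' < da a' \<Longrightarrow> a = a' \<and> i = i'"
  and offB_inj: "offB b + i = offB b' + i' \<Longrightarrow> i < db b \<Longrightarrow> i' < db b' \<Longrightarrow> b = b' \<and> i = i'"
  unfolding offA_def offB_def da_def db_def by (rule offset_inj; assumption)+

lemma offA_eq_sum: "offA a = (\<Sum>i<a. da i)" and offB_eq_sum: "offB b = (\<Sum>i<b. db i)"
  by (simp_all add: offA_def offB_def offset_def da_def db_def)

lemma offA_nA: "offA nA = card (edges G)"
proof -
  have "edges G = Sigma (agents G) (\<lambda>a. set (agent_ranking G a))"
    using agent_list(2) edge_vertices by fastforce
  then have "card (edges G) = (\<Sum>a\<in>agents G. card (set (agent_ranking G a)))" by simp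
  also have "\<dots> = (\<Sum>a\<in>agents G. da a)"
    by (intro sum.cong refl) (metis agent_list(1) da_def distinct_card)
  finally show ?thesis by (simp add: offA_eq_sum agents_eq)
qed

lemma offB_nB: "offB nB = card (edges G)"
proof -
  have "prod.swap ` edges G = Sigma (jobs G) (\<lambda>b. set (job_ranking G b))"
    using job_list(2) edge_vertices by force
  moreover have "card (prod.swap ` edges G) = card (edges G)" by (simp add: card_image)
  ultimately have "card (edges G) = card (Sigma (jobs G) (\<lambda>b. set (job_ranking G b)))" by simp
  also have "\<dots> = (\<Sum>b\<in>jobs G. card (set (job_ranking G b)))" by simp
  also have "\<dots> = (\<Sum>b\<in>jobs G. db b)"
    by (intro sum.cong refl) (metis job_list(1) db_def distinct_card)
  finally show ?thesis by (simp add: offB_eq_sum jobs_eq)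
qed

lemma size: "nA + nB + card (edges G) = input_size G"
  by (simp add: input_size_def nA_def nB_def)

lemma offA_le: "a \<le> nA \<Longrightarrow> offA a \<le> card (edges G)" and offB_le: "b \<le> nB \<Longrightarrow> offB b \<le> card (edges G)"
  using offA_mono[of a nA] offB_mono[of b nB] offA_nA offB_nB by simp_all

lemma da_le: "a < nA \<Longrightarrow> da a \<le> card (edges G)" and db_le: "b < nB \<Longrightarrow> db b \<le> card (edges G)"
  using offA_le[of "Suc a"] offB_le[of "Suc b"] by (simp_all add: offA_Suc offB_Suc)

lemma W_linear: "20 * input_size G + 20 \<le> W"
proof -
  have "20 * input_size G + 20 \<le> 20 * (input_size G + 2) * 1" by simp
  also have "\<dots> \<le> 20 * (input_size G + 2) * (input_size G + 2)" by (rule mult_le_mono2) simp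
  finally show ?thesis using W_large by simp
qed

lemma W_index: "a \<le> nA \<Longrightarrow> b \<le> nB \<Longrightarrow> a * nB + b \<le> W"
proof -
  assume "a \<le> nA" "b \<le> nB"
  then have "a * nB + b \<le> input_size G * input_size G + input_size G"
    using size by (intro add_mono mult_le_mono) auto
  also have "\<dots> \<le> 20 * (input_size G + 2) * (input_size G + 2)" by (simp add: algebra_simps)
  finally show ?thesis using W_large by simp
qed

lemma W_small: "x \<le> 20 * nA + 20 * nB + 20 * card (edges G) + 20 \<Longrightarrow> x \<le> W"
  using W_linear size by simp

definition inp :: "state \<Rightarrow> bool" where
  "inp s \<longleftrightarrow> reg s 0 = nA \<and> reg s 1 = nB \<and> mem s 0 = mem (input_state G) 0 \<and>
     mem s 1 = mem (input_state G) 1 \<and> mem s 2 = mem (input_state G) 2 \<and>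
     mem s 3 = mem (input_state G) 3"

lemma inp_input: "inp (input_state G)"
  by (simp add: inp_def input_state_def nA_def nB_def)

lemma inp_reg: "inp s \<Longrightarrow> reg s 0 = nA" "inp s \<Longrightarrow> reg s (Suc 0) = nB"
  by (simp_all add: inp_def)

lemma inp_mem:
  assumes "inp s"
  shows "a \<le> nA \<Longrightarrow> mem s 0 a = offA a" "b \<le> nB \<Longrightarrow> mem s 2 b = offB b"
    "a < nA \<Longrightarrow> i < da a \<Longrightarrow> mem s (Suc 0) (offA a + i) = agent_ranking G a ! i"
    "b < nB \<Longrightarrow> i < db b \<Longrightarrow> mem s 3 (offB b + i) = job_ranking G b ! i"
  using assms unfolding inp_def
  by (simp_all add: input_state_def offA_def offB_def da_def db_def offset_array_nth ranking_array_nth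
      flip: nA_def nB_def)

lemma list_bounds: "a < nA \<Longrightarrow> i < da a \<Longrightarrow> agent_ranking G a ! i < nB"
  "b < nB \<Longrightarrow> i < db b \<Longrightarrow> job_ranking G b ! i < nA"
  using agent_nth[of a i] job_nth[of b i] edge_vertices by fastforce+

subsection \<open>Rank tables\<close>

text \<open>Since memory is initially zero and addresses may be polynomially large, tables indexed by
  pairs \<open>a * nB + b\<close> need no initialization: arrays 5 and 6 map such an index to the rank of \<open>b\<close>
  for \<open>a\<close> and of \<open>a\<close> for \<open>b\<close>. Array 4 holds the multiples of \<open>nB\<close>, array 7 marks the first
  choices, array 8 holds \<open>sr\<close>, arrays 9 and 10 the state of the Gale--Shapley algorithm, and
  arrays 11 to 18 that of the job phase, whose last three arrays are stacks.\<close>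

definition body1 :: prog where
  "body1 = block [
     Assign 8 (Add (Reg 2) (Num 1)), Assign 5 (Load 0 (Reg 8)), Assign 9 (Load 0 (Reg 2)),
     Cond (Less (Reg 3) (Reg 5))
       (block [Assign 6 (Load 1 (Reg 3)), Assign 7 (Add (Reg 4) (Reg 6)), Assign 10 (Sub (Reg 3) (Reg 9)),
          Store 5 (Reg 7) (Reg 10), Cond (Equal (Reg 10) (Num 0)) (Store 7 (Reg 6) (Num 1)) Skip,
          Assign 3 (Add (Reg 3) (Num 1))])
       (block [Store 4 (Reg 2) (Reg 4), Assign 2 (Opd (Reg 8)), Assign 4 (Add (Reg 4) (Reg 1))])]"

definition keep :: "nat set \<Rightarrow> state \<Rightarrow> state \<Rightarrow> bool" where
  "keep D s s' \<longleftrightarrow> reg s' 0 = reg s 0 \<and> reg s' (Suc 0) = reg s (Suc 0) \<and> (\<forall>d. d \<notin> D \<longrightarrow> mem s' d = mem s d)"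

lemma keep_mem: "keep D s s' \<Longrightarrow> d \<notin> D \<Longrightarrow> mem s' d = mem s d"
  by (simp add: keep_def)

lemma inp_keep: "inp s \<Longrightarrow> keep D s s' \<Longrightarrow> D \<inter> {0, Suc 0, 2, 3} = {} \<Longrightarrow> inp s'"
  by (auto simp: inp_def keep_def)

text \<open>Later phases take their initial state from arrays that are still zero, so every phase
  has to report which ones it left untouched.\<close>

definition fresh :: "nat \<Rightarrow> state \<Rightarrow> bool" where
  "fresh n s \<longleftrightarrow> (\<forall>d\<ge>n. mem s d = (\<lambda>_. 0))"

lemma fresh_keep: "fresh n s \<Longrightarrow> keep D s s' \<Longrightarrow> (\<And>d. d \<in> D \<Longrightarrow> d < n) \<Longrightarrow> fresh n s'"
  unfolding fresh_def keep_def by (metis not_less)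

text \<open>A single loop replaces the nested one over agents and their lists: register 2 is the
  agent, register 3 the cell in the concatenated lists. Register 4 accumulates \<open>a * nB\<close>
  by additions, as the machine cannot multiply.\<close>

definition inv1 :: "state \<Rightarrow> bool" where
  "inv1 s \<longleftrightarrow> inp s \<and> fresh 8 s \<and> mem s 6 = (\<lambda>_. 0) \<and> reg s 2 \<le> nA \<and> reg s 4 = reg s 2 * nB \<and>
     offA (reg s 2) \<le> reg s 3 \<and> reg s 3 \<le> offA nA \<and> (reg s 2 < nA \<longrightarrow> reg s 3 \<le> offA (Suc (reg s 2))) \<and>
     (\<forall>a<reg s 2. mem s 4 a = a * nB) \<and>
     (\<forall>a i. a < nA \<longrightarrow> i < da a \<longrightarrow> offA a + i < reg s 3 \<longrightarrow> mem s 5 (a * nB + agent_ranking G a ! i) = i) \<and>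
     (\<forall>b. mem s 7 b = (if \<exists>a<nA. 0 < da a \<and> offA a < reg s 3 \<and> agent_ranking G a ! 0 = b then 1 else 0))"

definition pot1 :: "state \<Rightarrow> nat" where
  "pot1 s = 20 * ((offA nA - reg s 3) + (nA - reg s 2))"

lemma body1:
  assumes I: "inv1 s" and t: "test_val (Less (Reg 2) (Reg 0)) s"
  shows "wp W body1 (\<lambda>t s'. inv1 s' \<and> pot1 s' + t < pot1 s) s"
proof -
  define a e where "a = reg s 2" and "e = reg s 3"
  have r: "reg s 2 = a" "reg s 3 = e" by (simp_all add: a_def e_def)
  have inp: "inp s" and base: "reg s 4 = a * nB" and e: "offA a \<le> e" "e \<le> offA nA"
    and m4: "\<And>a'. a' < a \<Longrightarrow> mem s 4 a' = a' * nB"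
    and m5: "\<And>a i. a < nA \<Longrightarrow> i < da a \<Longrightarrow> offA a + i < e \<Longrightarrow> mem s 5 (a * nB + agent_ranking G a ! i) = i"
    and m7: "\<And>b. mem s 7 b = (if \<exists>a<nA. 0 < da a \<and> offA a < e \<and> agent_ranking G a ! 0 = b then 1 else 0)"
    and z: "fresh 8 s" "mem s 6 = (\<lambda>_. 0)"
    using I unfolding inv1_def r by blast+
  note ir = inp_reg[OF inp]
  have a: "a < nA" using t ir r by simp
  have e': "e \<le> offA (Suc a)" using I a unfolding inv1_def r by blast
  have ld: "mem s 0 (Suc a) = offA (Suc a)" "mem s 0 a = offA a" using inp_mem(1)[OF inp] a by simp_all
  have bounds: "Suc a \<le> W" "offA (Suc a) \<le> W" "offA a \<le> W" "Suc e \<le> W" "Suc 0 \<le> W" "a \<le> W"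
    using a e offA_le[of a] offA_le[of "Suc a"] offA_nA by (auto intro!: W_small)
  have bounds2: "a * nB + nB \<le> W" using W_index[of a nB] a by simp
  have pot: "pot1 s = 20 * ((offA nA - e) + (nA - a))" by (simp add: pot1_def r)
  show ?thesis
  proof (cases "e < offA (Suc a)")
    case True
    define i b where "i = e - offA a" and "b = agent_ranking G a ! i"
    have i: "i < da a" "e = offA a + i" using True e(1) by (auto simp: i_def offA_Suc)
    have b: "b < nB" using list_bounds(1)[OF a i(1)] by (simp add: b_def)
    have lb: "mem s (Suc 0) e = b" using inp_mem(3)[OF inp a i(1)] i(2) by (simp add: b_def)
    have Ei: "Suc e \<le> offA nA" using True offA_mono[of "Suc a" nA] a by simp
    have ie: "e - offA a = i" using i by simp
    have wb: "b \<le> W" "a * nB + b \<le> W" "i \<le> W" "e \<le> W" using b bounds bounds2 i by auto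
    have u5: "((mem s 5)(a * nB + b := i)) (a' * nB + agent_ranking G a' ! i') = i'"
      if h: "a' < nA" "i' < da a'" "offA a' + i' < Suc e" for a' i'
    proof (cases "a' * nB + agent_ranking G a' ! i' = a * nB + b")
      case True
      then have "a' = a" "agent_ranking G a' ! i' = b"
        using pair_index_inj[OF True list_bounds(1)[OF h(1,2)] b] by auto
      then have "i' = i" using agent_nth[of a i'] agent_nth[of a i] a h(2) i(1) by (auto simp: b_def)
      then show ?thesis using True by simp
    next
      case False
      then have "offA a' + i' \<noteq> e" using offA_inj[of a' i' a i] h(2) i by (auto simp: b_def)
      then show ?thesis using m5[OF h(1,2)] h(3) False by simp
    qed
    \<comment> \<open>Handling cell \<open>e\<close> adds a first choice exactly when
      \<open>e\<close> is the first cell of a list, that is, when \<open>i = 0\<close>.\<close>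
    have u7: "(\<exists>a'<nA. 0 < da a' \<and> offA a' < Suc e \<and> agent_ranking G a' ! 0 = b') \<longleftrightarrow>
        (\<exists>a'<nA. 0 < da a' \<and> offA a' < e \<and> agent_ranking G a' ! 0 = b') \<or> (i = 0 \<and> b = b')" for b'
    proof -
      have "offA a' = e \<longleftrightarrow> a' = a \<and> i = 0" if "0 < da a'" for a'
        using offA_inj[of a' 0 a i] that i by auto
      then show ?thesis using a i(1) b_def less_Suc_eq by (metis (no_types, lifting) gr_zeroI)
    qed
    have "wp W body1 (\<lambda>t s'. t \<le> 15 \<and> keep {5, 7} s s' \<and> reg s' 2 = a \<and> reg s' 3 = Suc e \<and>
        reg s' 4 = a * nB \<and> mem s' 5 = (mem s 5)(a * nB + b := i) \<and>
        mem s' 7 = (if i = 0 then (mem s 7)(b := 1) else mem s 7)) s"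
      unfolding body1_def using bounds wb
      by (simp add: wp_simps r base ir ld lb True ie keep_def)
    then show ?thesis
    proof (rule wp_mono, elim conjE)
      fix t :: nat and s' assume t: "t \<le> 15" and k: "keep {5, 7} s s'" and r': "reg s' 2 = a" "reg s' 3 = Suc e"
        "reg s' 4 = a * nB" and n5: "mem s' 5 = (mem s 5)(a * nB + b := i)"
        and n7: "mem s' 7 = (if i = 0 then (mem s 7)(b := 1) else mem s 7)"
      have "inv1 s'"
        unfolding inv1_def r'
      proof (intro conjI allI impI)
        show "inp s'" by (rule inp_keep[OF inp k]) simp
        show "fresh 8 s'" by (rule fresh_keep[OF z(1) k]) auto
        show "mem s' 6 = (\<lambda>_. 0)" using keep_mem[OF k, of 6] z by simp
        show "a \<le> nA" "offA a \<le> Suc e" "Suc e \<le> offA nA" using a e Ei by simp_all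
        show "Suc e \<le> offA (Suc a)" using True by simp
        show "mem s' 4 a' = a' * nB" if "a' < a" for a' using keep_mem[OF k, of 4] m4 that by simp
        show "mem s' 5 (a' * nB + agent_ranking G a' ! i') = i'"
          if "a' < nA" "i' < da a'" "offA a' + i' < Suc e" for a' i' unfolding n5 by (rule u5[OF that])
        show "mem s' 7 b' = (if \<exists>a'<nA. 0 < da a' \<and> offA a' < Suc e \<and> agent_ranking G a' ! 0 = b' then 1 else 0)"
          for b' unfolding n7 u7 using m7[of b'] by auto
      qed simp
      moreover have "pot1 s' + t < pot1 s" using t Ei by (simp add: pot1_def r' r)
      ultimately show "inv1 s' \<and> pot1 s' + t < pot1 s" by blast
    qed
  next
    case False
    then have e2: "e = offA (Suc a)" using e' by simp
    have "wp W body1 (\<lambda>t s'. t \<le> 15 \<and> keep {4} s s' \<and> reg s' 2 = Suc a \<and> reg s' 3 = e \<and>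
        reg s' 4 = Suc a * nB \<and> mem s' 4 = (mem s 4)(a := a * nB)) s"
      unfolding body1_def using bounds bounds2
      by (simp add: wp_simps r base ir ld False keep_def add.commute)
    then show ?thesis
    proof (rule wp_mono, elim conjE)
      fix t :: nat and s' assume t: "t \<le> 15" and k: "keep {4} s s'" and r': "reg s' 2 = Suc a" "reg s' 3 = e"
        "reg s' 4 = Suc a * nB" and n4: "mem s' 4 = (mem s 4)(a := a * nB)"
      have "inv1 s'"
        unfolding inv1_def r'
      proof (intro conjI allI impI)
        show "inp s'" by (rule inp_keep[OF inp k]) simp
        show "fresh 8 s'" by (rule fresh_keep[OF z(1) k]) auto
        show "mem s' 6 = (\<lambda>_. 0)" using keep_mem[OF k, of 6] z by simp
        show "Suc a \<le> nA" "offA (Suc a) \<le> e" "e \<le> offA nA" using a e e2 by simp_all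
        show "e \<le> offA (Suc (Suc a))" using e2 offA_mono[of "Suc a" "Suc (Suc a)"] by simp
        show "mem s' 4 a' = a' * nB" if "a' < Suc a" for a' using m4 that by (auto simp: n4 less_Suc_eq)
        show "mem s' 5 (a' * nB + agent_ranking G a' ! i') = i'"
          if "a' < nA" "i' < da a'" "offA a' + i' < e" for a' i' using m5[OF that] keep_mem[OF k, of 5] by simp
        show "mem s' 7 b' = (if \<exists>a'<nA. 0 < da a' \<and> offA a' < e \<and> agent_ranking G a' ! 0 = b' then 1 else 0)"
          for b' using m7[of b'] keep_mem[OF k, of 7] by simp
      qed simp
      moreover have "pot1 s' + t < pot1 s" using t a by (simp add: pot1_def r' r)
      ultimately show "inv1 s' \<and> pot1 s' + t < pot1 s" by blast
    qed
  qed
qed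

definition pre1 :: "state \<Rightarrow> bool" where
  "pre1 s \<longleftrightarrow> inp s \<and> (\<forall>a<nA. mem s 4 a = a * nB) \<and>
     (\<forall>a b. (a, b) \<in> edges G \<longrightarrow> mem s 5 (a * nB + b) = ra a b) \<and>
     (\<forall>b. mem s 7 b = (if b \<in> fjobs then 1 else 0))"

lemma pre1_keep: "pre1 s \<Longrightarrow> keep D s s' \<Longrightarrow> D \<inter> {0, Suc 0, 2, 3, 4, 5, 7} = {} \<Longrightarrow> pre1 s'"
  unfolding pre1_def using inp_keep[of s D s'] keep_mem[of D s s' 4] keep_mem[of D s s' 5] keep_mem[of D s s' 7]
  by auto

definition loop1 :: prog where "loop1 = While (Less (Reg 2) (Reg 0)) body1"

lemma loop1: "wp W loop1 (\<lambda>t s'. t \<le> 20 * input_size G + 1 \<and> pre1 s' \<and> fresh 8 s' \<and> mem s' 6 = (\<lambda>_. 0)) (input_state G)"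
proof -
  let ?s = "input_state G"
  have r0: "reg ?s 2 = 0" "reg ?s 3 = 0" "reg ?s 4 = 0" by (simp_all add: input_state_def)
  have z: "mem ?s d = (\<lambda>_. 0)" if "d \<ge> 4" for d using that by (auto simp: input_state_def)
  have I0: "inv1 ?s"
    unfolding inv1_def r0 using inp_input z by (auto simp: offA_0 fresh_def)
  have "wp W loop1 (\<lambda>t s'. inv1 s' \<and> \<not> test_val (Less (Reg 2) (Reg 0)) s' \<and> t \<le> Suc (pot1 ?s)) ?s"
    unfolding loop1_def by (rule wp_While[of inv1, OF body1 I0])
  then show ?thesis
  proof (rule wp_mono, elim conjE)
    fix t s' assume I: "inv1 s'" and n: "\<not> test_val (Less (Reg 2) (Reg 0)) s'" and t: "t \<le> Suc (pot1 ?s)"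
    have inp: "inp s'" using I by (simp add: inv1_def)
    have r: "reg s' 2 = nA" "reg s' 3 = offA nA" using I n inp_reg[OF inp] by (auto simp: inv1_def)
    have less: "offA a + i < offA nA" if "a < nA" "i < da a" for a i
      using offA_mono[of "Suc a" nA] that by (simp add: offA_Suc)
    have m4: "\<forall>a<nA. mem s' 4 a = a * nB" using I r by (simp add: inv1_def)
    have m5: "mem s' 5 (a * nB + agent_ranking G a ! i) = i" if "a < nA" "i < da a" for a i
      using I r that less[OF that] unfolding inv1_def by simp
    have "mem s' 5 (a * nB + b) = ra a b" if e: "(a, b) \<in> edges G" for a b
      using m5[of a "ra a b"] edge_vertices[OF e] ra_less[OF e] nth_ra[OF e] by simp
    moreover have "mem s' 7 b = (if b \<in> fjobs then 1 else 0)" for b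
    proof -
      have "(\<exists>a<nA. 0 < da a \<and> offA a < offA nA \<and> agent_ranking G a ! 0 = b) \<longleftrightarrow> b \<in> fjobs"
      proof
        assume "\<exists>a<nA. 0 < da a \<and> offA a < offA nA \<and> agent_ranking G a ! 0 = b"
        then obtain a where "a < nA" "0 < da a" "agent_ranking G a ! 0 = b" by blast
        then show "b \<in> fjobs" using agent_nth[of a 0] by (auto simp: fjobs_def)
      next
        assume "b \<in> fjobs"
        then obtain a where a: "(a, b) \<in> edges G" "ra a b = 0" by (auto simp: fjobs_def)
        then have "a < nA" "0 < da a" "agent_ranking G a ! 0 = b"
          using edge_vertices[OF a(1)] ra_less[OF a(1)] nth_ra[OF a(1)] by auto
        then show "\<exists>a<nA. 0 < da a \<and> offA a < offA nA \<and> agent_ranking G a ! 0 = b"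
          using less[of a 0] by auto
      qed
      then show ?thesis using I r unfolding inv1_def by simp
    qed
    ultimately have "pre1 s'" using inp m4 by (simp add: pre1_def)
    moreover have "pot1 ?s \<le> 20 * input_size G" using size offA_nA by (simp add: pot1_def r0)
    ultimately show "t \<le> 20 * input_size G + 1 \<and> pre1 s' \<and> fresh 8 s' \<and> mem s' 6 = (\<lambda>_. 0)"
      using I t by (simp add: inv1_def)
  qed
qed

text \<open>This loop runs along the lists of the jobs but indexes its table by
  \<open>a * nB + b\<close> too; the row offset of the agent comes from array 4.\<close>

definition body2 :: prog where
  "body2 = block [
     Assign 8 (Add (Reg 2) (Num 1)), Assign 5 (Load 2 (Reg 8)), Assign 9 (Load 2 (Reg 2)),
     Cond (Less (Reg 3) (Reg 5))
       (block [Assign 6 (Load 3 (Reg 3)), Assign 7 (Load 4 (Reg 6)), Assign 7 (Add (Reg 7) (Reg 2)),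
          Assign 10 (Sub (Reg 3) (Reg 9)), Store 6 (Reg 7) (Reg 10), Assign 3 (Add (Reg 3) (Num 1))])
       (Assign 2 (Opd (Reg 8)))]"

definition inv2 :: "state \<Rightarrow> bool" where
  "inv2 s \<longleftrightarrow> pre1 s \<and> fresh 8 s \<and> reg s 2 \<le> nB \<and>
     offB (reg s 2) \<le> reg s 3 \<and> reg s 3 \<le> offB nB \<and> (reg s 2 < nB \<longrightarrow> reg s 3 \<le> offB (Suc (reg s 2))) \<and>
     (\<forall>b j. b < nB \<longrightarrow> j < db b \<longrightarrow> offB b + j < reg s 3 \<longrightarrow> mem s 6 (job_ranking G b ! j * nB + b) = j)"

definition pot2 :: "state \<Rightarrow> nat" where
  "pot2 s = 20 * ((offB nB - reg s 3) + (nB - reg s 2))"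

lemma body2:
  assumes I: "inv2 s" and t: "test_val (Less (Reg 2) (Reg 1)) s"
  shows "wp W body2 (\<lambda>t s'. inv2 s' \<and> pot2 s' + t < pot2 s) s"
proof -
  define b e where "b = reg s 2" and "e = reg s 3"
  have r: "reg s 2 = b" "reg s 3 = e" by (simp_all add: b_def e_def)
  have pre: "pre1 s" and e: "offB b \<le> e" "e \<le> offB nB"
    and m6: "\<And>b j. b < nB \<Longrightarrow> j < db b \<Longrightarrow> offB b + j < e \<Longrightarrow> mem s 6 (job_ranking G b ! j * nB + b) = j"
    and z: "fresh 8 s"
    using I unfolding inv2_def r by blast+
  have inp: "inp s" and m4: "\<And>a. a < nA \<Longrightarrow> mem s 4 a = a * nB" using pre by (auto simp: pre1_def)
  note ir = inp_reg[OF inp]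
  have b: "b < nB" using t ir r by simp
  have e': "e \<le> offB (Suc b)" using I b unfolding inv2_def r by blast
  have ld: "mem s 2 (Suc b) = offB (Suc b)" "mem s 2 b = offB b" using inp_mem(2)[OF inp] b by simp_all
  have bounds: "Suc b \<le> W" "offB (Suc b) \<le> W" "offB b \<le> W" "Suc e \<le> W" "b \<le> W"
    using b e offB_le[of b] offB_le[of "Suc b"] offB_nB by (auto intro!: W_small)
  have pot: "pot2 s = 20 * ((offB nB - e) + (nB - b))" by (simp add: pot2_def r)
  show ?thesis
  proof (cases "e < offB (Suc b)")
    case True
    define j a where "j = e - offB b" and "a = job_ranking G b ! j"
    have j: "j < db b" "e = offB b + j" using True e(1) by (auto simp: j_def offB_Suc)
    have a: "a < nA" using list_bounds(2)[OF b j(1)] by (simp add: a_def)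
    have lb: "mem s 3 e = a" using inp_mem(4)[OF inp b j(1)] j(2) by (simp add: a_def)
    have Ei: "Suc e \<le> offB nB" using True offB_mono[of "Suc b" nB] b by simp
    have je: "e - offB b = j" using j by simp
    have wb: "a \<le> W" "a * nB + b \<le> W" "a * nB \<le> W" "j \<le> W"
      using a b bounds j W_index[of a b] by (auto intro: W_small)
    have u6: "((mem s 6)(a * nB + b := j)) (job_ranking G b' ! j' * nB + b') = j'"
      if h: "b' < nB" "j' < db b'" "offB b' + j' < Suc e" for b' j'
    proof (cases "job_ranking G b' ! j' * nB + b' = a * nB + b")
      case True
      then have "b' = b" "job_ranking G b' ! j' = a"
        using pair_index_inj[OF True h(1) b] by auto
      then have "j' = j" using job_nth[of b j'] job_nth[of b j] b h(2) j(1) by (auto simp: a_def)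
      then show ?thesis using True by simp
    next
      case False
      then have "offB b' + j' \<noteq> e" using offB_inj[of b' j' b j] h(2) j by (auto simp: a_def)
      then show ?thesis using m6[OF h(1,2)] h(3) False by simp
    qed
    have "wp W body2 (\<lambda>t s'. t \<le> 15 \<and> keep {6} s s' \<and> reg s' 2 = b \<and> reg s' 3 = Suc e \<and>
        mem s' 6 = (mem s 6)(a * nB + b := j)) s"
      unfolding body2_def using bounds wb
      by (simp add: wp_simps r ir ld lb m4 a True je keep_def)
    then show ?thesis
    proof (rule wp_mono, elim conjE)
      fix t :: nat and s' assume t: "t \<le> 15" and k: "keep {6} s s'" and r': "reg s' 2 = b" "reg s' 3 = Suc e"
        and n6: "mem s' 6 = (mem s 6)(a * nB + b := j)"
      have "inv2 s'"
        unfolding inv2_def r'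
      proof (intro conjI allI impI)
        show "pre1 s'" by (rule pre1_keep[OF pre k]) simp
        show "fresh 8 s'" by (rule fresh_keep[OF z k]) auto
        show "b \<le> nB" "offB b \<le> Suc e" "Suc e \<le> offB nB" using b e Ei by simp_all
        show "Suc e \<le> offB (Suc b)" using True by simp
        show "mem s' 6 (job_ranking G b' ! j' * nB + b') = j'"
          if "b' < nB" "j' < db b'" "offB b' + j' < Suc e" for b' j' unfolding n6 by (rule u6[OF that])
      qed
      moreover have "pot2 s' + t < pot2 s" using t Ei by (simp add: pot2_def r' r)
      ultimately show "inv2 s' \<and> pot2 s' + t < pot2 s" by blast
    qed
  next
    case False
    then have e2: "e = offB (Suc b)" using e' by simp
    have "wp W body2 (\<lambda>t s'. t \<le> 15 \<and> keep {} s s' \<and> reg s' 2 = Suc b \<and> reg s' 3 = e) s"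
      unfolding body2_def using bounds
      by (simp add: wp_simps r ir ld False keep_def)
    then show ?thesis
    proof (rule wp_mono, elim conjE)
      fix t :: nat and s' assume t: "t \<le> 15" and k: "keep {} s s'" and r': "reg s' 2 = Suc b" "reg s' 3 = e"
      have "inv2 s'"
        unfolding inv2_def r'
      proof (intro conjI allI impI)
        show "pre1 s'" by (rule pre1_keep[OF pre k]) simp
        show "fresh 8 s'" by (rule fresh_keep[OF z k]) auto
        show "Suc b \<le> nB" "offB (Suc b) \<le> e" "e \<le> offB nB" using b e e2 by simp_all
        show "e \<le> offB (Suc (Suc b))" using e2 offB_mono[of "Suc b" "Suc (Suc b)"] by simp
        show "mem s' 6 (job_ranking G b' ! j' * nB + b') = j'"
          if "b' < nB" "j' < db b'" "offB b' + j' < e" for b' j' using m6[OF that] keep_mem[OF k, of 6] by simp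
      qed
      moreover have "pot2 s' + t < pot2 s" using t b by (simp add: pot2_def r' r)
      ultimately show "inv2 s' \<and> pot2 s' + t < pot2 s" by blast
    qed
  qed
qed

definition pre2 :: "state \<Rightarrow> bool" where
  "pre2 s \<longleftrightarrow> pre1 s \<and> (\<forall>a b. (a, b) \<in> edges G \<longrightarrow> mem s 6 (a * nB + b) = rb b a)"

lemma pre2_keep: "pre2 s \<Longrightarrow> keep D s s' \<Longrightarrow> D \<inter> {0, Suc 0, 2, 3, 4, 5, 6, 7} = {} \<Longrightarrow> pre2 s'"
  unfolding pre2_def using pre1_keep[of s D s'] keep_mem[of D s s' 6] by auto

definition loop2 :: prog where
  "loop2 = block [Assign 2 (Opd (Num 0)), Assign 3 (Opd (Num 0)), While (Less (Reg 2) (Reg 1)) body2]"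

lemma loop2:
  assumes p: "pre1 s" "fresh 8 s"
  shows "wp W loop2 (\<lambda>t s'. t \<le> 20 * input_size G + 3 \<and> pre2 s' \<and> fresh 8 s') s"
proof -
  define s1 where "s1 = set_reg 3 0 (set_reg 2 0 s)"
  have k: "keep {} s s1" by (simp add: keep_def s1_def)
  have r0: "reg s1 2 = 0" "reg s1 3 = 0" by (simp_all add: s1_def)
  have "pre1 s1" by (rule pre1_keep[OF p(1) k]) simp
  moreover have "fresh 8 s1" by (rule fresh_keep[OF p(2) k]) simp
  ultimately have I0: "inv2 s1" unfolding inv2_def r0 by (simp add: offB_0)
  have pot: "pot2 s1 \<le> 20 * input_size G" using size offB_nB by (simp add: pot2_def r0)
  have "wp W (While (Less (Reg 2) (Reg 1)) body2)
      (\<lambda>t s'. inv2 s' \<and> \<not> test_val (Less (Reg 2) (Reg 1)) s' \<and> t \<le> Suc (pot2 s1)) s1"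
    by (rule wp_While[of inv2, OF body2 I0])
  then have "wp W (While (Less (Reg 2) (Reg 1)) body2)
      (\<lambda>t s'. 2 + t \<le> 20 * input_size G + 3 \<and> pre2 s' \<and> fresh 8 s') s1"
  proof (rule wp_mono, elim conjE)
    fix t s' assume I: "inv2 s'" and n: "\<not> test_val (Less (Reg 2) (Reg 1)) s'" and t: "t \<le> Suc (pot2 s1)"
    have pre: "pre1 s'" and z: "fresh 8 s'" using I by (simp_all add: inv2_def)
    then have inp: "inp s'" by (simp add: pre1_def)
    have r: "reg s' 2 = nB" "reg s' 3 = offB nB" using I n inp_reg[OF inp] by (auto simp: inv2_def)
    have less: "offB b + j < offB nB" if "b < nB" "j < db b" for b j
      using offB_mono[of "Suc b" nB] that by (simp add: offB_Suc)
    have m6: "mem s' 6 (job_ranking G b ! j * nB + b) = j" if "b < nB" "j < db b" for b j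
      using I r that less[OF that] unfolding inv2_def by simp
    have "mem s' 6 (a * nB + b) = rb b a" if e: "(a, b) \<in> edges G" for a b
      using m6[of b "rb b a"] edge_vertices[OF e] rb_less[OF e] nth_rb[OF e] by simp
    then show "2 + t \<le> 20 * input_size G + 3 \<and> pre2 s' \<and> fresh 8 s'"
      using pre z t pot by (simp add: pre2_def)
  qed
  then show ?thesis
    unfolding loop2_def by (simp add: wp_simps s1_def)
qed

lemma sr_eq:
  assumes "i \<le> da a" "\<And>j. j < i \<Longrightarrow> agent_ranking G a ! j \<in> fjobs"
    "i < da a \<Longrightarrow> agent_ranking G a ! i \<notin> fjobs"
  shows "sr a = i"
proof -
  have "takeWhile (\<lambda>b. b \<in> fjobs) (agent_ranking G a) = take i (agent_ranking G a)"
    using assms by (intro takeWhile_eq_take_P_nth) (auto simp: da_def)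
  then show ?thesis using assms(1) by (simp add: sr_def da_def)
qed

text \<open>Register 7 is 1 only if the list has not ended and the current job is a first choice.
  Otherwise the position is \<open>sr\<close>, and the rest of the list is skipped.\<close>

definition body3 :: prog where
  "body3 = block [
     Assign 8 (Add (Reg 2) (Num 1)), Assign 5 (Load 0 (Reg 8)), Assign 9 (Load 0 (Reg 2)), Assign 7 (Opd (Num 0)),
     Cond (Less (Reg 3) (Reg 5)) (block [Assign 6 (Load 1 (Reg 3)), Assign 7 (Load 7 (Reg 6))]) Skip,
     Cond (Equal (Reg 7) (Num 1)) (Assign 3 (Add (Reg 3) (Num 1)))
       (block [Assign 10 (Sub (Reg 3) (Reg 9)), Store 8 (Reg 2) (Reg 10), Assign 2 (Opd (Reg 8)),
          Assign 3 (Opd (Reg 5))])]"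

definition inv3 :: "state \<Rightarrow> bool" where
  "inv3 s \<longleftrightarrow> pre2 s \<and> fresh 9 s \<and> reg s 2 \<le> nA \<and>
     offA (reg s 2) \<le> reg s 3 \<and> reg s 3 \<le> offA nA \<and> (reg s 2 < nA \<longrightarrow> reg s 3 \<le> offA (Suc (reg s 2))) \<and>
     (\<forall>i. reg s 2 < nA \<longrightarrow> offA (reg s 2) + i < reg s 3 \<longrightarrow> agent_ranking G (reg s 2) ! i \<in> fjobs) \<and>
     (\<forall>a<reg s 2. mem s 8 a = sr a)"

definition pot3 :: "state \<Rightarrow> nat" where
  "pot3 s = 20 * ((offA nA - reg s 3) + (nA - reg s 2))"

lemma body3:
  assumes I: "inv3 s" and t: "test_val (Less (Reg 2) (Reg 0)) s"
  shows "wp W body3 (\<lambda>t s'. inv3 s' \<and> pot3 s' + t < pot3 s) s"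
proof -
  define a e where "a = reg s 2" and "e = reg s 3"
  have r: "reg s 2 = a" "reg s 3 = e" by (simp_all add: a_def e_def)
  have pre: "pre2 s" and e: "offA a \<le> e" "e \<le> offA nA"
    and m8: "\<And>a'. a' < a \<Longrightarrow> mem s 8 a' = sr a'"
    and F: "\<And>i. a < nA \<Longrightarrow> offA a + i < e \<Longrightarrow> agent_ranking G a ! i \<in> fjobs"
    and z: "fresh 9 s"
    using I unfolding inv3_def r by blast+
  have inp: "inp s" and m7: "\<And>b. mem s 7 b = (if b \<in> fjobs then 1 else 0)"
    using pre by (simp_all add: pre2_def pre1_def)
  note ir = inp_reg[OF inp]
  have a: "a < nA" using t ir r by simp
  have e': "e \<le> offA (Suc a)" using I a unfolding inv3_def r by blast
  have ld: "mem s 0 (Suc a) = offA (Suc a)" "mem s 0 a = offA a" using inp_mem(1)[OF inp] a by simp_all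
  have bounds: "Suc a \<le> W" "offA (Suc a) \<le> W" "offA a \<le> W" "Suc e \<le> W" "Suc 0 \<le> W" "a \<le> W" "e - offA a \<le> W"
    using a e offA_le[of a] offA_le[of "Suc a"] offA_nA by (auto intro!: W_small)
  have pot: "pot3 s = 20 * ((offA nA - e) + (nA - a))" by (simp add: pot3_def r)
  define i b where "i = e - offA a" and "b = agent_ranking G a ! i"
  have i: "e = offA a + i" "i \<le> da a" using e(1) e' by (simp_all add: i_def offA_Suc)
  have lt: "e < offA (Suc a) \<longleftrightarrow> i < da a" using i by (simp add: offA_Suc)
  have lb: "mem s (Suc 0) e = b" "b \<le> W" if "i < da a"
    using inp_mem(3)[OF inp a that] i(1) list_bounds(1)[OF a that] by (auto simp: b_def intro!: W_small)
  show ?thesis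
  proof (cases "i < da a \<and> b \<in> fjobs")
    case True
    have Ei: "Suc e \<le> offA nA" using True lt offA_mono[of "Suc a" nA] a by simp
    have "wp W body3 (\<lambda>t s'. t \<le> 15 \<and> keep {} s s' \<and> reg s' 2 = a \<and> reg s' 3 = Suc e) s"
      unfolding body3_def using bounds lb True lt
      by (simp add: wp_simps r ir ld m7 keep_def)
    then show ?thesis
    proof (rule wp_mono, elim conjE)
      fix t :: nat and s' assume t: "t \<le> 15" and k: "keep {} s s'" and r': "reg s' 2 = a" "reg s' 3 = Suc e"
      have "inv3 s'"
        unfolding inv3_def r'
      proof (intro conjI allI impI)
        show "pre2 s'" by (rule pre2_keep[OF pre k]) simp
        show "fresh 9 s'" by (rule fresh_keep[OF z k]) auto
        show "a \<le> nA" "offA a \<le> Suc e" "Suc e \<le> offA nA" using a e Ei by simp_all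
        show "Suc e \<le> offA (Suc a)" using True lt by simp
        show "agent_ranking G a ! i' \<in> fjobs" if "a < nA" "offA a + i' < Suc e" for i'
          using F[of i'] that i True by (cases "i' = i") (auto simp: b_def)
        show "mem s' 8 a' = sr a'" if "a' < a" for a' using m8[OF that] keep_mem[OF k, of 8] by simp
      qed
      moreover have "pot3 s' + t < pot3 s" using t Ei by (simp add: pot3_def r' r)
      ultimately show "inv3 s' \<and> pot3 s' + t < pot3 s" by blast
    qed
  next
    case False
    have sr: "sr a = i" by (rule sr_eq) (use i F a False b_def in auto)
    have ie: "e - offA a = i" using i by simp
    have "wp W body3 (\<lambda>t s'. t \<le> 15 \<and> keep {8} s s' \<and> reg s' 2 = Suc a \<and> reg s' 3 = offA (Suc a) \<and>
        mem s' 8 = (mem s 8)(a := i)) s"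
    proof (cases "i < da a")
      case True
      then show ?thesis
        unfolding body3_def using bounds lb False lt
        by (simp add: wp_simps r ir ld m7 keep_def ie)
    next
      case f2: False
      then show ?thesis
        unfolding body3_def using bounds lt
        by (simp add: wp_simps r ir ld m7 keep_def ie)
    qed
    then show ?thesis
    proof (rule wp_mono, elim conjE)
      fix t :: nat and s' assume t: "t \<le> 15" and k: "keep {8} s s'" and r': "reg s' 2 = Suc a" "reg s' 3 = offA (Suc a)"
        and n8: "mem s' 8 = (mem s 8)(a := i)"
      have le: "offA (Suc a) \<le> offA nA" using offA_mono[of "Suc a" nA] a by simp
      have "inv3 s'"
        unfolding inv3_def r'
      proof (intro conjI allI impI)
        show "pre2 s'" by (rule pre2_keep[OF pre k]) simp
        show "fresh 9 s'" by (rule fresh_keep[OF z k]) auto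
        show "Suc a \<le> nA" "offA (Suc a) \<le> offA (Suc a)" "offA (Suc a) \<le> offA nA" using a le by simp_all
        show "offA (Suc a) \<le> offA (Suc (Suc a))" using offA_mono[of "Suc a" "Suc (Suc a)"] by simp
        show "agent_ranking G (Suc a) ! i' \<in> fjobs" if "Suc a < nA" "offA (Suc a) + i' < offA (Suc a)" for i'
          using that by simp
        show "mem s' 8 a' = sr a'" if "a' < Suc a" for a' using m8[of a'] that sr by (auto simp: n8 less_Suc_eq)
      qed
      moreover have "pot3 s' + t < pot3 s" using t a e' by (simp add: pot3_def r' r)
      ultimately show "inv3 s' \<and> pot3 s' + t < pot3 s" by blast
    qed
  qed
qed

definition pre3 :: "state \<Rightarrow> bool" where
  "pre3 s \<longleftrightarrow> pre2 s \<and> (\<forall>a<nA. mem s 8 a = sr a)"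

lemma pre3_keep: "pre3 s \<Longrightarrow> keep D s s' \<Longrightarrow> (\<And>d. d \<in> D \<Longrightarrow> 8 < d) \<Longrightarrow> pre3 s'"
  unfolding pre3_def using pre2_keep[of s D s'] keep_mem[of D s s' 8] by fastforce

definition loop3 :: prog where
  "loop3 = block [Assign 2 (Opd (Num 0)), Assign 3 (Opd (Num 0)), While (Less (Reg 2) (Reg 0)) body3]"

lemma loop3:
  assumes p: "pre2 s" "fresh 8 s"
  shows "wp W loop3 (\<lambda>t s'. t \<le> 20 * input_size G + 3 \<and> pre3 s' \<and> fresh 9 s') s"
proof -
  define s1 where "s1 = set_reg 3 0 (set_reg 2 0 s)"
  have k: "keep {} s s1" by (simp add: keep_def s1_def)
  have r0: "reg s1 2 = 0" "reg s1 3 = 0" by (simp_all add: s1_def)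
  have "pre2 s1" by (rule pre2_keep[OF p(1) k]) simp
  moreover have "fresh 9 s1" using p(2) by (simp add: fresh_def s1_def)
  ultimately have I0: "inv3 s1" unfolding inv3_def r0 by (simp add: offA_0)
  have pot: "pot3 s1 \<le> 20 * input_size G" using size offA_nA by (simp add: pot3_def r0)
  have "wp W (While (Less (Reg 2) (Reg 0)) body3)
      (\<lambda>t s'. inv3 s' \<and> \<not> test_val (Less (Reg 2) (Reg 0)) s' \<and> t \<le> Suc (pot3 s1)) s1"
    by (rule wp_While[of inv3, OF body3 I0])
  then have "wp W (While (Less (Reg 2) (Reg 0)) body3)
      (\<lambda>t s'. 2 + t \<le> 20 * input_size G + 3 \<and> pre3 s' \<and> fresh 9 s') s1"
  proof (rule wp_mono, elim conjE)
    fix t s' assume I: "inv3 s'" and n: "\<not> test_val (Less (Reg 2) (Reg 0)) s'" and t: "t \<le> Suc (pot3 s1)"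
    have pre: "pre2 s'" and z: "fresh 9 s'" using I by (simp_all add: inv3_def)
    then have inp: "inp s'" by (simp add: pre1_def pre2_def)
    have "reg s' 2 = nA" using I n inp_reg[OF inp] by (auto simp: inv3_def)
    then have "\<forall>a<nA. mem s' 8 a = sr a" using I by (simp add: inv3_def)
    then show "2 + t \<le> 20 * input_size G + 3 \<and> pre3 s' \<and> fresh 9 s'"
      using pre z t pot by (simp add: pre3_def)
  qed
  then show ?thesis
    unfolding loop3_def by (simp add: wp_simps s1_def)
qed

subsection \<open>The stable matching\<close>

definition gof :: "state \<Rightarrow> gs" where
  "gof s = \<lparr>cur = mem s 9, sb = mem s 10, gx = reg s 3, gi = reg s 2\<rparr>"

definition propose :: prog where
  "propose = block [
     Assign 4 (Sub (Reg 3) (Num 1)), Assign 5 (Load 0 (Reg 4)), Assign 6 (Add (Reg 4) (Num 1)),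
     Assign 6 (Load 0 (Reg 6)), Assign 7 (Load 9 (Reg 4)), Assign 8 (Sub (Reg 6) (Reg 5)),
     Cond (Less (Reg 7) (Reg 8))
       (block [Assign 9 (Add (Reg 5) (Reg 7)), Assign 10 (Load 1 (Reg 9)), Assign 12 (Load 10 (Reg 10)),
          Cond (Equal (Reg 12) (Num 0))
            (block [Store 10 (Reg 10) (Reg 3), Assign 3 (Opd (Num 0))])
            (block [Assign 13 (Load 4 (Reg 4)), Assign 13 (Add (Reg 13) (Reg 10)), Assign 13 (Load 6 (Reg 13)),
               Assign 14 (Sub (Reg 12) (Num 1)), Assign 15 (Load 4 (Reg 14)),
               Assign 15 (Add (Reg 15) (Reg 10)), Assign 15 (Load 6 (Reg 15)),
               Cond (Less (Reg 13) (Reg 15))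
                 (block [Store 10 (Reg 10) (Reg 3), Assign 3 (Opd (Reg 12)), Assign 16 (Load 9 (Reg 14)),
                    Assign 16 (Add (Reg 16) (Num 1)), Store 9 (Reg 14) (Reg 16)])
                 (block [Assign 7 (Add (Reg 7) (Num 1)), Store 9 (Reg 4) (Reg 7)])])])
       (Assign 3 (Opd (Num 0)))]"

text \<open>Deciding \<open>gs_finished\<close> takes two comparisons, while a loop tests only one.
  So register 11 is the loop flag, and one extra iteration clears it.\<close>

definition body4 :: prog where
  "body4 = Cond (Equal (Reg 3) (Num 0))
     (Cond (Less (Reg 2) (Reg 0))
        (block [Assign 2 (Add (Reg 2) (Num 1)), Assign 3 (Opd (Reg 2))])
        (Assign 11 (Opd (Num 0))))
     propose"

lemma pre3D:
  assumes "pre3 s"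
  shows "inp s" "a < nA \<Longrightarrow> mem s 4 a = a * nB" "(a, b) \<in> edges G \<Longrightarrow> mem s 5 (a * nB + b) = ra a b"
    "(a, b) \<in> edges G \<Longrightarrow> mem s 6 (a * nB + b) = rb b a" "a < nA \<Longrightarrow> mem s 8 a = sr a"
  using assms by (simp_all add: pre3_def pre2_def pre1_def)

lemma body4:
  assumes pre: "pre3 s" and I: "gs_inv (gof s)" and nf: "\<not> gs_finished (gof s)"
  shows "wp W body4 (\<lambda>t s'. t \<le> 40 \<and> keep {9, 10} s s' \<and> gof s' = gs_step (gof s) \<and> reg s' 11 = reg s 11) s"
proof -
  have inp: "inp s" using pre3D(1)[OF pre] .
  note ir = inp_reg[OF inp]
  define g where "g = gof s"
  have gs: "cur g = mem s 9" "sb g = mem s 10" "gx g = reg s 3" "gi g = reg s 2" by (simp_all add: g_def gof_def)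
  note I = I[folded g_def]
  have gil: "reg s 2 \<le> nA" "reg s 3 \<le> reg s 2" using gs_invD(1,2)[OF I] by (simp_all add: gs)
  show ?thesis
  proof (cases "reg s 3 = 0")
    case True
    then have lt: "reg s 2 < nA" using nf gs by (simp add: gs_finished_def g_def)
    have "Suc (reg s 2) \<le> W" using lt by (intro W_small) simp
    then show ?thesis using True lt
      by (simp add: body4_def wp_simps ir keep_def gof_def gs_step_def)
  next
    case False
    define a where "a = reg s 3 - 1"
    have r3: "reg s 3 = Suc a" using False by (simp add: a_def)
    have a: "a < nA" using gil r3 by simp
    have ld: "mem s 0 (Suc a) = offA a + da a" "mem s 0 a = offA a"
      using inp_mem(1)[OF inp] a by (simp_all add: offA_Suc)
    have cl: "mem s 9 a \<le> da a" using gs_invD(3)[OF I a] by (simp add: gs)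
    have bounds: "Suc a \<le> W" "a \<le> W" "offA a + da a \<le> W" "offA a \<le> W" "da a \<le> W" "mem s 9 a \<le> W"
      using a offA_le[of "Suc a"] cl by (auto intro!: W_small simp: offA_Suc)
    show ?thesis
    proof (cases "mem s 9 a = da a")
      case True
      then show ?thesis using bounds
        by (simp add: body4_def propose_def wp_simps ir r3 ld keep_def gof_def gs_step_def)
    next
      case nd: False
      then have lt: "mem s 9 a < da a" using cl by simp
      define k b where "k = mem s 9 a" and "b = agent_ranking G a ! k"
      have k: "k < da a" "mem s 9 a = k" using lt by (simp_all add: k_def)
      have lb: "mem s (Suc 0) (offA a + k) = b" using inp_mem(3)[OF inp a k(1)] by (simp add: b_def)
      have e: "(a, b) \<in> edges G" "ra a b = k" using agent_nth[of a k] a k by (auto simp: b_def)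
      have b: "b < nB" using edge_vertices[OF e(1)] by simp
      have bounds2: "b \<le> W" "offA a + k \<le> W" "Suc k \<le> W" "k \<le> W"
        using b k bounds da_le[OF a] by (auto intro: W_small)
      show ?thesis
      proof (cases "mem s 10 b = 0")
        case True
        then show ?thesis using bounds bounds2 k
          by (simp add: body4_def propose_def wp_simps ir r3 ld lb keep_def gof_def gs_step_def Let_def
              flip: b_def)
      next
        case sb: False
        define a' where "a' = mem s 10 b - 1"
        have sba: "mem s 10 b = Suc a'" using sb by (simp add: a'_def)
        have e': "(a', b) \<in> edges G" "mem s 9 a' = ra a' b"
          using gs_invD(4)[OF I b] sba by (simp_all add: gs)
        have a': "a' < nA" using edge_vertices[OF e'(1)] by simp
        have m4: "mem s 4 a = a * nB" "mem s 4 a' = a' * nB" using pre3D(2)[OF pre] a a' by auto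
        have m6: "mem s 6 (a * nB + b) = rb b a" "mem s 6 (a' * nB + b) = rb b a'"
          using pre3D(4)[OF pre] e e' by auto
        have bounds3: "a * nB + b \<le> W" "a' * nB + b \<le> W" "a * nB \<le> W" "a' * nB \<le> W"
          using W_index[of a b] W_index[of a' b] a a' b by auto
        have bounds4: "rb b a \<le> W" "rb b a' \<le> W" "Suc a' \<le> W" "a' \<le> W" "Suc (ra a' b) \<le> W" "ra a' b \<le> W"
          using rb_less[OF e(1)] rb_less[OF e'(1)] ra_less[OF e'(1)] db_le[OF b] da_le[OF a'] a'
          by (auto intro!: W_small)
        show ?thesis using bounds bounds2 bounds3 bounds4 k
          by (simp add: body4_def propose_def wp_simps ir r3 ld lb keep_def gof_def gs_step_def Let_def sba
              m4 m6 e' nd flip: b_def)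
      qed
    qed
  qed
qed

definition inv4 :: "state \<Rightarrow> bool" where
  "inv4 s \<longleftrightarrow> pre3 s \<and> fresh 11 s \<and> gs_inv (gof s) \<and>
     (reg s 11 = 1 \<or> reg s 11 = 0 \<and> gs_finished (gof s))"

text \<open>An iteration costs at most 40. The summand \<open>reg s 11\<close> pays for the one that
  merely clears the flag.\<close>

definition pot4 :: "state \<Rightarrow> nat" where
  "pot4 s = 50 * (gs_potential (gof s) + reg s 11)"

lemma body4_inv:
  assumes I: "inv4 s" and t: "test_val (Equal (Reg 11) (Num 1)) s"
  shows "wp W body4 (\<lambda>t s'. inv4 s' \<and> pot4 s' + t < pot4 s) s"
proof -
  have r: "reg s 11 = 1" using t by simp
  have pre: "pre3 s" and z: "fresh 11 s" and g: "gs_inv (gof s)" using I by (simp_all add: inv4_def)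
  show ?thesis
  proof (cases "gs_finished (gof s)")
    case False
    show ?thesis
    proof (rule wp_mono[OF body4[OF pre g False]], elim conjE)
      fix t :: nat and s' assume t: "t \<le> 40" and k: "keep {9, 10} s s'" and g': "gof s' = gs_step (gof s)"
        and r': "reg s' 11 = reg s 11"
      have "pre3 s'" by (rule pre3_keep[OF pre k]) auto
      moreover have "fresh 11 s'" by (rule fresh_keep[OF z k]) auto
      ultimately have "inv4 s'" using gs_step_inv[OF g False] r r' by (simp add: inv4_def g')
      moreover have "pot4 s' + t < pot4 s" using gs_step_potential[OF g False] t by (simp add: pot4_def g' r')
      ultimately show "inv4 s' \<and> pot4 s' + t < pot4 s" by blast
    qed
  next
    case True
    have inp: "inp s" using pre3D(1)[OF pre] .
    have f: "reg s 3 = 0" "\<not> reg s 2 < nA" using True by (simp_all add: gs_finished_def gof_def)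
    have "wp W body4 (\<lambda>t s'. t \<le> 40 \<and> keep {} s s' \<and> gof s' = gof s \<and> reg s' 11 = 0) s"
      using f by (simp add: body4_def wp_simps inp_reg[OF inp] keep_def gof_def)
    then show ?thesis
    proof (rule wp_mono, elim conjE)
      fix t :: nat and s' assume t: "t \<le> 40" and k: "keep {} s s'" and g': "gof s' = gof s" and r': "reg s' 11 = 0"
      have "pre3 s'" by (rule pre3_keep[OF pre k]) auto
      moreover have "fresh 11 s'" by (rule fresh_keep[OF z k]) auto
      ultimately have "inv4 s'" using g True r' by (simp add: inv4_def g')
      moreover have "pot4 s' + t < pot4 s" using t r by (simp add: pot4_def g' r')
      ultimately show "inv4 s' \<and> pot4 s' + t < pot4 s" by blast
    qed
  qed
qed

definition pre4 :: "(nat \<times> nat) set \<Rightarrow> state \<Rightarrow> bool" where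
  "pre4 S s \<longleftrightarrow> pre3 s \<and> agent_optimal G S \<and> (\<forall>a<nA. mem s 9 a = ka S a) \<and>
     (\<forall>b<nB. mem s 10 b \<le> nA \<and> (\<forall>a. (a, b) \<in> S \<longleftrightarrow> mem s 10 b = Suc a))"

lemma pre4_keep: "pre4 S s \<Longrightarrow> keep D s s' \<Longrightarrow> (\<And>d. d \<in> D \<Longrightarrow> 10 < d) \<Longrightarrow> pre4 S s'"
  unfolding pre4_def using pre3_keep[of s D s'] keep_mem[of D s s' 9] keep_mem[of D s s' 10] by fastforce

definition loop4 :: prog where
  "loop4 = block [Assign 2 (Opd (Num 0)), Assign 3 (Opd (Num 0)), Assign 11 (Opd (Num 1)),
     While (Equal (Reg 11) (Num 1)) body4]"

lemma loop4:
  assumes p: "pre3 s" "fresh 9 s"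
  shows "wp W loop4 (\<lambda>t s'. t \<le> 100 * input_size G + 60 \<and> (\<exists>S. pre4 S s') \<and> fresh 11 s') s"
proof -
  define s1 where "s1 = set_reg 11 1 (set_reg 3 0 (set_reg 2 0 s))"
  have k: "keep {} s s1" by (simp add: keep_def s1_def)
  have "mem s 9 = (\<lambda>_. 0)" "mem s 10 = (\<lambda>_. 0)" using p(2) by (simp_all add: fresh_def)
  then have g: "gof s1 = gs_init" by (simp add: gof_def gs_init_def s1_def)
  have "pre3 s1" by (rule pre3_keep[OF p(1) k]) simp
  moreover have "fresh 11 s1" using p(2) by (simp add: fresh_def s1_def)
  ultimately have I0: "inv4 s1" using gs_init_inv by (simp add: inv4_def g) (simp add: s1_def)
  have pot: "pot4 s1 \<le> 100 * input_size G + 50"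
  proof -
    have "gs_potential gs_init = offA nA + 2 * nA"
      by (simp add: gs_potential_def gs_init_def offA_eq_sum agents_eq)
    moreover have "reg s1 11 = 1" by (simp add: s1_def)
    ultimately show ?thesis using size offA_nA by (simp add: pot4_def g)
  qed
  have one: "Suc 0 \<le> W" by (rule W_small) simp
  have "wp W (While (Equal (Reg 11) (Num 1)) body4)
      (\<lambda>t s'. inv4 s' \<and> \<not> test_val (Equal (Reg 11) (Num 1)) s' \<and> t \<le> Suc (pot4 s1)) s1"
    by (rule wp_While[of inv4, OF body4_inv I0])
  then have "wp W (While (Equal (Reg 11) (Num 1)) body4)
      (\<lambda>t s'. 3 + t \<le> 100 * input_size G + 60 \<and> (\<exists>S. pre4 S s') \<and> fresh 11 s') s1"
  proof (rule wp_mono, elim conjE)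
    fix t s' assume I: "inv4 s'" and n: "\<not> test_val (Equal (Reg 11) (Num 1)) s'" and t: "t \<le> Suc (pot4 s1)"
    have pre: "pre3 s'" and z: "fresh 11 s'" and gi: "gs_inv (gof s')" and f: "gs_finished (gof s')"
      using I n by (auto simp: inv4_def)
    note pr = gs_result_props[OF gi f]
    define S where "S = gs_result (gof s')"
    have c: "cur (gof s') = mem s' 9" "sb (gof s') = mem s' 10" by (simp_all add: gof_def)
    have "mem s' 10 b \<le> nA" if "b < nB" for b
      using gs_invD(4)[OF gi that] gs_invD(1)[OF gi] c by (cases "mem s' 10 b = 0") auto
    then have "pre4 S s'" using pre pr c by (simp add: pre4_def S_def)
    then show "3 + t \<le> 100 * input_size G + 60 \<and> (\<exists>S. pre4 S s') \<and> fresh 11 s'"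
      using t pot z by auto
  qed
  then show ?thesis
    unfolding loop4_def using one by (simp add: wp_simps s1_def)
qed

text \<open>Used for arrays 16 and 18: in the beginning all jobs have to move and all agents lack a
  partner, so both stacks contain everybody.\<close>

definition fill_body :: "nat \<Rightarrow> prog" where
  "fill_body d = block [Store d (Reg 2) (Reg 2), Assign 2 (Add (Reg 2) (Num 1))]"

definition fill :: "nat \<Rightarrow> nat \<Rightarrow> prog" where
  "fill d r = block [Assign 2 (Opd (Num 0)), While (Less (Reg 2) (Reg r)) (fill_body d)]"

lemma fill:
  assumes r: "r = 0 \<and> n = nA \<or> r = Suc 0 \<and> n = nB" and inp: "inp s" and d: "3 < d"
  shows "wp W (fill d r) (\<lambda>t s'. t \<le> 5 * n + 2 \<and> keep {d} s s' \<and> (\<forall>i<n. mem s' d i = i)) s"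
proof -
  define I where "I s' \<longleftrightarrow> keep {d} s s' \<and> reg s' 2 \<le> n \<and> (\<forall>i<reg s' 2. mem s' d i = i)" for s' :: state
  define f where "f s' = 5 * (n - reg s' 2)" for s' :: state
  define s1 where "s1 = set_reg 2 0 s"
  have I0: "I s1" by (simp add: I_def s1_def keep_def)
  have rn: "reg s r = n" using r inp_reg[OF inp] by auto
  have step: "wp W (fill_body d) (\<lambda>t s2. I s2 \<and> f s2 + t < f s') s'"
    if h: "I s'" "test_val (Less (Reg 2) (Reg r)) s'" for s'
  proof -
    have "reg s' r = n" using h(1) r rn by (auto simp: I_def keep_def)
    then have lt: "reg s' 2 < n" using h(2) by simp
    then have "Suc (reg s' 2) \<le> W" using r by (intro W_small) auto
    then show ?thesis using h(1) lt d
      by (auto simp: fill_body_def wp_simps I_def f_def keep_def less_Suc_eq)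
  qed
  have "wp W (While (Less (Reg 2) (Reg r)) (fill_body d))
      (\<lambda>t s'. I s' \<and> \<not> test_val (Less (Reg 2) (Reg r)) s' \<and> t \<le> Suc (f s1)) s1"
    by (rule wp_While[of I, OF step I0])
  then have "wp W (While (Less (Reg 2) (Reg r)) (fill_body d))
      (\<lambda>t s'. Suc t \<le> 5 * n + 2 \<and> keep {d} s s' \<and> (\<forall>i<n. mem s' d i = i)) s1"
  proof (rule wp_mono, elim conjE)
    fix t s' assume h: "I s'" "\<not> test_val (Less (Reg 2) (Reg r)) s'" and t: "t \<le> Suc (f s1)"
    have "reg s' r = n" using h(1) r rn by (auto simp: I_def keep_def)
    then have "reg s' 2 = n" using h by (auto simp: I_def)
    then show "Suc t \<le> 5 * n + 2 \<and> keep {d} s s' \<and> (\<forall>i<n. mem s' d i = i)"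
      using h t by (auto simp: I_def f_def s1_def)
  qed
  then show ?thesis unfolding fill_def by (simp add: wp_simps s1_def)
qed

end

section \<open>The job phase as a program\<close>

lemma wp_SeqI:
  "wp W p A s \<Longrightarrow> (\<And>t s1. A t s1 \<Longrightarrow> wp W q (\<lambda>t'. Q (t + t')) s1) \<Longrightarrow> wp W (Seq p q) Q s"
  unfolding wp_Seq by (rule wp_mono)

text \<open>The top of the stack is cell \<open>n - 1\<close>, hence the reversal. A push writes
  cell \<open>n\<close>, which by \<open>stk_upd\<close> does not affect the stack below.\<close>

definition stk :: "(nat \<Rightarrow> nat) \<Rightarrow> nat \<Rightarrow> nat list" where
  "stk f n = map f (rev [0..<n])"

lemma stk_simps [simp]: "stk f 0 = []" "stk f (Suc n) = f n # stk f n" "length (stk f n) = n"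
  by (simp_all add: stk_def)

lemma stk_upd [simp]: "n \<le> i \<Longrightarrow> stk (f(i := x)) n = stk f n"
  by (simp add: stk_def)

lemma stk_Nil_iff [simp]: "stk f n = [] \<longleftrightarrow> n = 0"
  by (simp add: stk_def)

locale job_program = ram G W + job_phase G S for G W S
begin

definition rep :: "state \<Rightarrow> mach \<Rightarrow> bool" where
  "rep s m \<longleftrightarrow> mem s 11 = P m \<and> mem s 12 = v m \<and> mem s 13 = hold m \<and> mem s 14 = sat m \<and>
     mem s 15 = flag m \<and> jst m = stk (mem s 16) (reg s 5) \<and> zst m = stk (mem s 17) (reg s 6) \<and>
     cst m = stk (mem s 18) (reg s 7) \<and> reg s 2 = zc m \<and> reg s 3 = zi m \<and> reg s 4 = ze m"

text \<open>In the job phase, registers from 20 on are scratch; the data of the run and the input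
  sizes live in registers below 20.\<close>

definition same :: "state \<Rightarrow> state \<Rightarrow> bool" where
  "same s s' \<longleftrightarrow> mem s' = mem s \<and> (\<forall>r<20. reg s' r = reg s r)"

lemma rep_same: "rep s m \<Longrightarrow> same s s' \<Longrightarrow> rep s' m"
  by (simp add: rep_def same_def)

lemma keep_same: "same s s' \<Longrightarrow> keep D s s'"
  by (simp add: keep_def same_def)

lemma keep_trans: "keep D s s1 \<Longrightarrow> keep D' s1 s2 \<Longrightarrow> D \<subseteq> E \<Longrightarrow> D' \<subseteq> E \<Longrightarrow> keep E s s2"
  unfolding keep_def subset_iff by metis

definition release_p :: prog where
  "release_p = block [Assign 21 (Load 13 (Reg 20)),
     Cond (Equal (Reg 21) (Num 0)) Skip
       (block [Assign 21 (Sub (Reg 21) (Num 1)), Store 14 (Reg 21) (Num 0), Store 16 (Reg 5) (Reg 21),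
          Assign 5 (Add (Reg 5) (Num 1)), Store 13 (Reg 20) (Num 0), Store 18 (Reg 7) (Reg 20),
          Assign 7 (Add (Reg 7) (Num 1))])]"

lemma wp_release:
  assumes R: "rep s m" and c: "reg s 20 = c" "c \<le> W"
    and b: "hold m c \<le> W" "Suc (reg s 5) \<le> W" "Suc (reg s 7) \<le> W"
  shows "wp W release_p (\<lambda>t s'. t \<le> 12 \<and> rep s' (release c m) \<and> keep {13, 14, 16, 18} s s' \<and>
    (\<forall>r. r \<notin> {5, 7, 21} \<longrightarrow> reg s' r = reg s r)) s"
proof -
  note R = R[unfolded rep_def]
  show ?thesis
  proof (cases "hold m c")
    case 0
    then show ?thesis using R c b by (simp add: release_p_def wp_simps rep_def release_def keep_def)
  next
    case (Suc h)
    then show ?thesis using R c b by (simp add: release_p_def wp_simps rep_def release_def keep_def)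
  qed
qed

definition raise_p :: prog where
  "raise_p = block [Store 12 (Reg 20) (Reg 22),
     Cond (Equal (Reg 22) (Num 4)) (block [Store 17 (Reg 6) (Reg 20), Assign 6 (Add (Reg 6) (Num 1))]) Skip]"

definition lift_p :: prog where
  "lift_p = Seq (Assign 23 (Load 12 (Reg 20)))
     (Cond (Less (Reg 23) (Reg 22)) (Seq raise_p release_p) Skip)"

lemma wp_lift:
  assumes R: "rep s m" and c: "reg s 20 = c" "c \<le> W" and w: "reg s 22 = w" "w \<le> W"
    and b: "hold m c \<le> W" "Suc (reg s 5) \<le> W" "Suc (reg s 6) \<le> W" "Suc (reg s 7) \<le> W" "v m c \<le> W"
  shows "wp W lift_p (\<lambda>t s'. t \<le> 25 \<and> rep s' (lift_to c w m) \<and> keep {12, 13, 14, 16, 17, 18} s s' \<and>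
    (\<forall>r. r \<notin> {5, 6, 7, 21, 23} \<longrightarrow> reg s' r = reg s r)) s"
proof -
  define s1 where "s1 = set_reg 23 (v m c) s"
  have R1: "rep s1 m" and k1: "keep {} s s1" and r1: "\<And>r. r \<noteq> 23 \<Longrightarrow> reg s1 r = reg s r" "reg s1 23 = v m c"
    using R by (simp_all add: rep_def s1_def keep_def)
  have m12: "mem s 12 = v m" using R by (simp add: rep_def)
  show ?thesis
  proof (cases "v m c < w")
    case False
    then show ?thesis
      using R1 k1 r1 c w b m12 unfolding s1_def
      by (simp add: lift_p_def wp_simps lift_to_def keep_def)
  next
    case True
    define m2 where "m2 = m\<lparr>v := (v m)(c := w), zst := (if w = 4 then c # zst m else zst m)\<rparr>"
    have raise: "wp W raise_p (\<lambda>t s2. t \<le> 5 \<and> rep s2 m2 \<and> keep {12, 17} s s2 \<and>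
        (\<forall>r. r \<notin> {6, 23} \<longrightarrow> reg s2 r = reg s r)) s1"
      using R c w b by (simp add: raise_p_def wp_simps rep_def m2_def keep_def s1_def)
    have "wp W (Seq raise_p release_p) (\<lambda>t s'. t \<le> 20 \<and> rep s' (lift_to c w m) \<and>
        keep {12, 13, 14, 16, 17, 18} s s' \<and> (\<forall>r. r \<notin> {5, 6, 7, 21, 23} \<longrightarrow> reg s' r = reg s r)) s1"
    proof (rule wp_SeqI[OF raise], elim conjE)
      fix t :: nat and s2 assume t: "t \<le> 5" and R2: "rep s2 m2" and k2: "keep {12, 17} s s2"
        and r2: "\<forall>r. r \<notin> {6, 23} \<longrightarrow> reg s2 r = reg s r"
      have "wp W release_p (\<lambda>t s'. t \<le> 12 \<and> rep s' (release c m2) \<and> keep {13, 14, 16, 18} s2 s' \<and>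
        (\<forall>r. r \<notin> {5, 7, 21} \<longrightarrow> reg s' r = reg s2 r)) s2"
        by (rule wp_release[OF R2]) (use r2 c b in \<open>simp_all add: m2_def\<close>)
      then show "wp W release_p (\<lambda>t' s'. t + t' \<le> 20 \<and> rep s' (lift_to c w m) \<and>
          keep {12, 13, 14, 16, 17, 18} s s' \<and> (\<forall>r. r \<notin> {5, 6, 7, 21, 23} \<longrightarrow> reg s' r = reg s r)) s2"
      proof (rule wp_mono, elim conjE, intro conjI)
        fix t' :: nat and s' assume h: "t' \<le> 12" "rep s' (release c m2)" "keep {13, 14, 16, 18} s2 s'"
          "\<forall>r. r \<notin> {5, 7, 21} \<longrightarrow> reg s' r = reg s2 r"
        show "t + t' \<le> 20" using t h(1) by simp
        show "rep s' (lift_to c w m)" using h(2) True by (simp add: lift_to_def m2_def)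
        show "keep {12, 13, 14, 16, 17, 18} s s'" by (rule keep_trans[OF k2 h(3)]) auto
        show "\<forall>r. r \<notin> {5, 6, 7, 21, 23} \<longrightarrow> reg s' r = reg s r" using h(4) r2 by simp
      qed
    qed
    then have "wp W (Seq raise_p release_p) (\<lambda>t s'. Suc (Suc t) \<le> 25 \<and> rep s' (lift_to c w m) \<and>
        keep {12, 13, 14, 16, 17, 18} s s' \<and> (\<forall>r. r \<notin> {5, 6, 7, 21, 23} \<longrightarrow> reg s' r = reg s r)) s1"
      by (rule wp_mono) simp
    then show ?thesis
      using True c w b m12 unfolding s1_def
      by (simp add: lift_p_def wp_simps(2) wp_Seq[of W "Assign 23 (Load 12 (Reg 20))"] wp_Cond)
  qed
qed

definition seat_p :: prog where
  "seat_p = block [Assign 37 (Add (Reg 24) (Num 1)), Store 13 (Reg 20) (Reg 37),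
     Assign 37 (Add (Reg 20) (Num 1)), Store 14 (Reg 24) (Reg 37)]"

lemma wp_seat:
  assumes R: "rep s m" and r: "reg s 20 = c" "reg s 24 = b" "Suc c \<le> W" "Suc b \<le> W"
  shows "wp W seat_p (\<lambda>t s'. t \<le> 5 \<and> rep s' (seat b c m) \<and> keep {13, 14} s s' \<and>
    (\<forall>r. r \<noteq> 37 \<longrightarrow> reg s' r = reg s r)) s"
  using R r by (simp add: seat_p_def wp_simps rep_def seat_def keep_def)

abbreviation (input) "cells \<equiv> {11, 12, 13, 14, 15, 16, 17, 18 :: nat}"

definition room :: "state \<Rightarrow> bool" where
  "room s \<longleftrightarrow> Suc (reg s 5) \<le> W \<and> Suc (reg s 6) \<le> W \<and> Suc (reg s 7) \<le> W"

lemma wp_lift_seat: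
  assumes R: "rep s m" and r: "reg s 20 = c" "reg s 24 = b" "reg s 22 = w" "Suc c \<le> W" "Suc b \<le> W" "w \<le> W"
    and b: "hold m c \<le> W" "v m c \<le> W" and room: "room s"
  shows "wp W (Seq lift_p seat_p) (\<lambda>t s'. t \<le> 30 \<and> rep s' (seat b c (lift_to c w m)) \<and> keep cells s s' \<and>
    reg s' 8 = reg s 8 \<and> reg s' 9 = reg s 9) s"
proof -
  have "wp W lift_p (\<lambda>t s'. t \<le> 25 \<and> rep s' (lift_to c w m) \<and> keep {12, 13, 14, 16, 17, 18} s s' \<and>
    (\<forall>r. r \<notin> {5, 6, 7, 21, 23} \<longrightarrow> reg s' r = reg s r)) s"
    by (rule wp_lift[OF R]) (use r b room in \<open>simp_all add: room_def\<close>)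
  then show ?thesis
  proof (rule wp_SeqI, elim conjE)
    fix t :: nat and s1 assume h: "t \<le> 25" "rep s1 (lift_to c w m)" "keep {12, 13, 14, 16, 17, 18} s s1"
      "\<forall>r. r \<notin> {5, 6, 7, 21, 23} \<longrightarrow> reg s1 r = reg s r"
    have "wp W seat_p (\<lambda>t s'. t \<le> 5 \<and> rep s' (seat b c (lift_to c w m)) \<and> keep {13, 14} s1 s' \<and>
        (\<forall>r. r \<noteq> 37 \<longrightarrow> reg s' r = reg s1 r)) s1"
      by (rule wp_seat[OF h(2)]) (use h(4) r in simp_all)
    then show "wp W seat_p (\<lambda>t' s'. t + t' \<le> 30 \<and> rep s' (seat b c (lift_to c w m)) \<and> keep cells s s' \<and>
        reg s' 8 = reg s 8 \<and> reg s' 9 = reg s 9) s1"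
    proof (rule wp_mono, elim conjE, intro conjI)
      fix t' :: nat and s' assume g: "t' \<le> 5" "rep s' (seat b c (lift_to c w m))" "keep {13, 14} s1 s'"
        "\<forall>r. r \<noteq> 37 \<longrightarrow> reg s' r = reg s1 r"
      show "t + t' \<le> 30" using h(1) g(1) by simp
      show "rep s' (seat b c (lift_to c w m))" by (rule g(2))
      show "keep cells s s'" by (rule keep_trans[OF h(3) g(3)]) auto
      show "reg s' 8 = reg s 8" "reg s' 9 = reg s 9" using g(4) h(4) by simp_all
    qed
  qed
qed

text \<open>The pieces of \<open>job_step\<close>, each of which gets its own postcondition.
  Register 24 holds the job \<open>b\<close> and 27 its position; from \<open>J2\<close> on, 20
  holds the agent \<open>c\<close>, 28 is 2 in the second traversal and 0 in the first, and 30 and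
  31 are \<open>ra c b\<close> and \<open>sr c\<close>. Then 32 says whether \<open>b\<close> is
  usable for \<open>c\<close>, 22 is the value \<open>w\<close>, and 35 and 38 select the
  branch.\<close>

definition J0 :: prog where
  "J0 = block [Assign 24 (Sub (Reg 5) (Num 1)), Assign 24 (Load 16 (Reg 24)), Assign 20 (Load 14 (Reg 24))]"
definition J1 :: prog where
  "J1 = block [Assign 27 (Load 11 (Reg 24)), Assign 21 (Load 2 (Reg 24)), Assign 22 (Add (Reg 24) (Num 1)),
     Assign 22 (Load 2 (Reg 22)), Assign 25 (Sub (Reg 22) (Reg 21)), Assign 26 (Add (Reg 25) (Reg 25))]"
definition J2 :: prog where
  "J2 = block [
     Cond (Less (Reg 27) (Reg 25)) (block [Assign 28 (Opd (Num 0)), Assign 29 (Opd (Reg 27))])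
       (block [Assign 28 (Opd (Num 2)), Assign 29 (Sub (Reg 27) (Reg 25))]),
     Assign 21 (Add (Reg 21) (Reg 29)), Assign 20 (Load 3 (Reg 21)), Assign 30 (Load 4 (Reg 20)),
     Assign 30 (Add (Reg 30) (Reg 24)), Assign 30 (Load 5 (Reg 30)), Assign 31 (Load 8 (Reg 20))]"
definition J3 :: prog where
  "J3 = block [Assign 32 (Opd (Num 0)), Assign 22 (Opd (Reg 28)),
     Cond (Less (Reg 30) (Reg 31)) (Assign 22 (Add (Reg 28) (Num 1))) Skip,
     Cond (Equal (Reg 30) (Num 0)) (Assign 32 (Opd (Num 1))) Skip,
     Cond (Equal (Reg 30) (Reg 31)) (Assign 32 (Opd (Num 1))) Skip]"
definition J4 :: prog where
  "J4 = block [Assign 33 (Load 12 (Reg 20)), Assign 34 (Load 15 (Reg 24)), Assign 35 (Opd (Num 0)),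
     Cond (Equal (Reg 34) (Num 0)) (Cond (Equal (Reg 32) (Num 1))
        (Cond (Less (Reg 22) (Reg 33)) Skip (Assign 35 (Opd (Num 1)))) Skip) Skip,
     Assign 36 (Load 10 (Reg 24)), Assign 37 (Add (Reg 20) (Num 1)), Assign 38 (Opd (Num 0)),
     Cond (Equal (Reg 28) (Num 2)) (Cond (Equal (Reg 36) (Reg 37)) (Assign 38 (Opd (Num 1))) Skip) Skip]"
definition Jsit :: prog where
  "Jsit = Seq (Assign 5 (Sub (Reg 5) (Num 1))) (Seq lift_p seat_p)"
definition Jzero :: prog where
  "Jzero = Cond (Equal (Reg 32) (Num 1))
     (Seq (block [Assign 5 (Sub (Reg 5) (Num 1)), Store 15 (Reg 24) (Num 1), Assign 22 (Opd (Num 4))])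
        (Seq lift_p seat_p))
     (block [Assign 8 (Opd (Num 0)), Assign 9 (Opd (Num 0))])"
definition Jadv :: prog where
  "Jadv = block [Assign 33 (Load 12 (Reg 20)),
     Cond (Equal (Reg 33) (Num 4))
       (Cond (Equal (Reg 28) (Num 2)) (Store 15 (Reg 24) (Num 1))
          (Cond (Less (Reg 30) (Reg 31))
             (block [Assign 39 (Load 9 (Reg 20)), Cond (Equal (Reg 39) (Num 0)) Skip (Store 15 (Reg 24) (Num 1))])
             Skip))
       Skip,
     Assign 27 (Add (Reg 27) (Num 1)), Store 11 (Reg 24) (Reg 27)]"
definition Jpass :: prog where
  "Jpass = Seq (Assign 22 (Add (Reg 22) (Reg 32))) (Seq lift_p Jadv)"
definition job_p :: prog where
  "job_p = Seq J0 (Cond (Equal (Reg 20) (Num 0))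
     (Seq J1 (Cond (Equal (Reg 27) (Reg 26))
        (block [Store 15 (Reg 24) (Num 1), Assign 5 (Sub (Reg 5) (Num 1))])
        (Seq J2 (Seq J3 (Seq J4 (Cond (Equal (Reg 35) (Num 1)) Jsit
           (Cond (Equal (Reg 38) (Num 1)) Jzero Jpass)))))))
     (Assign 5 (Sub (Reg 5) (Num 1))))"

lemma pre4D:
  assumes "pre4 S s"
  shows "pre3 s" "a < nA \<Longrightarrow> mem s 9 a = ka S a" "b < nB \<Longrightarrow> mem s 10 b \<le> nA"
    "b < nB \<Longrightarrow> (a, b) \<in> S \<longleftrightarrow> mem s 10 b = Suc a"
  using assms by (simp_all add: pre4_def)

lemma cell_bounds:
  assumes I: "inv {} m"
  shows "c < nA \<Longrightarrow> hold m c \<le> W" "c < nA \<Longrightarrow> v m c \<le> W" "b < nB \<Longrightarrow> sat m b \<le> W"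
    "b < nB \<Longrightarrow> Suc (P m b) \<le> W"
proof -
  show "hold m c \<le> W" if "c < nA"
    using invD(6)[OF I, of c] that by (cases "hold m c = 0") (auto intro!: W_small)
  show "v m c \<le> W" if "c < nA" using invD(10)[OF I, of c] that by (auto intro!: W_small)
  show "sat m b \<le> W" if "b < nB"
  proof (cases "sat m b = 0")
    case False
    then have "sits m b (sat m b - 1)" using invD(5)[OF I, of b] that by simp
    then have "sat m b - 1 < nA" using edge_vertices[of "sat m b - 1" b] by (simp add: sits_def)
    then show ?thesis by (intro W_small) simp
  qed simp
  show "Suc (P m b) \<le> W" if "b < nB"
    using invD(1)[OF I, of b] kb_le[OF S, of b] db_le[OF that] that by (intro W_small) simp
qed

text \<open>Register 8 is the verdict and register 9 the flag of the main loop. A step with outcome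
  \<open>None\<close> clears both.\<close>

abbreviation "step_post s om \<equiv> (\<lambda>(t :: nat) s'. t \<le> 100 \<and> keep cells s s' \<and>
   (case om of None \<Rightarrow> reg s' 8 = 0 \<and> reg s' 9 = 0
    | Some m' \<Rightarrow> rep s' m' \<and> reg s' 8 = reg s 8 \<and> reg s' 9 = reg s 9))"

lemma wp_job:
  assumes R: "rep s m" and pre: "pre4 S s" and I: "inv {} m" and ne: "jst m \<noteq> []"
    and fl: "\<And>b. flag m b \<le> 1" and room: "room s"
  shows "wp W job_p (step_post s (job_step m)) s"
proof -
  note R' = R[unfolded rep_def]
  have pre3: "pre3 s" using pre4D(1)[OF pre] .
  have inp: "inp s" using pre3D(1)[OF pre3] .
  define k where "k = reg s 5 - 1"
  have r5: "reg s 5 = Suc k" using ne R' by (auto simp: k_def)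
  define b where "b = mem s 16 k"
  have jst: "jst m = b # stk (mem s 16) k" using R' r5 by (simp add: b_def)
  have b: "b < nB" using invD(11)[OF I] jst by simp
  have hd: "hd (jst m) = b" by (simp add: jst)
  note cb = cell_bounds[OF I]
  have Wb: "Suc b \<le> W" "Suc 0 \<le> W" "4 \<le> W" "k \<le> W"
    using b room r5 by (auto simp: room_def intro!: W_small)
  have satW: "sat m b \<le> W" and PW: "Suc (P m b) \<le> W" using cb(3,4)[OF b] by auto
  have j0: "wp W J0 (\<lambda>t s'. t \<le> 4 \<and> same s s' \<and> reg s' 24 = b \<and> reg s' 20 = sat m b) s"
    using R' r5 Wb satW by (simp add: J0_def wp_simps same_def b_def[symmetric])
  show ?thesis
    unfolding job_p_def
  proof (rule wp_SeqI[OF j0], elim conjE)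
    fix t0 :: nat and s0 assume t0: "t0 \<le> 4" and sm0: "same s s0" and r0: "reg s0 24 = b" "reg s0 20 = sat m b"
    have R0: "rep s0 m" by (rule rep_same[OF R sm0])
    note R0' = R0[unfolded rep_def]
    have r50: "reg s0 5 = Suc k" "reg s0 8 = reg s 8" "reg s0 9 = reg s 9" "reg s0 0 = reg s 0"
      "reg s0 (Suc 0) = reg s (Suc 0)" "mem s0 = mem s" using sm0 r5 by (simp_all add: same_def)
    let ?rest = "Seq J1 (Cond (Equal (Reg 27) (Reg 26))
        (block [Store 15 (Reg 24) (Num 1), Assign 5 (Sub (Reg 5) (Num 1))])
        (Seq J2 (Seq J3 (Seq J4 (Cond (Equal (Reg 35) (Num 1)) Jsit
           (Cond (Equal (Reg 38) (Num 1)) Jzero Jpass))))))"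
    show "wp W (Cond (Equal (Reg 20) (Num 0)) ?rest (Assign 5 (Sub (Reg 5) (Num 1))))
        (\<lambda>t'. step_post s (job_step m) (t0 + t')) s0"
    proof (cases "sat m b = 0")
      case False
      then have js: "job_step m = Some (pop_job m)" by (simp add: job_step_def hd)
      have "rep (set_reg 5 k s0) (pop_job m)" using R0' jst r50 by (simp add: rep_def pop_job_def)
      then show ?thesis using False r0 r50 Wb t0 by (simp add: wp_Cond wp_Assign js keep_def)
    next
      case a0: True
      have ld: "mem s0 2 (Suc b) = offB b + db b" "mem s0 2 b = offB b"
        using inp_mem(2)[OF inp] b r50 by (simp_all add: offB_Suc)
      have Wd: "offB b + db b \<le> W" "offB b \<le> W" "db b \<le> W" "db b + db b \<le> W"
        using offB_le[of "Suc b"] db_le[OF b] b by (auto intro!: W_small simp: offB_Suc)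
      have j1: "wp W J1 (\<lambda>t s'. t \<le> 7 \<and> same s0 s' \<and> reg s' 24 = b \<and> reg s' 27 = P m b \<and> reg s' 21 = offB b \<and>
          reg s' 25 = db b \<and> reg s' 26 = db b + db b) s0"
        using R0' r0 ld Wd Wb PW by (simp add: J1_def wp_simps same_def)
      have "wp W ?rest (\<lambda>t'. step_post s (job_step m) (Suc (t0 + t'))) s0"
      proof (rule wp_SeqI[OF j1], elim conjE)
        fix t1 :: nat and s1 assume t1: "t1 \<le> 7" and sm1: "same s0 s1"
          and r1: "reg s1 24 = b" "reg s1 27 = P m b" "reg s1 21 = offB b" "reg s1 25 = db b" "reg s1 26 = db b + db b"
        have R1: "rep s1 m" by (rule rep_same[OF R0 sm1])
        note R1' = R1[unfolded rep_def]
        have r51: "reg s1 5 = Suc k" "reg s1 8 = reg s 8" "reg s1 9 = reg s 9" "reg s1 0 = reg s 0"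
          "reg s1 (Suc 0) = reg s (Suc 0)" "mem s1 = mem s" using sm1 r50 by (simp_all add: same_def)
        let ?rest1 = "Seq J2 (Seq J3 (Seq J4 (Cond (Equal (Reg 35) (Num 1)) Jsit
           (Cond (Equal (Reg 38) (Num 1)) Jzero Jpass))))"
        show "wp W (Cond (Equal (Reg 27) (Reg 26))
            (block [Store 15 (Reg 24) (Num 1), Assign 5 (Sub (Reg 5) (Num 1))]) ?rest1)
            (\<lambda>t'. step_post s (job_step m) (Suc (t0 + (t1 + t')))) s1"
        proof (cases "P m b = 2 * db b")
          case True
          then have js: "job_step m = Some (set_flag b (pop_job m))" using a0 by (simp add: job_step_def hd)
          have "rep (set_reg 5 k (set_mem 15 b (Suc 0) s1)) (set_flag b (pop_job m))"
            using R1' jst r51 by (simp add: rep_def pop_job_def set_flag_def)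
          then show ?thesis using True r1 r51 Wb t0 t1 
            by (simp add: wp_simps js keep_def mult_2)
        next
          case np: False
          define two where "two = (db b \<le> P m b)"
          define j where "j = (if two then P m b - db b else P m b)"
          define c where "c = job_ranking G b ! j"
          define w where "w = (if two then 2 else 0) + base c b"
          have bJ: "b \<in> jobs G" using b by simp
          note jf = job_facts[OF I bJ np two_def j_def c_def]
          note e = jf(1)
          have c: "c < nA" using edge_vertices[OF e] by simp
          have jl: "j < db b" using jf(2) rb_less[OF e] by simp
          have step: "job_step m = (if flag m b = 0 \<and> usable c b \<and> v m c \<le> w
              then Some (seat b c (lift_to c w (pop_job m)))
             else if two \<and> (c, b) \<in> S then
               (if usable c b then Some (seat b c (lift_to c 4 (set_flag b (pop_job m)))) else None)
             else Some (pass b c (w + (if usable c b then 1 else 0)) two m))"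
            using a0 np by (simp add: job_step_def hd two_def j_def c_def w_def Let_def)
          have lc: "mem s 3 (offB b + j) = c" using inp_mem(4)[OF inp b jl] by (simp add: c_def)
          have m4: "mem s 4 c = c * nB" and m5: "mem s 5 (c * nB + b) = ra c b" and m8: "mem s 8 c = sr c"
            using pre3D(2,3,5)[OF pre3] c e by auto
          have Wc: "c \<le> W" "Suc c \<le> W" "c * nB \<le> W" "c * nB + b \<le> W" "offB b + j \<le> W" "ra c b \<le> W" "sr c \<le> W"
            "j \<le> W" "2 \<le> W"
            using c b W_index[of c b] Wd jl ra_less[OF e] da_le[OF c] sr_le[of c] by (auto intro!: W_small)
          have j2: "wp W J2 (\<lambda>t s'. t \<le> 12 \<and> same s1 s' \<and> reg s' 24 = b \<and> reg s' 27 = P m b \<and> reg s' 20 = c \<and>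
              reg s' 28 = (if two then 2 else 0) \<and> reg s' 30 = ra c b \<and> reg s' 31 = sr c) s1"
          proof (cases two)
            case True
            then have "\<not> P m b < db b" "P m b - db b = j" by (auto simp: two_def j_def)
            then show ?thesis using r1 r51 lc m4 m5 m8 Wc True
              by (simp add: J2_def wp_simps same_def)
          next
            case False
            then have "P m b < db b" "P m b = j" by (auto simp: two_def j_def)
            then show ?thesis using r1 r51 lc m4 m5 m8 Wc False
              by (simp add: J2_def wp_simps same_def)
          qed
          have "wp W ?rest1 (\<lambda>t'. step_post s (job_step m) (Suc (t0 + (t1 + Suc t')))) s1"
          proof (rule wp_SeqI[OF j2], elim conjE)
            fix t2 :: nat and s2 assume t2: "t2 \<le> 12" and sm2: "same s1 s2" and r2: "reg s2 24 = b"
              "reg s2 27 = P m b" "reg s2 20 = c" "reg s2 28 = (if two then 2 else 0)" "reg s2 30 = ra c b" "reg s2 31 = sr c"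
            have j3: "wp W J3 (\<lambda>t s'. t \<le> 10 \<and> same s2 s' \<and> reg s' 24 = b \<and>
                reg s' 27 = P m b \<and> reg s' 20 = c \<and> reg s' 28 = (if two then 2 else 0) \<and> reg s' 30 = ra c b \<and>
                reg s' 31 = sr c \<and> reg s' 32 = (if usable c b then 1 else 0) \<and> reg s' 22 = w) s2"
              using r2 Wb Wc
              by (cases two; cases "ra c b < sr c"; cases "ra c b = 0"; cases "ra c b = sr c")
                (simp_all add: J3_def wp_simps same_def usable_def w_def base_def W_small)
            show "wp W (Seq J3 (Seq J4 (Cond (Equal (Reg 35) (Num 1)) Jsit
               (Cond (Equal (Reg 38) (Num 1)) Jzero Jpass))))
               (\<lambda>t'. step_post s (job_step m) (Suc (t0 + (t1 + Suc (t2 + t'))))) s2"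
            proof (rule wp_SeqI[OF j3], elim conjE)
              fix t3 :: nat and s3 assume t3: "t3 \<le> 10" and sm3: "same s2 s3" and r3: "reg s3 24 = b"
                "reg s3 27 = P m b" "reg s3 20 = c" "reg s3 28 = (if two then 2 else 0)" "reg s3 30 = ra c b"
                "reg s3 31 = sr c" "reg s3 32 = (if usable c b then 1 else 0)" "reg s3 22 = w"
              have ms3: "mem s3 = mem s" using sm3 sm2 r51 by (simp add: same_def)
              have m15: "mem s 15 = flag m" "mem s 12 = v m" using R' by simp_all
              have w4: "w \<le> 3" by (simp add: w_def base_def)
              have W4: "mem s 10 b \<le> W" "v m c \<le> W" "flag m b \<le> W" "w \<le> W"
                using pre4D(3)[OF pre b] cb(2)[OF c] fl[of b] Wb(2) w4 by (auto intro!: W_small)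
              have SB: "mem s 10 b = Suc c \<longleftrightarrow> (c, b) \<in> S" using pre4D(4)[OF pre b] by simp
              define sit where "sit \<longleftrightarrow> flag m b = 0 \<and> usable c b \<and> v m c \<le> w"
              define zero where "zero \<longleftrightarrow> two \<and> (c, b) \<in> S"
              have j4: "wp W J4 (\<lambda>t s'. t \<le> 14 \<and> same s3 s' \<and> reg s' 24 = b \<and>
                  reg s' 27 = P m b \<and> reg s' 20 = c \<and> reg s' 28 = (if two then 2 else 0) \<and> reg s' 30 = ra c b \<and>
                  reg s' 31 = sr c \<and> reg s' 32 = (if usable c b then 1 else 0) \<and> reg s' 22 = w \<and>
                  reg s' 35 = (if sit then 1 else 0) \<and> reg s' 38 = (if zero then 1 else 0)) s3"
                using r3 ms3 m15 Wb Wc W4 SB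
                by (cases "flag m b = 0"; cases "usable c b"; cases "v m c \<le> w"; cases two; cases "(c, b) \<in> S")
                  (simp_all add: J4_def wp_simps same_def sit_def zero_def)
              show "wp W (Seq J4 (Cond (Equal (Reg 35) (Num 1)) Jsit (Cond (Equal (Reg 38) (Num 1)) Jzero Jpass)))
                 (\<lambda>t'. step_post s (job_step m) (Suc (t0 + (t1 + Suc (t2 + (t3 + t')))))) s3"
              proof (rule wp_SeqI[OF j4], elim conjE)
                fix t4 :: nat and s4 assume t4: "t4 \<le> 14" and sm4: "same s3 s4" and r4: "reg s4 24 = b"
                  "reg s4 27 = P m b" "reg s4 20 = c" "reg s4 28 = (if two then 2 else 0)" "reg s4 30 = ra c b"
                  "reg s4 31 = sr c" "reg s4 32 = (if usable c b then 1 else 0)" "reg s4 22 = w"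
                  "reg s4 35 = (if sit then 1 else 0)" "reg s4 38 = (if zero then 1 else 0)"
                have sm: "same s s4" using sm0 sm1 sm2 sm3 sm4 by (simp add: same_def)
                have R4: "rep s4 m" by (rule rep_same[OF R sm])
                note R4' = R4[unfolded rep_def]
                have room4: "room s4" using room sm by (simp add: room_def same_def)
                have r54: "reg s4 5 = Suc k" "reg s4 8 = reg s 8" "reg s4 9 = reg s 9" "reg s4 0 = reg s 0"
                  "reg s4 (Suc 0) = reg s (Suc 0)" "mem s4 = mem s" using sm r5 by (simp_all add: same_def)
                define T where "T = Suc (t0 + (t1 + Suc (t2 + (t3 + t4))))"
                have T: "T \<le> 49" using t0 t1 t2 t3 t4 by (simp add: T_def)
                have holdW: "hold m c \<le> W" using cb(1)[OF c] .
                consider "sit" | "\<not> sit" "zero" "usable c b" | "\<not> sit" "zero" "\<not> usable c b" | "\<not> sit" "\<not> zero"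
                  by blast
                then have "wp W (Cond (Equal (Reg 35) (Num 1)) Jsit (Cond (Equal (Reg 38) (Num 1)) Jzero Jpass))
                  (\<lambda>t'. step_post s (job_step m) (T + t')) s4"
                proof cases
                  case 1
                  then have js: "job_step m = Some (seat b c (lift_to c w (pop_job m)))"
                    unfolding step sit_def by simp
                  define s5 where "s5 = set_reg 5 k s4"
                  have R5: "rep s5 (pop_job m)" using R4' jst r54 by (simp add: rep_def pop_job_def s5_def)
                  have "wp W (Seq lift_p seat_p) (\<lambda>t s'. t \<le> 30 \<and> rep s' (seat b c (lift_to c w (pop_job m))) \<and>
                      keep cells s5 s' \<and> reg s' 8 = reg s5 8 \<and> reg s' 9 = reg s5 9) s5"
                    by (rule wp_lift_seat[OF R5])
                      (use r4 Wb Wc W4 holdW room4 in \<open>auto simp: s5_def room_def r54\<close>)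
                  then have "wp W (Seq lift_p seat_p) (\<lambda>t'. step_post s (job_step m) (T + Suc (Suc t'))) s5"
                  proof (rule wp_mono)
                    fix t :: nat and s' assume h: "t \<le> 30 \<and> rep s' (seat b c (lift_to c w (pop_job m))) \<and>
                      keep cells s5 s' \<and> reg s' 8 = reg s5 8 \<and> reg s' 9 = reg s5 9"
                    have "keep cells s s5" using keep_same[OF sm, of cells] by (simp add: keep_def s5_def)
                    then have "keep cells s s'" using keep_trans h by blast
                    then show "step_post s (job_step m) (T + Suc (Suc t)) s'" using h T js r54 by (simp add: s5_def)
                  qed
                  then show ?thesis using 1 r4 r54 Wb
                    by (simp add: wp_Cond Jsit_def wp_Seq wp_Assign s5_def)
                next
                  case 2
                  then have js: "job_step m = Some (seat b c (lift_to c 4 (set_flag b (pop_job m))))"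
                    unfolding step sit_def zero_def by auto
                  define s5 where "s5 = set_reg 22 4 (set_mem 15 b 1 (set_reg 5 k s4))"
                  have R5: "rep s5 (set_flag b (pop_job m))"
                    using R4' jst r54 by (simp add: rep_def pop_job_def set_flag_def s5_def)
                  have "wp W (Seq lift_p seat_p) (\<lambda>t s'. t \<le> 30 \<and> rep s' (seat b c (lift_to c 4 (set_flag b (pop_job m)))) \<and>
                      keep cells s5 s' \<and> reg s' 8 = reg s5 8 \<and> reg s' 9 = reg s5 9) s5"
                    by (rule wp_lift_seat[OF R5])
                      (use r4 Wb Wc W4 holdW room4 in \<open>auto simp: s5_def room_def r54\<close>)
                  then have "wp W (Seq lift_p seat_p) (\<lambda>t'. step_post s (job_step m) (T + (6 + t'))) s5"
                  proof (rule wp_mono)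
                    fix t :: nat and s' assume h: "t \<le> 30 \<and> rep s' (seat b c (lift_to c 4 (set_flag b (pop_job m)))) \<and>
                      keep cells s5 s' \<and> reg s' 8 = reg s5 8 \<and> reg s' 9 = reg s5 9"
                    have "keep cells s s5" using keep_same[OF sm, of cells] by (simp add: keep_def s5_def)
                    then have "keep cells s s'" using keep_trans h by blast
                    then show "step_post s (job_step m) (T + (6 + t)) s'" using h T js r54 by (simp add: s5_def)
                  qed
                  then show ?thesis using 2 r4 r54 Wb
                    by (simp add: wp_Cond Jzero_def wp_Seq wp_Assign wp_Store s5_def)
                next
                  case 3
                  then have js: "job_step m = None" unfolding step sit_def zero_def by auto
                  have "keep cells s s4" by (rule keep_same[OF sm])
                  then show ?thesis using 3 r4 T js
                    by (simp add: wp_Cond Jzero_def wp_Seq wp_Assign keep_def)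
                next
                  case 4
                  define pw where "pw = w + (if usable c b then 1 else 0)"
                  have js: "job_step m = Some (pass b c pw two m)" using 4 unfolding step sit_def zero_def pw_def by auto
                  define s5 where "s5 = set_reg 22 pw s4"
                  have pwW: "pw \<le> W" "w \<le> W" using w4 by (auto simp: pw_def intro!: W_small)
                  have R5: "rep s5 m" using R4' by (simp add: rep_def s5_def)
                  define m1 where "m1 = lift_to c pw m"
                  have l: "wp W lift_p (\<lambda>t s'. t \<le> 25 \<and> rep s' m1 \<and> keep {12, 13, 14, 16, 17, 18} s5 s' \<and>
                      (\<forall>r. r \<notin> {5, 6, 7, 21, 23} \<longrightarrow> reg s' r = reg s5 r)) s5"
                    unfolding m1_def by (rule wp_lift[OF R5])
                      (use r4 Wb Wc W4 holdW room4 pwW in \<open>auto simp: s5_def room_def r54\<close>)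
                  have "wp W (Seq lift_p Jadv) (\<lambda>t'. step_post s (job_step m) (T + Suc (Suc (Suc t')))) s5"
                  proof (rule wp_SeqI[OF l], elim conjE)
                    fix t :: nat and s6 assume h: "t \<le> 25" "rep s6 m1" "keep {12, 13, 14, 16, 17, 18} s5 s6"
                      "\<forall>r. r \<notin> {5, 6, 7, 21, 23} \<longrightarrow> reg s6 r = reg s5 r"
                    note R6 = h(2)[unfolded rep_def]
                    have r6: "reg s6 24 = b" "reg s6 27 = P m b" "reg s6 20 = c" "reg s6 28 = (if two then 2 else 0)"
                      "reg s6 30 = ra c b" "reg s6 31 = sr c" "reg s6 8 = reg s 8" "reg s6 9 = reg s 9"
                      using h(4) r4 r54 by (simp_all add: s5_def)
                    have k5: "keep {} s s5" using keep_same[OF sm, of "{}"] by (simp add: keep_def s5_def)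
                    have k6: "keep {12, 13, 14, 16, 17, 18} s s6" by (rule keep_trans[OF k5 h(3)]) auto
                    have m9: "mem s6 9 c = ka S c" using keep_mem[OF k6, of 9] pre4D(2)[OF pre c] by simp
                    have "v m1 c \<le> max (v m c) pw" by (simp add: m1_def)
                    then have vW: "v m1 c \<le> W" using W4 pwW by simp
                    have kW: "ka S c \<le> W" using ka_le[OF S, of c] da_le[OF c] by (intro W_small) simp
                    define cond where "cond \<longleftrightarrow> v m1 c = 4 \<and> (two \<or> ra c b < sr c \<and> ka S c \<noteq> 0)"
                    define m' where "m' = (if cond then set_flag b m1 else m1)\<lparr>P := (P m1)(b := Suc (P m b))\<rparr>"
                    have m': "pass b c pw two m = m'"
                      by (auto simp: pass_def m'_def cond_def m1_def Let_def)
                    have "wp W Jadv (\<lambda>t s'. t \<le> 12 \<and> rep s' m' \<and> keep {11, 15} s6 s' \<and>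
                        reg s' 8 = reg s6 8 \<and> reg s' 9 = reg s6 9) s6"
                      using r6 R6 m9 vW kW PW Wb Wc
                      by (cases "v m1 c = 4"; cases two; cases "ra c b < sr c"; cases "ka S c = 0")
                        (simp_all add: Jadv_def wp_simps rep_def m'_def cond_def set_flag_def keep_def)
                    then show "wp W Jadv (\<lambda>t'. step_post s (job_step m) (T + Suc (Suc (Suc (t + t'))))) s6"
                    proof (rule wp_mono)
                      fix t' :: nat and s' assume g: "t' \<le> 12 \<and> rep s' m' \<and> keep {11, 15} s6 s' \<and>
                        reg s' 8 = reg s6 8 \<and> reg s' 9 = reg s6 9"
                      have "keep cells s s'" by (rule keep_trans[OF k6, of "{11, 15}"]) (use g in auto)
                      then show "step_post s (job_step m) (T + Suc (Suc (Suc (t + t')))) s'"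
                        using g h(1) T r6 by (simp add: js m')
                    qed
                  qed
                  then show ?thesis using 4 r4 pwW
                    by (simp add: wp_Cond Jpass_def wp_Seq[of W "Assign 22 (Add (Reg 22) (Reg 32))"] wp_Assign
                        s5_def pw_def)
                qed
                then show "wp W (Cond (Equal (Reg 35) (Num 1)) Jsit (Cond (Equal (Reg 38) (Num 1)) Jzero Jpass))
                  (\<lambda>t'. step_post s (job_step m) (Suc (t0 + (t1 + Suc (t2 + (t3 + (t4 + t'))))))) s4"
                  by (simp add: T_def add.assoc)
              qed
            qed
          qed
          then show ?thesis using np r1 by (simp add: wp_Cond mult_2)
        qed
      qed
      then show ?thesis using a0 r0 by (simp add: wp_Cond)
    qed
  qed
qed

definition scan1 :: prog where
  "scan1 = block [Assign 20 (Load 0 (Reg 2)), Assign 20 (Add (Reg 20) (Reg 3)), Assign 24 (Load 1 (Reg 20)),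
     Assign 25 (Load 4 (Reg 2)), Assign 25 (Add (Reg 25) (Reg 24)), Assign 26 (Load 6 (Reg 25)),
     Assign 27 (Load 11 (Reg 24)), Assign 29 (Load 9 (Reg 2)), Assign 30 (Load 8 (Reg 2)),
     Assign 21 (Load 2 (Reg 24)), Assign 22 (Add (Reg 24) (Num 1)), Assign 22 (Load 2 (Reg 22)),
     Assign 22 (Sub (Reg 22) (Reg 21)), Assign 22 (Add (Reg 22) (Reg 26))]"
definition scan2 :: prog where
  "scan2 = block [Assign 28 (Opd (Num 0)), Cond (Less (Reg 22) (Reg 27)) (Assign 28 (Opd (Num 1))) Skip,
     Cond (Less (Reg 26) (Reg 27)) (Cond (Less (Reg 3) (Reg 30))
       (Cond (Equal (Reg 29) (Num 0)) Skip (Assign 28 (Opd (Num 1)))) Skip) Skip,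
     Cond (Equal (Reg 3) (Reg 29)) (Assign 28 (Opd (Num 1))) Skip,
     Assign 31 (Load 15 (Reg 24)), Assign 3 (Add (Reg 3) (Num 1))]"
definition scan3 :: prog where
  "scan3 = Cond (Equal (Reg 31) (Num 0)) (Cond (Equal (Reg 28) (Num 1))
     (Seq (block [Store 15 (Reg 24) (Num 1), Assign 20 (Load 14 (Reg 24))])
        (Cond (Equal (Reg 20) (Num 0)) Skip (Seq (Assign 20 (Sub (Reg 20) (Num 1))) release_p)))
     Skip) Skip"
definition scan_p :: prog where "scan_p = Seq scan1 (Seq scan2 scan3)"

lemma wp_scan:
  assumes R: "rep s m" and pre: "pre4 S s" and I: "inv {} m" and z: "zi m < ze m"
    and fl: "\<And>b. flag m b \<le> 1" and room: "room s"
  shows "wp W scan_p (step_post s (Some (scan_step m))) s"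
proof -
  note R' = R[unfolded rep_def]
  have pre3: "pre3 s" using pre4D(1)[OF pre] .
  have inp: "inp s" using pre3D(1)[OF pre3] .
  define c i b where "c = zc m" and "i = zi m" and "b = agent_ranking G c ! i"
  have c: "c < nA" "i < da c" using invD(14)[OF I z] z by (auto simp: c_def i_def)
  have e: "(c, b) \<in> edges G" "ra c b = i" using agent_nth[of c i] c by (auto simp: b_def)
  have b: "b < nB" using edge_vertices[OF e(1)] by simp
  note cb = cell_bounds[OF I]
  have ld: "mem s 0 c = offA c" "mem s (Suc 0) (offA c + i) = b" "mem s 4 c = c * nB"
    "mem s 6 (c * nB + b) = rb b c" "mem s 9 c = ka S c" "mem s 8 c = sr c"
    "mem s 2 b = offB b" "mem s 2 (Suc b) = offB b + db b"
    using inp_mem[OF inp] c b e pre3D[OF pre3] pre4D(2)[OF pre] by (simp_all add: b_def offB_Suc)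
  have Wc: "c \<le> W" "Suc i \<le> W" "i \<le> W" "offA c + i \<le> W" "offA c \<le> W" "b \<le> W" "Suc b \<le> W" "c * nB \<le> W"
    "c * nB + b \<le> W" "rb b c \<le> W" "P m b \<le> W" "ka S c \<le> W" "sr c \<le> W" "offB b \<le> W" "offB b + db b \<le> W"
    "db b \<le> W" "db b + rb b c \<le> W" "Suc 0 \<le> W" "flag m b \<le> W" "sat m b \<le> W"
    using c b W_index[of c b] offA_le[of "Suc c"] offB_le[of "Suc b"] rb_less[OF e(1)] ka_le[OF S, of c]
      da_le[OF c(1)] db_le[OF b] sr_le[of c] cb(3,4)[OF b] fl[of b]
    by (auto intro!: W_small simp: offA_Suc offB_Suc)
  have zcs: "zc m = c" "zi m = i" by (simp_all add: c_def i_def)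
  have s1: "wp W scan1 (\<lambda>t s'. t \<le> 15 \<and> same s s' \<and> reg s' 24 = b \<and> reg s' 26 = rb b c \<and> reg s' 27 = P m b \<and>
      reg s' 29 = ka S c \<and> reg s' 30 = sr c \<and> reg s' 22 = db b + rb b c) s"
    using R' ld Wc zcs by (simp add: scan1_def wp_simps same_def)
  show ?thesis
    unfolding scan_p_def
  proof (rule wp_SeqI[OF s1], elim conjE)
    fix t1 :: nat and s1 assume t1: "t1 \<le> 15" and sm1: "same s s1" and r1: "reg s1 24 = b" "reg s1 26 = rb b c"
      "reg s1 27 = P m b" "reg s1 29 = ka S c" "reg s1 30 = sr c" "reg s1 22 = db b + rb b c"
    have R1: "rep s1 m" by (rule rep_same[OF R sm1])
    note R1' = R1[unfolded rep_def]
    define m1 where "m1 = m\<lparr>zi := Suc i\<rparr>"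
    have s2: "wp W scan2 (\<lambda>t s'. t \<le> 14 \<and> rep s' m1 \<and> keep {} s1 s' \<and> reg s' 24 = b \<and> reg s' 31 = flag m b \<and>
        reg s' 28 = (if trig m c b then 1 else 0) \<and> reg s' 5 = reg s1 5 \<and> reg s' 7 = reg s1 7 \<and>
        reg s' 8 = reg s1 8 \<and> reg s' 9 = reg s1 9) s1"
      using R1' r1 Wc zcs e(2)
      by (cases "db b + rb b c < P m b"; cases "rb b c < P m b"; cases "i < sr c"; cases "ka S c = 0"; cases "i = ka S c")
        (simp_all add: scan2_def wp_simps rep_def keep_def trig_def m1_def)
    show "wp W (Seq scan2 scan3) (\<lambda>t'. step_post s (Some (scan_step m)) (t1 + t')) s1"
    proof (rule wp_SeqI[OF s2], elim conjE)
      fix t2 :: nat and s2 assume t2: "t2 \<le> 14" and R2: "rep s2 m1" and k2: "keep {} s1 s2"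
        and r2: "reg s2 24 = b" "reg s2 31 = flag m b" "reg s2 28 = (if trig m c b then 1 else 0)"
          "reg s2 5 = reg s1 5" "reg s2 7 = reg s1 7" "reg s2 8 = reg s1 8" "reg s2 9 = reg s1 9"
      have rs: "reg s2 5 = reg s 5" "reg s2 7 = reg s 7" "reg s2 8 = reg s 8" "reg s2 9 = reg s 9"
        using r2 sm1 by (simp_all add: same_def)
      have k: "keep cells s s2" by (rule keep_trans[OF keep_same[OF sm1, of "{}"] k2]) auto
      have st: "scan_step m = (if flag m b = 0 \<and> trig m c b then flag_release b m1 else m1)"
        by (simp add: scan_step_def Let_def m1_def b_def c_def i_def)
      have m14: "mem s2 14 = sat m" using R2 by (simp add: rep_def m1_def)
      consider "\<not> (flag m b = 0 \<and> trig m c b)" | "flag m b = 0" "trig m c b" "sat m b = 0"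
        | "flag m b = 0" "trig m c b" "sat m b \<noteq> 0" by blast
      then show "wp W scan3 (\<lambda>t'. step_post s (Some (scan_step m)) (t1 + (t2 + t'))) s2"
      proof cases
        case 1
        then show ?thesis using r2 R2 k t1 t2 rs
          by (cases "flag m b = 0"; cases "trig m c b") (simp_all add: scan3_def wp_simps st)
      next
        case 2
        have "rep (set_reg 20 0 (set_mem 15 b (Suc 0) s2)) (set_flag b m1)" using R2 by (simp add: rep_def set_flag_def)
        then show ?thesis using 2 r2 k t1 t2 Wc m14 rs
          by (simp add: scan3_def wp_simps st flag_release_def m1_def keep_def)
      next
        case 3
        define c' where "c' = sat m b - 1"
        have sc: "sat m b = Suc c'" using 3 by (simp add: c'_def)
        have bJ: "b \<in> jobs G" using b by simp
        have "sits m b c'" using invD(5)[OF I bJ] 3 by (simp add: c'_def)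
        then have c': "c' < nA" using edge_vertices[of c' b] by (simp add: sits_def)
        have Wc': "c' \<le> W" using c' by (intro W_small) simp
        define s3 where "s3 = set_reg 20 c' (set_reg 20 (Suc c') (set_mem 15 b (Suc 0) s2))"
        have R3: "rep s3 (set_flag b m1)" using R2 by (simp add: rep_def set_flag_def s3_def)
        have "wp W release_p (\<lambda>t s'. t \<le> 12 \<and> rep s' (release c' (set_flag b m1)) \<and> keep {13, 14, 16, 18} s3 s' \<and>
            (\<forall>r. r \<notin> {5, 7, 21} \<longrightarrow> reg s' r = reg s3 r)) s3"
          by (rule wp_release[OF R3])
            (use cb(1)[OF c'] Wc' room rs in \<open>simp_all add: s3_def m1_def set_flag_def room_def\<close>)
        then have "wp W release_p (\<lambda>t'. step_post s (Some (scan_step m)) (t1 + (t2 + (6 + t')))) s3"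
        proof (rule wp_mono)
          fix t :: nat and s' assume h: "t \<le> 12 \<and> rep s' (release c' (set_flag b m1)) \<and> keep {13, 14, 16, 18} s3 s' \<and>
            (\<forall>r. r \<notin> {5, 7, 21} \<longrightarrow> reg s' r = reg s3 r)"
          have k3: "keep cells s s3" using k by (simp add: keep_def s3_def)
          have "keep cells s s'" by (rule keep_trans[OF k3, of "{13, 14, 16, 18}"]) (use h in auto)
          moreover have "scan_step m = release c' (set_flag b m1)"
            using 3 by (simp add: st flag_release_def m1_def sc)
          ultimately show "step_post s (Some (scan_step m)) (t1 + (t2 + (6 + t))) s'"
            using h t1 t2 rs by (simp add: s3_def)
        qed
        then show ?thesis using 3 r2 Wc Wc' m14 sc by (simp add: scan3_def wp_simps s3_def)
      qed
    qed
  qed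
qed

definition next_p :: prog where
  "next_p = block [Assign 6 (Sub (Reg 6) (Num 1)), Assign 2 (Load 17 (Reg 6)), Assign 20 (Load 0 (Reg 2)),
     Assign 21 (Add (Reg 2) (Num 1)), Assign 21 (Load 0 (Reg 21)), Assign 3 (Opd (Num 0)),
     Assign 4 (Sub (Reg 21) (Reg 20))]"

lemma wp_next:
  assumes R: "rep s m" and pre: "pre4 S s" and I: "inv {} m" and ne: "zst m \<noteq> []" and room: "room s"
  shows "wp W next_p (step_post s (Some (scan_next m))) s"
proof -
  note R' = R[unfolded rep_def]
  have inp: "inp s" using pre3D(1)[OF pre4D(1)[OF pre]] .
  define k where "k = reg s 6 - 1"
  have r6: "reg s 6 = Suc k" using ne R' by (auto simp: k_def)
  define c where "c = mem s 17 k"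
  have zst: "zst m = c # stk (mem s 17) k" using R' r6 by (simp add: c_def)
  have c: "c < nA" using invD(12)[OF I] zst by simp
  have ld: "mem s 0 c = offA c" "mem s 0 (Suc c) = offA c + da c"
    using inp_mem(1)[OF inp] c by (simp_all add: offA_Suc)
  have Wc: "c \<le> W" "Suc c \<le> W" "offA c \<le> W" "offA c + da c \<le> W" "da c \<le> W" "k \<le> W"
    using c offA_le[of "Suc c"] room r6 by (auto intro!: W_small simp: offA_Suc room_def)
  show ?thesis
    using R' r6 ld Wc zst by (simp add: next_p_def wp_simps rep_def scan_next_def keep_def flip: c_def)
qed

definition cand_p :: prog where
  "cand_p = block [Assign 7 (Sub (Reg 7) (Num 1)), Assign 20 (Load 18 (Reg 7)), Assign 21 (Load 13 (Reg 20)),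
     Assign 22 (Load 12 (Reg 20)),
     Cond (Equal (Reg 21) (Num 0)) (Cond (Less (Reg 22) (Num 4))
       (block [Assign 23 (Load 9 (Reg 20)), Assign 24 (Load 0 (Reg 20)), Assign 25 (Add (Reg 20) (Num 1)),
          Assign 25 (Load 0 (Reg 25)), Assign 25 (Sub (Reg 25) (Reg 24)), Assign 26 (Load 8 (Reg 20)),
          Assign 27 (Opd (Num 1)),
          Cond (Equal (Reg 23) (Reg 25)) (Cond (Less (Reg 26) (Reg 25)) (Assign 27 (Opd (Num 0))) Skip) Skip,
          Cond (Equal (Reg 27) (Num 1))
            (block [Store 12 (Reg 20) (Num 4), Store 17 (Reg 6) (Reg 20), Assign 6 (Add (Reg 6) (Num 1))])
            (block [Assign 8 (Opd (Num 0)), Assign 9 (Opd (Num 0))])]) Skip) Skip]"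

lemma wp_cand:
  assumes R: "rep s m" and pre: "pre4 S s" and I: "inv {} m" and ne: "cst m \<noteq> []" and room: "room s"
  shows "wp W cand_p (step_post s (cand_step m)) s"
proof -
  note R' = R[unfolded rep_def]
  have pre3: "pre3 s" using pre4D(1)[OF pre] .
  have inp: "inp s" using pre3D(1)[OF pre3] .
  define k where "k = reg s 7 - 1"
  have r7: "reg s 7 = Suc k" using ne R' by (auto simp: k_def)
  define c where "c = mem s 18 k"
  have cst: "cst m = c # stk (mem s 18) k" using R' r7 by (simp add: c_def)
  have c: "c < nA" using invD(13)[OF I] cst by simp
  note cb = cell_bounds[OF I]
  have ld: "mem s 0 c = offA c" "mem s 0 (Suc c) = offA c + da c" "mem s 9 c = ka S c" "mem s 8 c = sr c"
    using inp_mem(1)[OF inp] c pre3D(5)[OF pre3] pre4D(2)[OF pre] by (simp_all add: offA_Suc)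
  have Wc: "c \<le> W" "Suc c \<le> W" "offA c \<le> W" "offA c + da c \<le> W" "da c \<le> W" "k \<le> W" "hold m c \<le> W" "v m c \<le> W"
    "ka S c \<le> W" "sr c \<le> W" "Suc 0 \<le> W" "4 \<le> W" "reg s 6 \<le> W" "Suc (reg s 6) \<le> W"
    using c offA_le[of "Suc c"] room r7 cb(1,2)[OF c] ka_le[OF S, of c] da_le[OF c] sr_le[of c]
    by (auto intro!: W_small simp: offA_Suc room_def)
  have step: "cand_step m = (if hold m c = 0 \<and> v m c < 4 then
       (if ka S c = da c \<and> sr c < da c then None
        else Some (m\<lparr>cst := stk (mem s 18) k, v := (v m)(c := 4), zst := c # zst m\<rparr>))
     else Some (m\<lparr>cst := stk (mem s 18) k\<rparr>))"
    by (simp add: cand_step_def cst Let_def)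
  show ?thesis
    unfolding step using R' r7 ld Wc c_def[symmetric]
    by (cases "hold m c = 0"; cases "v m c < 4"; cases "ka S c = da c"; cases "sr c < da c")
      (simp_all add: cand_p_def wp_simps rep_def keep_def)
qed

definition body5 :: prog where
  "body5 = Cond (Less (Reg 3) (Reg 4)) scan_p
     (Cond (Less (Num 0) (Reg 6)) next_p
       (Cond (Less (Num 0) (Reg 5)) job_p
         (Cond (Less (Num 0) (Reg 7)) cand_p (Assign 9 (Opd (Num 0))))))"

lemma wp_body5:
  assumes R: "rep s m" and pre: "pre4 S s" and I: "inv {} m" and nf: "\<not> finished m"
    and fl: "\<And>b. flag m b \<le> 1" and room: "room s"
  shows "wp W body5 (\<lambda>t s'. t \<le> 110 \<and> (\<exists>t'. step_post s (step m) t' s')) s"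
proof -
  note R' = R[unfolded rep_def]
  have up: "wp W p (\<lambda>t s'. n + t \<le> 110 \<and> (\<exists>t'. step_post s om t' s')) s"
    if "wp W p (step_post s om) s" "n \<le> 10" for p om n
    using that(1) by (rule wp_mono) (use that(2) in auto)
  consider "zi m < ze m" | "\<not> zi m < ze m" "zst m \<noteq> []" | "\<not> zi m < ze m" "zst m = []" "jst m \<noteq> []"
    | "\<not> zi m < ze m" "zst m = []" "jst m = []" "cst m \<noteq> []"
    using nf by (auto simp: finished_def)
  then show ?thesis
  proof cases
    case 1
    then have st: "step m = Some (scan_step m)" by (simp add: step_def)
    show ?thesis unfolding st using 1 R' up[OF wp_scan[OF R pre I 1 fl room], of 1]
      by (simp add: body5_def wp_Cond)
  next
    case 2
    then have st: "step m = Some (scan_next m)" by (simp add: step_def)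
    have "0 < reg s 6" using 2 R' by simp
    then show ?thesis unfolding st using 2 R' up[OF wp_next[OF R pre I 2(2) room], of 2]
      by (simp add: body5_def wp_Cond)
  next
    case 3
    then have st: "step m = job_step m" by (simp add: step_def)
    have "reg s 6 = 0" "0 < reg s 5" using 3 R' by simp_all
    then show ?thesis unfolding st using 3(1) R' up[OF wp_job[OF R pre I 3(3) fl room], of 3]
      by (simp add: body5_def wp_Cond)
  next
    case 4
    then have st: "step m = cand_step m" by (simp add: step_def)
    have "reg s 6 = 0" "reg s 5 = 0" "0 < reg s 7" using 4 R' by simp_all
    then show ?thesis unfolding st using 4(1) R' up[OF wp_cand[OF R pre I 4(4) room], of 4]
      by (simp add: body5_def wp_Cond)
  qed
qed

lemma step_flags:
  assumes "\<And>b. flag m b \<le> 1" "step m = Some m'"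
  shows "flag m' b \<le> 1"
proof -
  have rel: "flag (release c n) = flag n" for c n by (simp add: release_def)
  have fr: "flag (flag_release b n) = (flag n)(b := 1)" for b n by (simp add: flag_release_def rel)
  have se: "flag (seat b c n) = flag n" for b c n by (simp add: seat_def)
  have fl: "flag m b \<le> Suc 0" for b using assms(1)[of b] by simp
  show ?thesis
    using assms(2)
    by (auto simp: step_def scan_step_def scan_next_def job_step_def cand_step_def pass_def Let_def fr se fl
        split: if_splits)
qed

section \<open>The main loop and the output\<close>

definition mof :: "state \<Rightarrow> mach" where
  "mof s = \<lparr>P = mem s 11, v = mem s 12, hold = mem s 13, sat = mem s 14, flag = mem s 15,
     jst = stk (mem s 16) (reg s 5), zst = stk (mem s 17) (reg s 6), cst = stk (mem s 18) (reg s 7),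
     zc = reg s 2, zi = reg s 3, ze = reg s 4\<rparr>"

lemma rep_mof: "rep s (mof s)" and mof_rep: "rep s m \<Longrightarrow> mof s = m"
  by (simp_all add: rep_def mof_def)

text \<open>After a failure only the verdict matters. Before, the bound on the potential is carried
  along because it limits the stack heights, and the bound on the flags because they must fit into a
  word.\<close>

definition inv5 :: "state \<Rightarrow> bool" where
  "inv5 s \<longleftrightarrow> pre4 S s \<and>
     (reg s 9 = 0 \<and> reg s 8 = 0 \<and> \<not> (\<exists>M x y. fp_witness M x y) \<or>
      reg s 8 = 1 \<and> inv {} (mof s) \<and> (\<forall>b. flag (mof s) b \<le> 1) \<and> potential (mof s) \<le> 20 * (nA + nB + card (edges G)) \<and>
      (reg s 9 = 1 \<or> reg s 9 = 0 \<and> finished (mof s)))"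

text \<open>An iteration costs at most 110. The added 1 pays for the last one, which clears register
  9 on success or on failure.\<close>

definition pot5 :: "state \<Rightarrow> nat" where
  "pot5 s = (if reg s 9 = 1 then 120 * (potential (mof s) + 1) else 0)"

text \<open>The heights of two stacks are summands of the potential, and every entry of the third
  contributes at least 1 to it. So no push can exceed the word bound.\<close>

lemma room_potential: "rep s m \<Longrightarrow> potential m \<le> 20 * (nA + nB + card (edges G)) \<Longrightarrow> room s"
proof -
  assume R: "rep s m" and p: "potential m \<le> 20 * (nA + nB + card (edges G))"
  have "length (zst m) \<le> (\<Sum>c\<leftarrow>zst m. da c + 1)" by (induction "zst m") (auto simp: sum_list_Suc)
  then have "length (jst m) \<le> potential m" "length (zst m) \<le> potential m" "length (cst m) \<le> potential m"
    by (simp_all add: potential_def)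
  then show ?thesis using R p unfolding room_def rep_def
    by (intro conjI W_small) (simp_all add: algebra_simps)
qed

lemma body5_inv:
  assumes I: "inv5 s" and t: "test_val (Equal (Reg 9) (Num 1)) s"
  shows "wp W body5 (\<lambda>t s'. inv5 s' \<and> pot5 s' + t < pot5 s) s"
proof -
  have r9: "reg s 9 = 1" using t by simp
  define m where "m = mof s"
  have R: "rep s m" using rep_mof by (simp add: m_def)
  have pre: "pre4 S s" and r8: "reg s 8 = 1" and im: "inv {} m" and fl: "\<And>b. flag m b \<le> 1"
    and pm: "potential m \<le> 20 * (nA + nB + card (edges G))"
    using I r9 by (auto simp: inv5_def m_def)
  have pot: "pot5 s = 120 * (potential m + 1)" by (simp add: pot5_def r9 m_def)
  show ?thesis
  proof (cases "finished m")
    case True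
    note R' = R[unfolded rep_def]
    have z: "reg s 5 = 0" "reg s 6 = 0" "reg s 7 = 0" "\<not> reg s 3 < reg s 4"
      using True R' by (simp_all add: finished_def)
    define s' where "s' = set_reg 9 0 s"
    have k: "keep {} s s'" by (simp add: keep_def s'_def)
    have "pre4 S s'" by (rule pre4_keep[OF pre k]) simp
    moreover have "mof s' = m" by (simp add: mof_def s'_def m_def)
    ultimately have "inv5 s'" using im fl pm True r8 unfolding inv5_def by (simp add: s'_def)
    moreover have "pot5 s' = 0" by (simp add: pot5_def s'_def)
    ultimately show ?thesis unfolding pot using z
      by (simp add: body5_def wp_Cond wp_Assign s'_def)
  next
    case False
    show ?thesis
    proof (rule wp_mono[OF wp_body5[OF R pre im False fl room_potential[OF R pm]]], elim conjE exE)
      fix t t' :: nat and s' assume t: "t \<le> 110" and k: "keep cells s s'"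
        and post: "case step m of None \<Rightarrow> reg s' 8 = 0 \<and> reg s' 9 = 0
          | Some m' \<Rightarrow> rep s' m' \<and> reg s' 8 = reg s 8 \<and> reg s' 9 = reg s 9"
      have pre': "pre4 S s'" by (rule pre4_keep[OF pre k]) auto
      show "inv5 s' \<and> pot5 s' + t < pot5 s"
      proof (cases "step m")
        case None
        then have "\<not> (\<exists>M x y. fp_witness M x y)" using step_inv[OF im False] by simp
        then have "inv5 s'" using pre' post None by (simp add: inv5_def)
        moreover have "pot5 s' = 0" using post None by (simp add: pot5_def)
        ultimately show ?thesis using t pot by simp
      next
        case (Some m')
        have m': "mof s' = m'" using post Some mof_rep by simp
        have r': "reg s' 8 = 1" "reg s' 9 = 1" using post Some r8 r9 by simp_all
        have "inv {} m'" using step_inv[OF im False] Some by simp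
        moreover have pl: "potential m' < potential m" using step_potential[OF im False Some] .
        moreover have "flag m' b \<le> 1" for b using step_flags[OF fl Some] .
        ultimately have inv5: "inv5 s'" using pre' r' m' pm by (simp add: inv5_def)
        have "pot5 s' = 120 * (potential m' + 1)" by (simp add: pot5_def m' r')
        moreover have "120 * (potential m' + 1) \<le> 120 * potential m" using pl by (intro mult_le_mono2) simp
        ultimately have "pot5 s' + t < pot5 s" using t pot by simp
        then show ?thesis using inv5 by blast
      qed
    qed
  qed
qed

definition main_p :: prog where
  "main_p = block [Assign 2 (Opd (Num 0)), Assign 3 (Opd (Num 0)), Assign 4 (Opd (Num 0)), Assign 5 (Opd (Reg 1)),
     Assign 6 (Opd (Num 0)), Assign 7 (Opd (Reg 0)), Assign 8 (Opd (Num 1)), Assign 9 (Opd (Num 1)),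
     While (Equal (Reg 9) (Num 1)) body5]"

lemma set_stk: "(\<forall>i<n. f i = i) \<Longrightarrow> set (stk f n) = {..<n}"
  by (auto simp: stk_def)

lemma wp_main:
  assumes pre: "pre4 S s" and z: "\<And>d. d \<in> {11, 12, 13, 14, 15, 17} \<Longrightarrow> mem s d = (\<lambda>_. 0)"
    and js: "\<forall>i<nB. mem s 16 i = i" and cs: "\<forall>i<nA. mem s 18 i = i"
  shows "wp W main_p (\<lambda>t s'. t \<le> 2400 * input_size G + 130 \<and> inv5 s' \<and> reg s' 9 = 0) s"
proof -
  have inp: "inp s" using pre3D(1)[OF pre4D(1)[OF pre]] .
  note ir = inp_reg[OF inp]
  define s1 where "s1 = set_reg 9 1 (set_reg 8 1 (set_reg 7 nA (set_reg 6 0 (set_reg 5 nB (set_reg 4 0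
    (set_reg 3 0 (set_reg 2 0 s)))))))"
  define m where "m = mof s1"
  have m: "P m = (\<lambda>_. 0)" "v m = (\<lambda>_. 0)" "hold m = (\<lambda>_. 0)" "sat m = (\<lambda>_. 0)" "flag m = (\<lambda>_. 0)"
    "zst m = []" "zi m = 0" "ze m = 0" "set (jst m) = {..<nB}" "set (cst m) = {..<nA}"
    "length (jst m) = nB" "length (cst m) = nA"
    using z js cs by (simp_all add: m_def mof_def s1_def set_stk)
  have k: "keep {} s s1" by (simp add: keep_def s1_def)
  have pre1: "pre4 S s1" by (rule pre4_keep[OF pre k]) simp
  have im: "inv {} m"
    by (rule invI) (auto simp: m sound_def)
  \<comment> \<open>This amounts to 3 per edge, 11 per agent and 3 per job, well below the factor 20
    that \<open>inv5\<close> maintains.\<close>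
  have "potential m = 2 * offB nB + 8 * nA + (offA nA + 2 * nA) + 2 * nB + nB + nA"
    by (simp add: potential_def m offA_eq_sum offB_eq_sum agents_eq jobs_eq sum_Suc sum_distrib_left)
  then have pm: "potential m \<le> 20 * (nA + nB + card (edges G))" by (simp add: offA_nA offB_nB)
  have I0: "inv5 s1" unfolding inv5_def m_def[symmetric] using pre1 im pm by (simp add: m s1_def)
  have "pot5 s1 = 120 * (potential m + 1)" by (simp add: pot5_def m_def s1_def)
  then have pot: "pot5 s1 \<le> 2400 * input_size G + 120" using pm size by simp
  have W0: "nA \<le> W" "nB \<le> W" "Suc 0 \<le> W" by (auto intro!: W_small)
  have "wp W (While (Equal (Reg 9) (Num 1)) body5)
      (\<lambda>t s'. inv5 s' \<and> \<not> test_val (Equal (Reg 9) (Num 1)) s' \<and> t \<le> Suc (pot5 s1)) s1"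
    by (rule wp_While[of inv5, OF body5_inv I0])
  then have "wp W (While (Equal (Reg 9) (Num 1)) body5)
      (\<lambda>t s'. 8 + t \<le> 2400 * input_size G + 130 \<and> inv5 s' \<and> reg s' 9 = 0) s1"
    by (rule wp_mono) (use pot in \<open>auto simp: inv5_def\<close>)
  then show ?thesis
    unfolding main_p_def using W0 by (simp add: wp_simps ir s1_def)
qed

text \<open>The entries of \<open>hold\<close> are already in the output format, shifted by one with
  0 for unmatched, so they are copied unchanged. Array 0 with its offsets may be overwritten, as
  nothing reads it any more.\<close>

definition copy_body :: prog where
  "copy_body = block [Assign 3 (Load 13 (Reg 2)), Store 0 (Reg 2) (Reg 3), Assign 2 (Add (Reg 2) (Num 1))]"

definition out_p :: prog where
  "out_p = Seq (Cond (Equal (Reg 8) (Num 1))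
       (Seq (Assign 2 (Opd (Num 0))) (While (Less (Reg 2) (Reg 0)) copy_body)) Skip)
     (Assign 0 (Opd (Reg 8)))"

lemma wp_out:
  assumes I: "inv5 s" and r9: "reg s 9 = 0"
  shows "wp W out_p (\<lambda>t s'. t \<le> 5 * input_size G + 10 \<and> correct_output G s') s"
proof (cases "reg s 8 = 1")
  case False
  then have z: "reg s 8 = 0" and n: "\<not> (\<exists>M x y. fp_witness M x y)" using I by (auto simp: inv5_def)
  have "\<not> (\<exists>M. fully_popular G M)" using n fully_popular_iff by blast
  then show ?thesis using z by (simp add: out_p_def wp_simps correct_output_def)
next
  case True
  define m where "m = mof s"
  have im: "inv {} m" and fin: "finished m" and pre: "pre4 S s"
    using I True r9 by (auto simp: inv5_def m_def)
  have inp: "inp s" using pre3D(1)[OF pre4D(1)[OF pre]] .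
  note ir = inp_reg[OF inp]
  have h: "hold m = mem s 13" by (simp add: m_def mof_def)
  define J where "J s' \<longleftrightarrow> reg s' 0 = nA \<and> reg s' 8 = 1 \<and> reg s' 2 \<le> nA \<and> mem s' 13 = hold m \<and>
      (\<forall>a<reg s' 2. mem s' 0 a = hold m a)" for s' :: state
  define f where "f s' = 5 * (nA - reg s' 2)" for s' :: state
  define s1 where "s1 = set_reg 2 0 s"
  have J0: "J s1" using ir True h by (simp add: J_def s1_def)
  have step: "wp W copy_body (\<lambda>t s2. J s2 \<and> f s2 + t < f s') s'"
    if g: "J s'" "test_val (Less (Reg 2) (Reg 0)) s'" for s'
  proof -
    have lt: "reg s' 2 < nA" using g by (simp add: J_def)
    then have "Suc (reg s' 2) \<le> W" "hold m (reg s' 2) \<le> W"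
      using cell_bounds(1)[OF im] by (auto intro: W_small)
    then show ?thesis using g(1) lt
      by (auto simp: copy_body_def wp_simps J_def f_def less_Suc_eq)
  qed
  have "wp W (While (Less (Reg 2) (Reg 0)) copy_body)
      (\<lambda>t s'. J s' \<and> \<not> test_val (Less (Reg 2) (Reg 0)) s' \<and> t \<le> Suc (f s1)) s1"
    by (rule wp_While[of J, OF step J0])
  then have "wp W (While (Less (Reg 2) (Reg 0)) copy_body)
      (\<lambda>t s'. Suc (Suc (Suc t)) \<le> 5 * input_size G + 10 \<and> correct_output G (set_reg 0 (Suc 0) s') \<and> reg s' 8 = 1) s1"
  proof (rule wp_mono, elim conjE)
    fix t s' assume g: "J s'" "\<not> test_val (Less (Reg 2) (Reg 0)) s'" and t: "t \<le> Suc (f s1)"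
    have "reg s' 2 = nA" using g by (simp add: J_def)
    then have "mem s' 0 a = hold m a" if "a < nA" for a using g that by (simp add: J_def)
    then have o: "output_matching G (set_reg 0 (Suc 0) s') = result m"
      by (auto simp: output_matching_def result_def)
    have max: "max_fully_popular G (result m)" using result_max[OF im fin] .
    then have "\<exists>M. fully_popular G M" by (auto simp: max_fully_popular_def)
    then have "correct_output G (set_reg 0 (Suc 0) s')" using max o by (simp add: correct_output_def)
    then show "Suc (Suc (Suc t)) \<le> 5 * input_size G + 10 \<and> correct_output G (set_reg 0 (Suc 0) s') \<and> reg s' 8 = 1"
      using t g size by (simp add: f_def s1_def J_def)
  qed
  then show ?thesis using True
    unfolding out_p_def
    by (simp add: wp_Seq wp_Cond wp_Assign s1_def) (erule wp_mono, simp add: wp_Assign W_small)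
qed

end

text \<open>The programs were defined inside locales but mention none of their parameters, so
  outside they are closed terms: one program serves all instances and all word sizes.\<close>

definition algorithm :: prog where
  "algorithm = Seq ram.loop1 (Seq ram.loop2 (Seq ram.loop3 (Seq ram.loop4
     (Seq (ram.fill 16 1) (Seq (ram.fill 18 0) (Seq job_program.main_p job_program.out_p))))))"

context ram
begin

lemma wp_algorithm:
  "wp W algorithm (\<lambda>t s'. t \<le> 3000 * input_size G + 1000 \<and> correct_output G s') (input_state G)"
proof -
  let ?n = "input_size G"
  have nn: "nA \<le> ?n" "nB \<le> ?n" using size by simp_all
  show ?thesis
    unfolding algorithm_def
  proof (rule wp_SeqI[OF loop1], elim conjE)
    fix t1 s1 assume t1: "t1 \<le> 20 * ?n + 1" and p1: "pre1 s1" "fresh 8 s1"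
    show "wp W (Seq loop2 (Seq loop3 (Seq loop4
        (Seq (fill 16 1) (Seq (fill 18 0) (Seq job_program.main_p job_program.out_p))))))
      (\<lambda>t s'. t1 + t \<le> 3000 * ?n + 1000 \<and> correct_output G s') s1"
    proof (rule wp_SeqI[OF loop2[OF p1]], elim conjE)
      fix t2 s2 assume t2: "t2 \<le> 20 * ?n + 3" and p2: "pre2 s2" "fresh 8 s2"
      show "wp W (Seq loop3 (Seq loop4
          (Seq (fill 16 1) (Seq (fill 18 0) (Seq job_program.main_p job_program.out_p)))))
        (\<lambda>t s'. t1 + (t2 + t) \<le> 3000 * ?n + 1000 \<and> correct_output G s') s2"
      proof (rule wp_SeqI[OF loop3[OF p2]], elim conjE)
        fix t3 s3 assume t3: "t3 \<le> 20 * ?n + 3" and p3: "pre3 s3" "fresh 9 s3"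
        show "wp W (Seq loop4 (Seq (fill 16 1) (Seq (fill 18 0) (Seq job_program.main_p job_program.out_p))))
          (\<lambda>t s'. t1 + (t2 + (t3 + t)) \<le> 3000 * ?n + 1000 \<and> correct_output G s') s3"
        proof (rule wp_SeqI[OF loop4[OF p3]], elim conjE exE)
          fix t4 s4 S assume t4: "t4 \<le> 100 * ?n + 60" and p4: "pre4 S s4" "fresh 11 s4"
          interpret agent_optimal G S using p4(1) by (simp add: pre4_def)
          interpret job_program G W S by unfold_locales
          have inp4: "inp s4" using pre3D(1)[OF pre4D(1)[OF p4(1)]] .
          have f1: "wp W (fill 16 1) (\<lambda>t s'. t \<le> 5 * nB + 2 \<and> keep {16} s4 s' \<and> (\<forall>i<nB. mem s' 16 i = i)) s4"
            by (rule fill[OF _ inp4]) simp_all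
          show "wp W (Seq (fill 16 1) (Seq (fill 18 0) (Seq main_p out_p)))
            (\<lambda>t s'. t1 + (t2 + (t3 + (t4 + t))) \<le> 3000 * ?n + 1000 \<and> correct_output G s') s4"
          proof (rule wp_SeqI[OF f1], elim conjE)
            fix t5 s5 assume t5: "t5 \<le> 5 * nB + 2" and k5: "keep {16} s4 s5" and js: "\<forall>i<nB. mem s5 16 i = i"
            have pre5: "pre4 S s5" by (rule pre4_keep[OF p4(1) k5]) simp
            have inp5: "inp s5" using pre3D(1)[OF pre4D(1)[OF pre5]] .
            have f2: "wp W (fill 18 0) (\<lambda>t s'. t \<le> 5 * nA + 2 \<and> keep {18} s5 s' \<and> (\<forall>i<nA. mem s' 18 i = i)) s5"
              by (rule fill[OF _ inp5]) simp_all
            show "wp W (Seq (fill 18 0) (Seq main_p out_p))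
              (\<lambda>t s'. t1 + (t2 + (t3 + (t4 + (t5 + t)))) \<le> 3000 * ?n + 1000 \<and> correct_output G s') s5"
            proof (rule wp_SeqI[OF f2], elim conjE)
              fix t6 s6 assume t6: "t6 \<le> 5 * nA + 2" and k6: "keep {18} s5 s6" and cs: "\<forall>i<nA. mem s6 18 i = i"
              have pre6: "pre4 S s6" by (rule pre4_keep[OF pre5 k6]) simp
              have z: "mem s6 d = (\<lambda>_. 0)" if "d \<in> {11, 12, 13, 14, 15, 17}" for d
                using that keep_mem[OF k6, of d] keep_mem[OF k5, of d] p4(2) by (auto simp: fresh_def)
              have js6: "\<forall>i<nB. mem s6 16 i = i" using js keep_mem[OF k6, of 16] by simp
              show "wp W (Seq main_p out_p)
                (\<lambda>t s'. t1 + (t2 + (t3 + (t4 + (t5 + (t6 + t))))) \<le> 3000 * ?n + 1000 \<and> correct_output G s') s6"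
              proof (rule wp_SeqI[OF wp_main[OF pre6 z js6 cs]], assumption, elim conjE)
                fix t7 s7 assume t7: "t7 \<le> 2400 * ?n + 130" and i7: "inv5 s7" "reg s7 9 = 0"
                show "wp W out_p
                  (\<lambda>t s'. t1 + (t2 + (t3 + (t4 + (t5 + (t6 + (t7 + t)))))) \<le> 3000 * ?n + 1000 \<and> correct_output G s') s7"
                  by (rule wp_mono[OF wp_out[OF i7]]) (use t1 t2 t3 t4 t5 t6 t7 nn in simp)
              qed
            qed
          qed
        qed
      qed
    qed
  qed
qed

end

theorem theorem1:
  "\<exists>(p :: prog) (T :: nat \<Rightarrow> nat) (k :: nat).
     (\<lambda>n. real (T n)) \<in> O(\<lambda>n. real n) \<and>
     (\<forall>G :: (nat, nat) marriage. marriage_instance G \<and> numbered G \<longrightarrow>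
        (\<exists>t s. exec ((input_size G + 2) ^ k) p (input_state G) t s \<and>
               t \<le> T (input_size G) \<and> correct_output G s))"
proof (rule exI[of _ algorithm], rule exI[of _ "\<lambda>n. 3000 * n + 1000"], rule exI[of _ 7],
    intro conjI allI impI)
  show "(\<lambda>n. real (3000 * n + 1000)) \<in> O(\<lambda>n. real n)"
    by (rule bigoI[of _ 4000]) (auto intro!: eventually_sequentiallyI[of 1])
  fix G :: "(nat, nat) marriage" assume G: "marriage_instance G \<and> numbered G"
  have "20 * (input_size G + 2) * (input_size G + 2) \<le> (input_size G + 2) ^ 7"
  proof -
    let ?m = "input_size G + 2"
    \<comment> \<open>The exponent 7 is 2 for the quadratic bound plus 5 to absorb the factor 20,
      since the base is at least 2 and 2 to the fifth is 32.\<close>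
    have "20 \<le> (2 :: nat) ^ 5" by simp
    also have "\<dots> \<le> ?m ^ 5" by (rule power_mono) auto
    finally have "20 * (?m * ?m) \<le> ?m ^ 5 * (?m * ?m)" by (rule mult_le_mono1)
    also have "\<dots> = ?m ^ (5 + 2)" by (simp only: power_add power2_eq_square)
    finally show ?thesis by (simp only: mult.assoc numeral_plus_numeral add_num_simps)
  qed
  then interpret ram G "(input_size G + 2) ^ 7"
    using G by unfold_locales auto
  show "\<exists>t s. exec ((input_size G + 2) ^ 7) algorithm (input_state G) t s \<and>
      t \<le> 3000 * input_size G + 1000 \<and> correct_output G s"
    using wp_algorithm unfolding wp_def .
qed

end
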